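(* Let $G$ be a Garside group of finite type. Given $x,y\in G$, Algorithm 3 (written out in the context) terminates and solves the conjugacy decision problem and the conjugacy search problem for $x$ and $y$: if $x$ and $y$ are conjugate in $G$, it returns `$x$ and $y$ are conjugate by $c$' with an element $c\in G$ such that $c^{-1}xc=y$, and if $x$ and $y$ are not conjugate in $G$, it returns `$x$ and $y$ are not conjugate'.
   Context: Garside groups. Let $G$ be a group, $P\subseteq G$ a submonoid with $P\cap P^{-1}=\{1\}$ (its elements are called positive) and $\Delta\in P$. $(G,P,\Delta)$ is a Garside structure if: (1) the left-invariant partial order $a\preccurlyeq b\Leftrightarrow a^{-1}b\in P$ is a lattice order on $G$, with gcd $a\wedge b$ and lcm $a\vee b$; (2) the set $[1,\Delta]=\{s\in G: 1\preccurlyeq s\preccurlyeq\Delta\}$ of simple elements generates $G$; (3) $\Delta^{-1}P\Delta=P$; (4) for all $x\in P\setminus\{1\}$, $\|x\|=\sup\{k: x=a_1\cdots a_k,\ a_i\in P\setminus\{1\}\}<\infty$. It is of finite type if $[1,\Delta]$ is finite. Throughout, $G\neq\{1\}$ is a group with a fixed Garside structure $(G,P,\Delta)$ of finite type. An atom is an element $a\in P\setminus\{1\}$ such that $a=bc$ with $b,c\in P$ implies $b=1$ or $c=1$; there are finitely many atoms $a_1,\dots,a_\lambda$. Notation: $x^c=c^{-1}xc$. $\inf(x)$ and $\sup(x)$ are the maximal and minimal integers, respectively, with $\Delta^{\inf(x)}\preccurlyeq x\preccurlyeq\Delta^{\sup(x)}$; $\ell(x)=\sup(x)-\inf(x)$.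 $\mathrm{SSS}(x)$ is the set of conjugates $y$ of $x$ such that $\inf(y)$ is maximal and $\sup(y)$ is minimal among all conjugates of $x$. The preferred prefix of $x$ is $\mathfrak p(x)=(x\Delta^{-\inf(x)})\wedge(x^{-1}\Delta^{\sup(x)})\wedge\Delta$ and the cyclic sliding of $x$ is $\mathfrak s(x)=x^{\mathfrak p(x)}$. $\mathrm{SC}(x)$ is the set of all conjugates $y$ of $x$ with $\mathfrak s^m(y)=y$ for some $m\ge 1$. Transport: for $x,\alpha\in G$, the transport of $\alpha$ at $x$ is $\alpha^{(1)}=\mathfrak p(x)^{-1}\alpha\,\mathfrak p(x^\alpha)$; $\alpha^{(0)}=\alpha$ and $\alpha^{(i)}=(\alpha^{(i-1)})^{(1)}$, the latter transport being taken at $\mathfrak s^{i-1}(x)$. Pullback: for $z\in\mathrm{SC}(x)$, $y=\mathfrak s(z)$ and $s\in P$, the pullback $s_{(1)}$ of $s$ at $y$ is the unique $\preccurlyeq$-minimal positive element such that $z^{s_{(1)}}\in\mathrm{SSS}(x)$ and $s\preccurlyeq (s_{(1)})^{(1)}$ (transport at $z$); $s_{(0)}=s$ and $s_{(k)}=(s_{(k-1)})_{(1)}$, the latter pullback being taken at the unique element $w$ in the sliding circuit of $y$ with $\mathfrak s^{k-1}(w)=y$. Algorithm 1 (input $x\in G$; output an element $\widetilde x\in\mathrm{SC}(x)$ and $c\in G$ with $x^c=\widetilde x$). 1. Set $\widetilde x=x$, $c=1$, $\mathcal T=\emptyset$. 2. While $\widetilde x\notin\mathcal T$, set $\mathcal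 T=\mathcal T\cup\{\widetilde x\}$, $c=c\cdot\mathfrak p(\widetilde x)$ and $\widetilde x=\mathfrak s(\widetilde x)$. 3. Set $y=\mathfrak s(\widetilde x)$ and $d=\mathfrak p(\widetilde x)$. 4. While $y\ne\widetilde x$, set $d=d\cdot\mathfrak p(y)$ and $y=\mathfrak s(y)$. 5. Return $\widetilde x$ and $c=c\,d^{-1}$. Algorithm 2 (input $v\in\mathrm{SC}(x)$; output a set $\mathcal A_v\subseteq P$; transports and pullbacks are at $v$). 1. Compute the minimal integer $N>0$ with $\mathfrak s^N(v)=v$. 2. List the atoms $a_1,\dots,a_\lambda$ of $G$. Set $\mathcal A_v=\emptyset$, $Atoms=\emptyset$. 3. For $t=1,\dots,\lambda$ do: (a) Set $s=a_t$. (b) While $\ell(v^s)>\ell(v)$, set $s=s\cdot(1\vee (v^s)^{-1}\Delta^{\inf(v)}\vee v^s\Delta^{-\sup(v)})$. (c) If $a_t\preccurlyeq\mathfrak p(v)$, compute the iterated $N$-fold pullbacks $s,s_{(N)},s_{(2N)},\dots$ until the first repetition, say $s_{(rN)}$, and set $s=s_{(rN)}$. (d) Compute the iterated $N$-fold transports $s,s^{(N)},s^{(2N)},\dots$ until the first repetition, say $s^{(jN)}$; let $i<j$ with $s^{(iN)}=s^{(jN)}$. (e) If $a_t\preccurlyeq s^{(mN)}$ for some $m$ with $i\le m<j$, then: if $a_k\not\preccurlyeq s^{(mN)}$ for all $k=1,\dots,\lambda$ such that $a_k\in Atoms$ or $k>t$, set $\mathcal A_v=\mathcal A_v\cup\{s^{(mN)}\}$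 and $Atoms=Atoms\cup\{a_t\}$. 4. Return $\mathcal A_v$. Algorithm 3 (input $x,y\in G$). 1. Use Algorithm 1 to compute $\widetilde x\in\mathrm{SC}(x)$, $\widetilde y\in\mathrm{SC}(y)$ and $c_1,c_2$ with $x^{c_1}=\widetilde x$, $y^{c_2}=\widetilde y$. 2. Set $\mathcal V=\{\widetilde x\}$, $\mathcal V'=\{\widetilde x\}$, $c_{\widetilde x}=1$. 3. While $\mathcal V'\ne\emptyset$ do: (a) take $v\in\mathcal V'$; (b) use Algorithm 2 to compute $\mathcal A_v$; (c) for every $s\in\mathcal A_v$ do: (i) if $v^s=\widetilde y$, set $c_{\widetilde y}=c_v\cdot s$, return `$x$ and $y$ are conjugate by $c_1\cdot c_{\widetilde y}\cdot c_2^{-1}$' and stop; (ii) if $v^s\notin\mathcal V$, set $c_{v^s}=c_v\cdot s$, $\mathcal V=\mathcal V\cup\{v^s\}$, $\mathcal V'=\mathcal V'\cup\{v^s\}$; (d) remove $v$ from $\mathcal V'$. 4. Return `$x$ and $y$ are not conjugate'. *)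

theory Defs
  imports
    "HOL-Algebra.Lattice"
    "HOL-Algebra.Generated_Groups"
    "HOL-Library.While_Combinator"
    "HOL-Library.Monad_Syntax"
begin

section \<open>Garside structures\<close>

definition prefix_order :: "('a, 'b) monoid_scheme \<Rightarrow> 'a set \<Rightarrow> 'a gorder" where
  "prefix_order G P = \<lparr>carrier = carrier G, eq = (=), le = (\<lambda>a b. inv\<^bsub>G\<^esub> a \<otimes>\<^bsub>G\<^esub> b \<in> P)\<rparr>"

locale garside_data =
  fixes G :: "('a, 'b) monoid_scheme" (structure) and P :: "'a set" and \<Delta> :: 'a
begin

abbreviation prefix (infix \<open>\<preceq>\<close> 50) where
  "a \<preceq> b \<equiv> a \<sqsubseteq>\<^bsub>prefix_order G P\<^esub> b"

abbreviation prefix_gcd (infixl \<open>\<triangle>\<close> 60) where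
  "a \<triangle> b \<equiv> a \<sqinter>\<^bsub>prefix_order G P\<^esub> b"

abbreviation prefix_lcm (infixl \<open>\<nabla>\<close> 60) where
  "a \<nabla> b \<equiv> a \<squnion>\<^bsub>prefix_order G P\<^esub> b"

definition simples :: "'a set" where
  "simples = {s \<in> carrier G. \<one> \<preceq> s \<and> s \<preceq> \<Delta>}"

definition atoms :: "'a set" where
  "atoms = {a \<in> P - {\<one>}. \<forall>b\<in>P. \<forall>c\<in>P. a = b \<otimes> c \<longrightarrow> b = \<one> \<or> c = \<one>}"

end

locale garside_structure = garside_data G P \<Delta> + group G + submonoid P G
  for G :: "('a, 'b) monoid_scheme" (structure) and P \<Delta> +
  assumes positive_inter_negative: "P \<inter> m_inv G ` P = {\<one>}"
    and Delta_positive: "\<Delta> \<in> P"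
    and lattice_order: "lattice (prefix_order G P)"
    and simples_generate: "generate G simples = carrier G"
    and Delta_conj_positive: "(\<lambda>p. inv \<Delta> \<otimes> p \<otimes> \<Delta>) ` P = P"
    and finite_norm: "x \<in> P - {\<one>} \<Longrightarrow>
      bdd_above {length as |as. set as \<subseteq> P - {\<one>} \<and> foldr (\<otimes>) as \<one> = x}"

locale garside_finite_type = garside_structure +
  assumes finite_simples: "finite simples"

section \<open>Conjugation and cyclic sliding\<close>

context garside_data
begin

definition conj_by :: "'a \<Rightarrow> 'a \<Rightarrow> 'a" (infixl \<open>\<star>\<close> 75) where
  "x \<star> c = inv c \<otimes> x \<otimes> c"

definition conjugates :: "'a \<Rightarrow> 'a set" where
  "conjugates x = {x \<star> c |c. c \<in> carrier G}"

definition infimum :: "'a \<Rightarrow> int" where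
  "infimum x = (GREATEST k. \<Delta> [^] k \<preceq> x)"

definition supremum :: "'a \<Rightarrow> int" where
  "supremum x = (LEAST k. x \<preceq> \<Delta> [^] k)"

definition canonical_length :: "'a \<Rightarrow> int" where
  "canonical_length x = supremum x - infimum x"

definition SSS :: "'a \<Rightarrow> 'a set" where
  "SSS x = {y \<in> conjugates x.
     \<forall>z \<in> conjugates x. infimum z \<le> infimum y \<and> supremum y \<le> supremum z}"

definition preferred_prefix :: "'a \<Rightarrow> 'a" where
  "preferred_prefix x =
     (x \<otimes> \<Delta> [^] (- infimum x)) \<triangle> (inv x \<otimes> \<Delta> [^] supremum x) \<triangle> \<Delta>"

definition slide :: "'a \<Rightarrow> 'a" where
  "slide x = x \<star> preferred_prefix x"

definition SC :: "'a \<Rightarrow> 'a set" where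
  "SC x = {y \<in> conjugates x. \<exists>m\<ge>1. (slide ^^ m) y = y}"

definition sliding_circuit :: "'a \<Rightarrow> 'a set" where
  "sliding_circuit y = range (\<lambda>i. (slide ^^ i) y)"

definition transport :: "'a \<Rightarrow> 'a \<Rightarrow> 'a" where
  "transport x \<alpha> = inv (preferred_prefix x) \<otimes> \<alpha> \<otimes> preferred_prefix (x \<star> \<alpha>)"

primrec iter_transport :: "'a \<Rightarrow> 'a \<Rightarrow> nat \<Rightarrow> 'a" where
  "iter_transport x \<alpha> 0 = \<alpha>"
| "iter_transport x \<alpha> (Suc i) = transport ((slide ^^ i) x) (iter_transport x \<alpha> i)"

text \<open>
  The pullback of \<open>s\<close> at \<open>y\<close> is formulated through the preimage \<open>z\<close> of \<open>y\<close> under sliding.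
  As \<open>SC\<close> and \<open>SSS\<close> depend only on the conjugacy class, no reference to the element whose
  sliding circuits are considered is needed.
\<close>

definition pullback_candidates :: "'a \<Rightarrow> 'a \<Rightarrow> 'a set" where
  "pullback_candidates z s = {u \<in> P. z \<star> u \<in> SSS z \<and> s \<preceq> transport z u}"

definition pullback :: "'a \<Rightarrow> 'a \<Rightarrow> 'a" where
  "pullback y s =
     (let z = (THE z. z \<in> SC y \<and> slide z = y)
      in THE u. u \<in> pullback_candidates z s \<and>
           (\<forall>u' \<in> pullback_candidates z s. u' \<preceq> u \<longrightarrow> u' = u))"

primrec iter_pullback :: "'a \<Rightarrow> 'a \<Rightarrow> nat \<Rightarrow> 'a" where
  "iter_pullback y s 0 = s"
| "iter_pullback y s (Suc k) =
     pullback (THE w. w \<in> sliding_circuit y \<and> (slide ^^ k) w = y) (iter_pullback y s k)"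

end

section \<open>The algorithms\<close>

text \<open>
  Computations live in the option monad, where \<open>None\<close> stands for divergence.
  Unbounded search diverges if there is nothing to be found.
\<close>

definition search :: "(nat \<Rightarrow> bool) \<Rightarrow> nat option" where
  "search Q = (if \<exists>n. Q n then Some (LEAST n. Q n) else None)"

definition first_repetition :: "(nat \<Rightarrow> 'c) \<Rightarrow> nat option" where
  "first_repetition f = search (\<lambda>j. \<exists>i<j. f i = f j)"

datatype 'c answer = Conjugate_by 'c | Not_conjugate

context garside_data
begin

subsection \<open>Finding an element of a sliding circuit\<close>

definition find_circuit :: "'a \<Rightarrow> ('a \<times> 'a) option" where
  "find_circuit x = do {
     (xt, c, T) \<leftarrow> while_option (\<lambda>(xt, c, T). xt \<notin> T)
       (\<lambda>(xt, c, T). (slide xt, c \<otimes> preferred_prefix xt, T \<union> {xt})) (x, \<one>, {});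
     (y, d) \<leftarrow> while_option (\<lambda>(y, d). y \<noteq> xt)
       (\<lambda>(y, d). (slide y, d \<otimes> preferred_prefix y)) (slide xt, preferred_prefix xt);
     Some (xt, c \<otimes> inv d)
   }"

subsection \<open>The set of arrows starting at a vertex\<close>

text \<open>
  The algorithm leaves open which index \<open>m\<close> is used when several are suitable; \<open>pick_index v a M\<close>
  is the choice made from the set \<open>M\<close> of suitable indices while processing the atom \<open>a\<close> at \<open>v\<close>.
  The list \<open>as\<close> enumerates the atoms, indexed from 0.
\<close>

definition arrows_step ::
    "('a \<Rightarrow> 'a \<Rightarrow> nat set \<Rightarrow> nat) \<Rightarrow> 'a list \<Rightarrow> 'a \<Rightarrow> nat \<Rightarrow> nat \<Rightarrow> 'a set \<times> 'a set \<Rightarrow> ('a set \<times> 'a set) option"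
  where
  "arrows_step pick_index as v N t = (\<lambda>(A, Atoms). do {
     s \<leftarrow> while_option (\<lambda>s. canonical_length (v \<star> s) > canonical_length v)
       (\<lambda>s. s \<otimes> (\<one> \<nabla> inv (v \<star> s) \<otimes> \<Delta> [^] infimum v \<nabla> (v \<star> s) \<otimes> \<Delta> [^] (- supremum v))) (as ! t);
     s \<leftarrow> (if as ! t \<preceq> preferred_prefix v
          then do {
            r \<leftarrow> first_repetition (\<lambda>i. iter_pullback v s (i * N));
            Some (iter_pullback v s (r * N))
          }
          else Some s);
     j \<leftarrow> first_repetition (\<lambda>i. iter_transport v s (i * N));
     let i = (THE i. i < j \<and> iter_transport v s (i * N) = iter_transport v s (j * N));
     let M = {m. i \<le> m \<and> m < j \<and> as ! t \<preceq> iter_transport v s (m * N)};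
     let u = iter_transport v s (pick_index v (as ! t) M * N);
     Some (if M \<noteq> {} \<and> (\<forall>k < length as. as ! k \<in> Atoms \<or> k > t \<longrightarrow> \<not> as ! k \<preceq> u)
       then (A \<union> {u}, Atoms \<union> {as ! t}) else (A, Atoms))
   })"

primrec arrows_loop ::
    "('a \<Rightarrow> 'a \<Rightarrow> nat set \<Rightarrow> nat) \<Rightarrow> 'a list \<Rightarrow> 'a \<Rightarrow> nat \<Rightarrow> nat list \<Rightarrow> 'a set \<times> 'a set \<Rightarrow> ('a set \<times> 'a set) option"
  where
  "arrows_loop pick_index as v N [] st = Some st"
| "arrows_loop pick_index as v N (t # ts) st = do {
     st' \<leftarrow> arrows_step pick_index as v N t st;
     arrows_loop pick_index as v N ts st'
   }"

definition arrows :: "('a \<Rightarrow> 'a \<Rightarrow> nat set \<Rightarrow> nat) \<Rightarrow> 'a list \<Rightarrow> 'a \<Rightarrow> 'a set option" where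
  "arrows pick_index as v = do {
     N \<leftarrow> search (\<lambda>n. n > 0 \<and> (slide ^^ n) v = v);
     (A, Atoms) \<leftarrow> arrows_loop pick_index as v N [0..<length as] ({}, {});
     Some A
   }"

subsection \<open>Exploring the graph of sliding circuits\<close>

text \<open>
  A state \<open>(V, V', c)\<close> consists of the visited vertices, those still to be processed, and the known
  conjugating elements. The result \<open>Inl g\<close> means that the target \<open>yt\<close> has been reached with
  conjugating element \<open>g\<close>.
\<close>

fun visit ::
    "'a \<Rightarrow> 'a \<Rightarrow> 'a list \<Rightarrow> 'a set \<times> 'a set \<times> ('a \<Rightarrow> 'a) \<Rightarrow> 'a + 'a set \<times> 'a set \<times> ('a \<Rightarrow> 'a)"
  where
  "visit yt v [] st = Inr st"
| "visit yt v (s # ss) (V, V', c) =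
     (if v \<star> s = yt then Inl (c v \<otimes> s)
      else if v \<star> s \<notin> V
      then visit yt v ss (V \<union> {v \<star> s}, V' \<union> {v \<star> s}, c(v \<star> s := c v \<otimes> s))
      else visit yt v ss (V, V', c))"

text \<open>
  \<open>pick V'\<close> is the vertex taken from \<open>V'\<close>, and \<open>enum v A\<close> the order in which the set \<open>A\<close> of arrows at
  \<open>v\<close> is traversed. Letting \<open>pick\<close> depend on \<open>V'\<close> alone loses no behaviour: a vertex removed from
  \<open>V'\<close> never returns, so that the same nonempty \<open>V'\<close> is never met twice in a run. Likewise each \<open>v\<close> is
  processed at most once.
\<close>

partial_function (option) explore ::
    "('a set \<Rightarrow> 'a) \<Rightarrow> ('a \<Rightarrow> 'a \<Rightarrow> nat set \<Rightarrow> nat) \<Rightarrow> ('a \<Rightarrow> 'a set \<Rightarrow> 'a list) \<Rightarrow> 'a list \<Rightarrow> 'a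
      \<Rightarrow> 'a set \<Rightarrow> 'a set \<Rightarrow> ('a \<Rightarrow> 'a) \<Rightarrow> 'a answer option"
  where
  "explore pick pick_index enum as yt V V' c =
     (if V' = {} then Some Not_conjugate
      else do {
        let v = pick V';
        A \<leftarrow> arrows pick_index as v;
        (case visit yt v (enum v A) (V, V', c) of
          Inl g \<Rightarrow> Some (Conjugate_by g)
        | Inr (V\<^sub>1, V\<^sub>1', c\<^sub>1) \<Rightarrow> explore pick pick_index enum as yt V\<^sub>1 (V\<^sub>1' - {v}) c\<^sub>1)
      })"

definition solve_conjugacy ::
    "('a set \<Rightarrow> 'a) \<Rightarrow> ('a \<Rightarrow> 'a \<Rightarrow> nat set \<Rightarrow> nat) \<Rightarrow> ('a \<Rightarrow> 'a set \<Rightarrow> 'a list) \<Rightarrow> 'a list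
      \<Rightarrow> 'a \<Rightarrow> 'a \<Rightarrow> 'a answer option"
  where
  "solve_conjugacy pick pick_index enum as x y = do {
     (xt, c\<^sub>1) \<leftarrow> find_circuit x;
     (yt, c\<^sub>2) \<leftarrow> find_circuit y;
     answer \<leftarrow> explore pick pick_index enum as yt {xt} {xt} ((\<lambda>_. undefined)(xt := \<one>));
     Some (case answer of
       Conjugate_by g \<Rightarrow> Conjugate_by (c\<^sub>1 \<otimes> g \<otimes> inv c\<^sub>2)
     | Not_conjugate \<Rightarrow> Not_conjugate)
   }"

end

end

theory Submission
  imports Defs
begin

text \<open>
  Fix \<open>v\<close> in a sliding circuit. In terms of conjugators \<open>c\<close> of \<open>v\<close>, cyclic sliding is the map
  \<open>c \<mapsto> A c \<triangle> B c \<triangle> D c\<close>, where \<open>A c = v c \<Delta>\<^bsup>- inf v\<^esup>\<close>, \<open>B c = v\<^sup>-\<^sup>1 c \<Delta>\<^bsup>sup v\<^esup>\<close> and \<open>D c = c \<Delta>\<close> are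
  commuting automorphisms of the lattice \<open>G\<close>, and \<open>v \<star> c\<close> lies in the super summit set iff
  \<open>c \<preceq> A c\<close> and \<open>c \<preceq> B c\<close>. Hence transport preserves the order and meets. Along a full circuit it
  acts on the positive \<open>c\<close> with \<open>v \<star> c\<close> in the super summit set, and the \<open>c\<close> with \<open>v \<star> c\<close> in a
  sliding circuit are its periodic points; they are closed under meets, so every nontrivial one is
  a product of minimal ones. Iterated pullback is the lower adjoint of iterated transport. These
  two facts show that Algorithm 2 finds all minimal elements, so that the exploration reaches
  every conjugate of \<open>v\<close> in a sliding circuit.
\<close>

text \<open>For a single map to act on all conjugators, infimum and supremum must be constant along
  the conjugates in play. Sliding circuits therefore have to be placed inside the super summit set
  before transport can be studied, and that step has to argue with the sliding map on conjugators
  alone. The second obstacle is that iterated transport could collapse a nontrivial element to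
  \<open>\<one>\<close>, so that the least super summit conjugator above an atom \<open>a\<close>
  would no longer lead to the minimal element above \<open>a\<close>. If \<open>a\<close> is not a
  prefix of \<open>preferred_prefix v\<close>, the collapse is impossible; if it is, repeated
  pullback first yields an element that increases under transport along the period of the pullback
  sequence, and so cannot collapse. Finiteness comes from order intervals being finite; for orbits
  of transport and pullback the bounds are powers of \<open>\<Delta>\<close>, which transport
  fixes.\<close>

locale garside_nontrivial = garside_finite_type +
  assumes nontrivial: "carrier G \<noteq> {\<one>}"

section \<open>The lattice of a Garside structure\<close>

context garside_structure
begin

lemma le_iff: "a \<preceq> b \<longleftrightarrow> inv a \<otimes> b \<in> P"
  by (simp add: prefix_order_def)

lemma positive_carrier [simp, intro]: "a \<in> P \<Longrightarrow> a \<in> carrier G"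
  using subset by auto

lemma Delta_carrier [simp, intro]: "\<Delta> \<in> carrier G"
  using Delta_positive by auto

lemma one_le_iff: "a \<in> carrier G \<Longrightarrow> \<one> \<preceq> a \<longleftrightarrow> a \<in> P"
  by (simp add: le_iff)

lemma
  shows le_refl [simp]: "a \<in> carrier G \<Longrightarrow> a \<preceq> a"
    and le_trans: "a \<preceq> b \<Longrightarrow> b \<preceq> c \<Longrightarrow> a \<in> carrier G \<Longrightarrow> b \<in> carrier G \<Longrightarrow> c \<in> carrier G
      \<Longrightarrow> a \<preceq> c"
    and le_antisym: "a \<preceq> b \<Longrightarrow> b \<preceq> a \<Longrightarrow> a \<in> carrier G \<Longrightarrow> b \<in> carrier G \<Longrightarrow> a = b"
    and meet_closed [simp, intro]: "a \<in> carrier G \<Longrightarrow> b \<in> carrier G \<Longrightarrow> a \<triangle> b \<in> carrier G"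
    and meet_left: "a \<in> carrier G \<Longrightarrow> b \<in> carrier G \<Longrightarrow> a \<triangle> b \<preceq> a"
    and meet_right: "a \<in> carrier G \<Longrightarrow> b \<in> carrier G \<Longrightarrow> a \<triangle> b \<preceq> b"
    and meet_greatest: "c \<preceq> a \<Longrightarrow> c \<preceq> b \<Longrightarrow> a \<in> carrier G \<Longrightarrow> b \<in> carrier G \<Longrightarrow> c \<in> carrier G
      \<Longrightarrow> c \<preceq> a \<triangle> b"
    and join_closed [simp, intro]: "a \<in> carrier G \<Longrightarrow> b \<in> carrier G \<Longrightarrow> a \<nabla> b \<in> carrier G"
    and join_left: "a \<in> carrier G \<Longrightarrow> b \<in> carrier G \<Longrightarrow> a \<preceq> a \<nabla> b"
    and join_right: "a \<in> carrier G \<Longrightarrow> b \<in> carrier G \<Longrightarrow> b \<preceq> a \<nabla> b"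
    and join_least: "a \<preceq> c \<Longrightarrow> b \<preceq> c \<Longrightarrow> a \<in> carrier G \<Longrightarrow> b \<in> carrier G \<Longrightarrow> c \<in> carrier G
      \<Longrightarrow> a \<nabla> b \<preceq> c"
proof -
  interpret prefix: lattice "prefix_order G P"
    by (rule lattice_order)
  have [simp]: "carrier (prefix_order G P) = carrier G"
    by (simp add: prefix_order_def)
  show "a \<in> carrier G \<Longrightarrow> a \<preceq> a" by simp
  show "a \<preceq> b \<Longrightarrow> b \<preceq> c \<Longrightarrow> a \<in> carrier G \<Longrightarrow> b \<in> carrier G \<Longrightarrow> c \<in> carrier G \<Longrightarrow> a \<preceq> c"
    using prefix.le_trans by simp
  show "a \<preceq> b \<Longrightarrow> b \<preceq> a \<Longrightarrow> a \<in> carrier G \<Longrightarrow> b \<in> carrier G \<Longrightarrow> a = b"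
    using prefix.le_antisym by simp
  show "a \<in> carrier G \<Longrightarrow> b \<in> carrier G \<Longrightarrow> a \<triangle> b \<in> carrier G"
    using prefix.meet_closed by simp
  show "a \<in> carrier G \<Longrightarrow> b \<in> carrier G \<Longrightarrow> a \<triangle> b \<preceq> a"
    using prefix.meet_left by simp
  show "a \<in> carrier G \<Longrightarrow> b \<in> carrier G \<Longrightarrow> a \<triangle> b \<preceq> b"
    using prefix.meet_right by simp
  show "c \<preceq> a \<Longrightarrow> c \<preceq> b \<Longrightarrow> a \<in> carrier G \<Longrightarrow> b \<in> carrier G \<Longrightarrow> c \<in> carrier G \<Longrightarrow> c \<preceq> a \<triangle> b"
    using prefix.meet_le by simp
  show "a \<in> carrier G \<Longrightarrow> b \<in> carrier G \<Longrightarrow> a \<nabla> b \<in> carrier G"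
    using prefix.join_closed by simp
  show "a \<in> carrier G \<Longrightarrow> b \<in> carrier G \<Longrightarrow> a \<preceq> a \<nabla> b"
    using prefix.join_left by simp
  show "a \<in> carrier G \<Longrightarrow> b \<in> carrier G \<Longrightarrow> b \<preceq> a \<nabla> b"
    using prefix.join_right by simp
  show "a \<preceq> c \<Longrightarrow> b \<preceq> c \<Longrightarrow> a \<in> carrier G \<Longrightarrow> b \<in> carrier G \<Longrightarrow> c \<in> carrier G \<Longrightarrow> a \<nabla> b \<preceq> c"
    using prefix.join_le by simp
qed

lemma le_meet_iff [simp]:
  assumes "a \<in> carrier G" "b \<in> carrier G" "c \<in> carrier G"
  shows "c \<preceq> a \<triangle> b \<longleftrightarrow> c \<preceq> a \<and> c \<preceq> b"
  using assms meet_left[of a b] meet_right[of a b] meet_greatest[of c a b]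
    le_trans[of c "a \<triangle> b" a]
    le_trans[of c "a \<triangle> b" b] by auto

lemma join_le_iff [simp]:
  assumes "a \<in> carrier G" "b \<in> carrier G" "c \<in> carrier G"
  shows "a \<nabla> b \<preceq> c \<longleftrightarrow> a \<preceq> c \<and> b \<preceq> c"
  using assms join_left[of a b] join_right[of a b] join_least[of a c b]
    le_trans[of a "a \<nabla> b" c]
    le_trans[of b "a \<nabla> b" c] by auto

lemma meet_mono:
  assumes "a \<preceq> a'" "b \<preceq> b'" "a \<in> carrier G" "b \<in> carrier G" "a' \<in> carrier G" "b' \<in> carrier G"
  shows "a \<triangle> b \<preceq> a' \<triangle> b'"
  using assms meet_left[of a b] meet_right[of a b]
    le_trans[of "a \<triangle> b" a a'] le_trans[of "a \<triangle> b" b b'] by simp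

lemma inv_mult_cancel [simp]:
  "a \<in> carrier G \<Longrightarrow> b \<in> carrier G \<Longrightarrow> inv a \<otimes> (a \<otimes> b) = b"
  "a \<in> carrier G \<Longrightarrow> b \<in> carrier G \<Longrightarrow> a \<otimes> (inv a \<otimes> b) = b"
  by (simp_all add: m_assoc[symmetric])

lemma mult_le_iff [simp]:
  assumes "g \<in> carrier G" "a \<in> carrier G" "b \<in> carrier G"
  shows "g \<otimes> a \<preceq> g \<otimes> b \<longleftrightarrow> a \<preceq> b"
  using assms by (simp add: le_iff inv_mult_group m_assoc)

lemma le_mult_positive: "g \<in> carrier G \<Longrightarrow> a \<in> P \<Longrightarrow> g \<preceq> g \<otimes> a"
  by (simp add: le_iff)

lemma Delta_conj_positive_iff:
  assumes "g \<in> carrier G"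
  shows "inv \<Delta> \<otimes> g \<otimes> \<Delta> \<in> P \<longleftrightarrow> g \<in> P"
proof
  assume "inv \<Delta> \<otimes> g \<otimes> \<Delta> \<in> P"
  then have "inv \<Delta> \<otimes> g \<otimes> \<Delta> \<in> (\<lambda>p. inv \<Delta> \<otimes> p \<otimes> \<Delta>) ` P"
    by (subst Delta_conj_positive)
  then obtain p where p: "p \<in> P" "inv \<Delta> \<otimes> g \<otimes> \<Delta> = inv \<Delta> \<otimes> p \<otimes> \<Delta>"
    by blast
  with assms show "g \<in> P" by (simp add: m_assoc)
next
  assume "g \<in> P"
  then have "inv \<Delta> \<otimes> g \<otimes> \<Delta> \<in> (\<lambda>p. inv \<Delta> \<otimes> p \<otimes> \<Delta>) ` P"
    by (rule imageI)
  then show "inv \<Delta> \<otimes> g \<otimes> \<Delta> \<in> P"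
    by (subst (asm) Delta_conj_positive)
qed

text \<open>The order is left invariant by definition; for right multiplication by
  \<open>\<Delta>\<close>, invariance is the axiom that conjugation by \<open>\<Delta>\<close>
  preserves \<open>P\<close>.\<close>

lemma mult_Delta_le_iff:
  assumes "a \<in> carrier G" "b \<in> carrier G"
  shows "a \<otimes> \<Delta> \<preceq> b \<otimes> \<Delta> \<longleftrightarrow> a \<preceq> b"
  using assms Delta_conj_positive_iff[of "inv a \<otimes> b"] by (simp add: le_iff inv_mult_group m_assoc)

lemma Delta_pow_add:
  "\<Delta> [^] (j + k :: int) = \<Delta> [^] j \<otimes> \<Delta> [^] k"
  by (simp add: int_pow_mult)

lemma mult_Delta_pow_le_iff [simp]:
  fixes k :: int
  assumes "a \<in> carrier G" "b \<in> carrier G"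
  shows "a \<otimes> \<Delta> [^] k \<preceq> b \<otimes> \<Delta> [^] k \<longleftrightarrow> a \<preceq> b"
proof (induction k rule: int_induct[where k = 0])
  case base
  with assms show ?case by simp
next
  case (step1 i)
  with assms show ?case
    using mult_Delta_le_iff[of "a \<otimes> \<Delta> [^] i" "b \<otimes> \<Delta> [^] i"]
    by (simp add: Delta_pow_add m_assoc)
next
  case (step2 i)
  have "g \<otimes> \<Delta> [^] i = g \<otimes> \<Delta> [^] (i - 1) \<otimes> \<Delta>" if "g \<in> carrier G" for g
    using that Delta_pow_add[of "i - 1" 1] by (simp add: m_assoc)
  with step2 assms show ?case
    using mult_Delta_le_iff[of "a \<otimes> \<Delta> [^] (i - 1)" "b \<otimes> \<Delta> [^] (i - 1)"] by simp
qed

lemma Delta_pow_mono: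
  assumes "j \<le> (k :: int)"
  shows "\<Delta> [^] j \<preceq> \<Delta> [^] k"
proof -
  have "\<Delta> [^] n \<in> P" for n :: nat
    by (induction n) (auto simp: Delta_positive)
  then have "\<Delta> [^] (k - j) \<in> P"
    using assms by (metis int_pow_int zle_diff1_eq zero_le_imp_eq_int diff_ge_0_iff_ge)
  then show ?thesis
    using Delta_pow_add[of j "k - j"] le_mult_positive[of "\<Delta> [^] j"] by simp
qed

text \<open>Left translation and right multiplication by a power of \<open>\<Delta>\<close> are
  order automorphisms. Their composites form a group with exponents adding up, and every term in the
  preferred prefix of a conjugate becomes one of them.\<close>

definition shift :: "'a \<Rightarrow> int \<Rightarrow> 'a \<Rightarrow> 'a" where
  "shift x k a = x \<otimes> a \<otimes> \<Delta> [^] k"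

lemma shift_closed [simp, intro]:
  "x \<in> carrier G \<Longrightarrow> a \<in> carrier G \<Longrightarrow> shift x k a \<in> carrier G"
  by (simp add: shift_def)

lemma shift_le_iff [simp]:
  assumes "x \<in> carrier G" "a \<in> carrier G" "b \<in> carrier G"
  shows "shift x k a \<preceq> shift x k b \<longleftrightarrow> a \<preceq> b"
  using assms by (simp add: shift_def)

lemma shift_shift [simp]:
  assumes "x \<in> carrier G" "y \<in> carrier G" "a \<in> carrier G"
  shows "shift x j (shift y k a) = shift (x \<otimes> y) (k + j) a"
  using assms by (simp add: shift_def m_assoc Delta_pow_add)

lemma shift_one_zero [simp]: "a \<in> carrier G \<Longrightarrow> shift \<one> 0 a = a"
  by (simp add: shift_def)

lemma shift_adjoint:
  assumes "x \<in> carrier G" "a \<in> carrier G" "b \<in> carrier G"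
  shows "shift (inv x) (- k) a \<preceq> b \<longleftrightarrow> a \<preceq> shift x k b"
  using assms shift_le_iff[of x "shift (inv x) (- k) a" b k] by (simp del: shift_le_iff)

lemma shift_meet:
  assumes "x \<in> carrier G" "a \<in> carrier G" "b \<in> carrier G"
  shows "shift x k (a \<triangle> b) = shift x k a \<triangle> shift x k b"
proof (rule le_antisym)
  have "shift (inv x) (- k) (shift x k a \<triangle> shift x k b) \<preceq> a \<triangle> b"
    using assms meet_left[of "shift x k a" "shift x k b"]
      meet_right[of "shift x k a" "shift x k b"]
    by (auto simp: shift_adjoint simp del: shift_shift)
  then show "shift x k a \<triangle> shift x k b \<preceq> shift x k (a \<triangle> b)"
    using assms by (simp add: shift_adjoint del: le_meet_iff)
qed (use assms meet_left meet_right in auto)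

lemma le_shift_one:
  assumes "a \<in> carrier G" "0 \<le> k"
  shows "a \<preceq> shift \<one> k a"
  using assms Delta_pow_mono[of 0 k] by (simp add: shift_def le_iff)

lemma shift_one_mono:
  assumes "a \<in> carrier G" "j \<le> k"
  shows "shift \<one> j a \<preceq> shift \<one> k a"
  using assms le_shift_one[of "shift \<one> j a" "k - j"] by simp

text \<open>Membership of a conjugate in the super summit set amounts to two inequalities of this
  form; this gives closure of the conjugators under meets.\<close>

lemma le_shift_meet:
  assumes "x \<in> carrier G" "a \<in> carrier G" "b \<in> carrier G"
    "a \<preceq> shift x k a" "b \<preceq> shift x k b"
  shows "a \<triangle> b \<preceq> shift x k (a \<triangle> b)"
  using assms by (simp add: shift_meet meet_mono del: le_meet_iff)

lemma Delta_bounds: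
  assumes "g \<in> carrier G"
  shows "\<exists>k\<ge>0. \<Delta> [^] (- k) \<preceq> g \<and> g \<preceq> \<Delta> [^] (k :: int)"
proof -
  have simple: "s \<in> carrier G" "\<one> \<preceq> s" "s \<preceq> \<Delta>" if "s \<in> simples" for s
    using that by (auto simp: simples_def)
  have "g \<in> generate G simples"
    using assms simples_generate by simp
  then show ?thesis
  proof induction
    case one
    show ?case by (intro exI[of _ 0]) simp
  next
    case (incl h)
    have "\<Delta> [^] (- 1 :: int) \<preceq> \<one>" using Delta_pow_mono[of "-1" 0] by simp
    with simple[OF incl] show ?case
      using le_trans[of "\<Delta> [^] (- 1 :: int)" \<one> h] by (intro exI[of _ 1]) auto
  next
    case (inv h)
    note s = simple[OF inv]
    have "inv h \<preceq> \<one>"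
      using s mult_le_iff[of h "inv h" \<one>] by simp
    moreover have "\<one> \<preceq> \<Delta>" by (simp add: one_le_iff Delta_positive)
    \<comment> \<open>\<open>\<Delta> \<otimes> inv h\<close> is conjugate by
      \<open>\<Delta>\<close> to the complement \<open>inv h \<otimes> \<Delta>\<close>, which is
      positive because \<open>h\<close> is simple.\<close>
    moreover have "\<Delta> [^] (- 1 :: int) \<preceq> inv h"
      using s Delta_conj_positive_iff[of "\<Delta> \<otimes> inv h"]
      by (simp add: le_iff m_assoc int_pow_neg)
    ultimately show ?case
      using s le_trans[of "inv h" \<one> \<Delta>] by (intro exI[of _ 1]) auto
  next
    case (eng h1 h2)
    have c: "h1 \<in> carrier G" "h2 \<in> carrier G"
      using eng simples_generate by auto
    obtain j k where j: "j \<ge> 0" "\<Delta> [^] (- j) \<preceq> h1" "h1 \<preceq> \<Delta> [^] (j :: int)"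
      and k: "k \<ge> 0" "\<Delta> [^] (- k) \<preceq> h2" "h2 \<preceq> \<Delta> [^] (k :: int)"
      using eng.IH by auto
    have "h1 \<otimes> h2 \<preceq> h1 \<otimes> \<Delta> [^] k" "h1 \<otimes> \<Delta> [^] k \<preceq> \<Delta> [^] j \<otimes> \<Delta> [^] k"
      "h1 \<otimes> \<Delta> [^] (- k) \<preceq> h1 \<otimes> h2" "\<Delta> [^] (- j) \<otimes> \<Delta> [^] (- k) \<preceq> h1 \<otimes> \<Delta> [^] (- k)"
      using c j k by simp_all
    then have "\<Delta> [^] (- (j + k)) \<preceq> h1 \<otimes> h2 \<and> h1 \<otimes> h2 \<preceq> \<Delta> [^] (j + k)"
      using c le_trans[of "h1 \<otimes> h2" "h1 \<otimes> \<Delta> [^] k" "\<Delta> [^] (j + k)"]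
        le_trans[of "\<Delta> [^] (- (j + k))" "h1 \<otimes> \<Delta> [^] (- k)" "h1 \<otimes> h2"]
        Delta_pow_add[of "- j" "- k"]
      by (simp add: Delta_pow_add[symmetric])
    then show ?case using j k by (intro exI[of _ "j + k"]) auto
  qed
qed

end

lemma finite_range_repetition:
  fixes f :: "nat \<Rightarrow> 'c"
  assumes "finite (range f)"
  obtains i j where "i < j" "f i = f j"
proof -
  have "\<not> inj f"
    using assms finite_imageD infinite_UNIV_nat by blast
  then obtain i j where "i \<noteq> j" "f i = f j"
    by (auto simp: inj_def)
  then show ?thesis
    using that[of i j] that[of j i] by (cases "i < j") auto
qed

context garside_structure
begin

lemma mult_left_cancel [simp]:
  "x \<in> carrier G \<Longrightarrow> y \<in> carrier G \<Longrightarrow> z \<in> carrier G \<Longrightarrow> x \<otimes> y = x \<otimes> z \<longleftrightarrow> y = z"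
  using Units_l_cancel[of x y z] by simp

lemma conj_by_closed [simp, intro]: "x \<in> carrier G \<Longrightarrow> c \<in> carrier G \<Longrightarrow> x \<star> c \<in> carrier G"
  by (simp add: conj_by_def)

lemma conj_by_one [simp]: "x \<in> carrier G \<Longrightarrow> x \<star> \<one> = x"
  by (simp add: conj_by_def)

lemma conj_by_mult:
  "x \<in> carrier G \<Longrightarrow> c \<in> carrier G \<Longrightarrow> d \<in> carrier G \<Longrightarrow> x \<star> (c \<otimes> d) = x \<star> c \<star> d"
  by (simp add: conj_by_def inv_mult_group m_assoc)

lemma conj_by_inv: "x \<in> carrier G \<Longrightarrow> c \<in> carrier G \<Longrightarrow> inv (x \<star> c) = inv x \<star> c"
  by (simp add: conj_by_def inv_mult_group m_assoc)

lemma conj_by_cancel [simp]: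
  "x \<in> carrier G \<Longrightarrow> c \<in> carrier G \<Longrightarrow> x \<star> c \<star> inv c = x"
  by (simp flip: conj_by_mult)

lemma conj_by_commutes:
  "x \<in> carrier G \<Longrightarrow> c \<in> carrier G \<Longrightarrow> x \<star> c = x \<longleftrightarrow> x \<otimes> c = c \<otimes> x"
  using mult_left_cancel[of c "x \<star> c" x] by (auto simp: conj_by_def m_assoc simp del: mult_left_cancel)

text \<open>The two shifts commute because \<open>x\<close> and \<open>y\<close> do, so the order
  automorphism \<open>shift x j\<close> can be applied to both sides.\<close>

lemma le_shift_commute:
  assumes "x \<in> carrier G" "y \<in> carrier G" "a \<in> carrier G" "x \<otimes> y = y \<otimes> x" "a \<preceq> shift y k a"
  shows "shift x j a \<preceq> shift y k (shift x j a)"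
  using assms shift_le_iff[of x a "shift y k a" j] by (simp add: add.commute)

end

section \<open>Finiteness of intervals and stabilisation of bounded chains\<close>

context garside_finite_type
begin

text \<open>A positive \<open>g\<close> below the next power splits as \<open>s \<otimes> h\<close>,
  with \<open>s = g \<triangle> \<Delta>\<close> one of the finitely many simple elements and
  \<open>h\<close> below the previous power.\<close>

lemma finite_below_Delta_pow: "finite {g \<in> P. g \<preceq> \<Delta> [^] int n}"
proof (induction n)
  case 0
  have "{g \<in> P. g \<preceq> \<Delta> [^] int 0} \<subseteq> {\<one>}"
    using le_antisym one_le_iff by auto
  then show ?case
    using finite_subset by blast
next
  case (Suc n)
  have "g \<in> (\<lambda>(s, h). s \<otimes> h) ` (simples \<times> {h \<in> P. h \<preceq> \<Delta> [^] int n})"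
    if g: "g \<in> P" "g \<preceq> \<Delta> [^] int (Suc n)" for g
  proof -
    define s where "s = g \<triangle> \<Delta>"
    define h where "h = inv s \<otimes> g"
    have s: "s \<in> simples" "s \<in> carrier G" "s \<preceq> g"
      using g meet_left meet_right
      by (auto simp: s_def simples_def one_le_iff Delta_positive)
    have h: "h \<in> P" "s \<otimes> h = g"
      using s g by (auto simp: h_def le_iff[symmetric])
    have "\<Delta> \<otimes> \<Delta> [^] int n = \<Delta> [^] int (Suc n)"
      using Delta_pow_add[of 1 "int n"] by simp
    \<comment> \<open>The right side is the meet of \<open>g \<otimes> \<Delta> [^] int n\<close>
      and \<open>\<Delta> [^] int (Suc n)\<close>, and \<open>g\<close> lies below both.\<close>
    then have "g \<preceq> shift \<one> (int n) s"
      using g le_shift_one[of g "int n"] by (simp add: s_def shift_meet) (simp add: shift_def)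
    then have "s \<otimes> h \<preceq> s \<otimes> \<Delta> [^] int n"
      using h s by (simp add: shift_def del: mult_le_iff)
    then have "h \<preceq> \<Delta> [^] int n"
      using h(1) s by simp
    then show ?thesis
      using h s by force
  qed
  then have "{g \<in> P. g \<preceq> \<Delta> [^] int (Suc n)}
      \<subseteq> (\<lambda>(s, h). s \<otimes> h) ` (simples \<times> {h \<in> P. h \<preceq> \<Delta> [^] int n})"
    by blast
  then show ?case
    using Suc finite_simples finite_subset by blast
qed

text \<open>Left translation by \<open>inv a\<close> moves the interval among the positive elements
  below a power of \<open>\<Delta>\<close>.\<close>

lemma finite_interval:
  assumes a: "a \<in> carrier G" and b: "b \<in> carrier G"
  shows "finite {g \<in> carrier G. a \<preceq> g \<and> g \<preceq> b}"
proof -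
  obtain k where k: "k \<ge> 0" "inv a \<otimes> b \<preceq> \<Delta> [^] (k :: int)"
    using Delta_bounds[of "inv a \<otimes> b"] a b by auto
  have "g \<in> (\<otimes>) a ` {h \<in> P. h \<preceq> \<Delta> [^] int (nat k)}"
    if g: "g \<in> carrier G" "a \<preceq> g" "g \<preceq> b" for g
  proof (rule image_eqI)
    show "g = a \<otimes> (inv a \<otimes> g)"
      using g a by simp
    have "inv a \<otimes> g \<preceq> inv a \<otimes> b"
      using g a b by simp
    then show "inv a \<otimes> g \<in> {h \<in> P. h \<preceq> \<Delta> [^] int (nat k)}"
      using g a b k le_trans[of "inv a \<otimes> g" "inv a \<otimes> b" "\<Delta> [^] k"] by (simp add: le_iff[of a])
  qed
  then have "{g \<in> carrier G. a \<preceq> g \<and> g \<preceq> b} \<subseteq> (\<otimes>) a ` {h \<in> P. h \<preceq> \<Delta> [^] int (nat k)}"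
    by blast
  then show ?thesis
    using finite_below_Delta_pow finite_subset by blast
qed

lemma increasing_le:
  assumes "\<And>n. f n \<in> carrier G" "\<And>n. f n \<preceq> f (Suc n)" "m \<le> n"
  shows "f m \<preceq> f n"
  using assms(3)
proof (induction n rule: dec_induct)
  case base
  show ?case using assms(1) by simp
next
  case (step n)
  then show ?case using assms(1,2) le_trans by blast
qed

text \<open>A chain inside a finite interval takes some value twice, and antisymmetry makes it
  constant in between.\<close>

lemma increasing_stabilizes:
  assumes f: "\<And>n. f n \<in> carrier G" "\<And>n. f n \<preceq> f (Suc n)"
    and b: "b \<in> carrier G" "\<And>n. f n \<preceq> b"
  shows "\<exists>n. f (Suc n) = f n"
proof -
  have "range f \<subseteq> {g \<in> carrier G. f 0 \<preceq> g \<and> g \<preceq> b}"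
    using f b increasing_le[of f] by auto
  then have "finite (range f)"
    using finite_interval f(1) b(1) finite_subset by blast
  then obtain i j where "i < j" "f i = f j"
    using finite_range_repetition by blast
  then have "f (Suc i) \<preceq> f i"
    using increasing_le[of f "Suc i" j] f by simp
  then show ?thesis
    using f le_antisym by blast
qed

lemma decreasing_stabilizes:
  assumes f: "\<And>n. f n \<in> carrier G" "\<And>n. f (Suc n) \<preceq> f n"
    and b: "b \<in> carrier G" "\<And>n. b \<preceq> f n"
  shows "\<exists>n. f (Suc n) = f n"
proof -
  have le: "f n \<preceq> f m" if "m \<le> n" for m n
    using that
  proof (induction n rule: dec_induct)
    case base
    show ?case using f(1) by simp
  next
    case (step n)
    then show ?case using f le_trans by blast
  qed
  have "range f \<subseteq> {g \<in> carrier G. b \<preceq> g \<and> g \<preceq> f 0}"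
    using f b le by auto
  then have "finite (range f)"
    using finite_interval f(1) b(1) finite_subset by blast
  then obtain i j where "i < j" "f i = f j"
    using finite_range_repetition by blast
  then have "f i \<preceq> f (Suc i)"
    using le[of "Suc i" j] by simp
  then show ?thesis
    using f le_antisym by blast
qed

end

section \<open>Infimum, supremum and cyclic sliding\<close>

context garside_nontrivial
begin

text \<open>Here nontriviality of \<open>G\<close> enters: with \<open>\<Delta> = \<one>\<close> all
  powers would coincide, and the extremal exponents in \<open>infimum\<close> and
  \<open>supremum\<close> would not exist.\<close>

lemma Delta_ne_one: "\<Delta> \<noteq> \<one>"
proof
  assume D: "\<Delta> = \<one>"
  have "g = \<one>" if "g \<in> carrier G" for g
    using Delta_bounds[OF that] that le_antisym[of g \<one>] by (auto simp: D)
  then show False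
    using nontrivial by auto
qed

lemma Delta_pow_le_iff [simp]: "\<Delta> [^] j \<preceq> \<Delta> [^] k \<longleftrightarrow> j \<le> (k :: int)"
proof
  assume le: "\<Delta> [^] j \<preceq> \<Delta> [^] k"
  show "j \<le> k"
  proof (rule ccontr)
    assume "\<not> j \<le> k"
    then have "\<Delta> [^] (k + 1) \<preceq> \<Delta> [^] k"
      using le Delta_pow_mono[of "k + 1" j] le_trans[of "\<Delta> [^] (k + 1)" "\<Delta> [^] j"] by simp
    then have "\<Delta> [^] (k + 1) = \<Delta> [^] k"
      using Delta_pow_mono[of k "k + 1"] by (intro le_antisym) auto
    then have "\<Delta> [^] k \<otimes> \<Delta> = \<Delta> [^] k \<otimes> \<one>"
      using Delta_pow_add[of k 1] by simp
    then show False
      using Delta_ne_one by simp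
  qed
qed (rule Delta_pow_mono)

text \<open>Justifies the \<open>GREATEST\<close>: by \<open>Delta_bounds\<close> the admissible
  exponents are nonempty and bounded above. Later arguments use \<open>infimum\<close> only through
  this equivalence.\<close>

lemma le_infimum_iff:
  assumes "g \<in> carrier G"
  shows "k \<le> infimum g \<longleftrightarrow> \<Delta> [^] k \<preceq> g"
proof -
  obtain K where K: "\<Delta> [^] (- K) \<preceq> g" "g \<preceq> \<Delta> [^] (K :: int)"
    using Delta_bounds[OF assms] by auto
  \<comment> \<open>Cutting off exponents below \<open>- K\<close> makes the set finite without
    changing the maximum, as \<open>- K\<close> itself qualifies.\<close>
  let ?S = "{- K..K} \<inter> {k. \<Delta> [^] k \<preceq> g}"
  have le: "j \<le> K" if "\<Delta> [^] (j :: int) \<preceq> g" for j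
    using that K assms le_trans[of "\<Delta> [^] j" g "\<Delta> [^] K"] by simp
  have S: "finite ?S" "- K \<in> ?S"
    using K le[of "- K"] by auto
  have m: "\<Delta> [^] Max ?S \<preceq> g" "- K \<le> Max ?S"
    using Max_in[of ?S] Max_ge[of ?S "- K"] S by blast+
  have max: "j \<le> Max ?S" if "\<Delta> [^] j \<preceq> g" for j
  proof (cases "- K \<le> j")
    case True
    then show ?thesis
      using S le[OF that] that by (intro Max_ge) auto
  qed (use m in auto)
  have "infimum g = Max ?S"
    unfolding infimum_def by (rule Greatest_equality) (use m max in auto)
  with max[of k] show ?thesis
    using m(1) assms le_trans[of "\<Delta> [^] k" "\<Delta> [^] infimum g" g] by fastforce
qed

lemma inv_le_iff:
  fixes k :: int
  assumes "g \<in> carrier G"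
  shows "\<Delta> [^] k \<preceq> inv g \<longleftrightarrow> g \<preceq> \<Delta> [^] (- k)"
proof -
  have "\<Delta> [^] k \<preceq> inv g \<longleftrightarrow> \<Delta> [^] k \<otimes> \<Delta> [^] (- k) \<preceq> inv g \<otimes> \<Delta> [^] (- k)"
    using assms by simp
  also have "\<dots> \<longleftrightarrow> g \<otimes> \<one> \<preceq> g \<otimes> (inv g \<otimes> \<Delta> [^] (- k))"
    using assms by (subst mult_le_iff) (simp_all add: Delta_pow_add[symmetric])
  finally show ?thesis
    using assms by (simp del: mult_le_iff)
qed

lemma supremum_le_iff:
  assumes "g \<in> carrier G"
  shows "supremum g \<le> k \<longleftrightarrow> g \<preceq> \<Delta> [^] k"
proof -
  have *: "- infimum (inv g) \<le> j \<longleftrightarrow> g \<preceq> \<Delta> [^] j" for j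
    using le_infimum_iff[of "inv g" "- j"] inv_le_iff[of g "- j"] assms by auto
  have "supremum g = - infimum (inv g)"
    unfolding supremum_def by (rule Least_equality) (use * in auto)
  with * show ?thesis by simp
qed

text \<open>Inversion exchanges infimum and supremum and commutes with sliding; statements on
  suprema are obtained from those on infima by passing to the inverse.\<close>

lemma supremum_inv:
  assumes "g \<in> carrier G"
  shows "supremum (inv g) = - infimum g"
proof -
  have "supremum (inv g) \<le> k \<longleftrightarrow> - infimum g \<le> k" for k
    using assms supremum_le_iff[of "inv g" k] le_infimum_iff[of g "- k"] inv_le_iff[of "inv g" "- k"]
    by auto
  from this[of "supremum (inv g)"] this[of "- infimum g"] show ?thesis
    by simp
qed

lemma infimum_inv: "g \<in> carrier G \<Longrightarrow> infimum (inv g) = - supremum g"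
  using supremum_inv[of "inv g"] by simp

text \<open>Multiplying \<open>\<Delta> [^] k \<preceq> x \<star> a\<close> by \<open>a\<close> on
  the left removes the inverse, so that \<open>a\<close> is compared with its image under an order
  automorphism.\<close>

lemma le_infimum_conj_iff:
  assumes "x \<in> carrier G" "a \<in> carrier G"
  shows "k \<le> infimum (x \<star> a) \<longleftrightarrow> a \<preceq> shift x (- k) a"
proof -
  have "k \<le> infimum (x \<star> a) \<longleftrightarrow> a \<otimes> \<Delta> [^] k \<otimes> \<Delta> [^] (- k) \<preceq> a \<otimes> (x \<star> a) \<otimes> \<Delta> [^] (- k)"
    using assms by (simp add: le_infimum_iff)
  then show ?thesis
    using assms by (simp add: shift_def conj_by_def m_assoc Delta_pow_add[symmetric])
qed

lemma supremum_conj_le_iff: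
  assumes "x \<in> carrier G" "a \<in> carrier G"
  shows "supremum (x \<star> a) \<le> k \<longleftrightarrow> a \<preceq> shift (inv x) k a"
  using assms le_infimum_conj_iff[of "inv x" a "- k"] infimum_inv[of "x \<star> a"]
  by (simp add: conj_by_inv)

text \<open>The conjugator of \<open>slide (x \<star> a)\<close> when \<open>p\<close> and
  \<open>q\<close> are infimum and supremum of \<open>x \<star> a\<close>. In general these depend
  on \<open>a\<close>; where they are constant, sliding becomes the iteration of a single
  map.\<close>

definition slide_step :: "int \<Rightarrow> int \<Rightarrow> 'a \<Rightarrow> 'a \<Rightarrow> 'a" where
  "slide_step p q x a = shift x (- p) a \<triangle> shift (inv x) q a \<triangle> shift \<one> 1 a"

lemma slide_step_closed [simp, intro]:
  "x \<in> carrier G \<Longrightarrow> a \<in> carrier G \<Longrightarrow> slide_step p q x a \<in> carrier G"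
  by (simp add: slide_step_def)

lemma slide_step_mono:
  "x \<in> carrier G \<Longrightarrow> a \<in> carrier G \<Longrightarrow> b \<in> carrier G \<Longrightarrow> a \<preceq> b
    \<Longrightarrow> slide_step p q x a \<preceq> slide_step p q x b"
  unfolding slide_step_def by (intro meet_mono) simp_all

lemma slide_step_le:
  assumes "x \<in> carrier G" "a \<in> carrier G"
  shows "slide_step p q x a \<preceq> shift x (- p) a" "slide_step p q x a \<preceq> shift (inv x) q a"
    "slide_step p q x a \<preceq> shift \<one> 1 a"
proof -
  let ?s = "slide_step p q x a"
  have "?s \<preceq> ?s" using assms by simp
  then show "?s \<preceq> shift x (- p) a" "?s \<preceq> shift (inv x) q a" "?s \<preceq> shift \<one> 1 a"
    unfolding slide_step_def[of p q x a] using assms by (simp_all del: le_refl)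
qed

lemma le_slide_step_iff:
  "x \<in> carrier G \<Longrightarrow> a \<in> carrier G \<Longrightarrow> c \<in> carrier G \<Longrightarrow> c \<preceq> slide_step p q x a \<longleftrightarrow>
    c \<preceq> shift x (- p) a \<and> c \<preceq> shift (inv x) q a \<and> c \<preceq> shift \<one> 1 a"
  by (simp add: slide_step_def)

lemma preferred_prefix_closed [simp, intro]: "x \<in> carrier G \<Longrightarrow> preferred_prefix x \<in> carrier G"
  by (simp add: preferred_prefix_def)

lemma slide_closed [simp, intro]: "x \<in> carrier G \<Longrightarrow> slide x \<in> carrier G"
  by (simp add: slide_def)

lemma mult_meet:
  "g \<in> carrier G \<Longrightarrow> a \<in> carrier G \<Longrightarrow> b \<in> carrier G \<Longrightarrow> g \<otimes> (a \<triangle> b) = g \<otimes> a \<triangle> g \<otimes> b"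
  using shift_meet[of g a b 0] by (simp add: shift_def)

lemma mult_preferred_prefix:
  assumes "x \<in> carrier G" "a \<in> carrier G"
  shows "a \<otimes> preferred_prefix (x \<star> a) = slide_step (infimum (x \<star> a)) (supremum (x \<star> a)) x a"
proof -
  have "a \<otimes> (x \<star> a \<otimes> \<Delta> [^] j) = shift x j a" "a \<otimes> (inv (x \<star> a) \<otimes> \<Delta> [^] j) = shift (inv x) j a"
    for j :: int
    using assms by (simp_all add: shift_def conj_by_def m_assoc inv_mult_group)
  then show ?thesis
    using assms by (simp add: preferred_prefix_def slide_step_def mult_meet) (simp add: shift_def)
qed

lemma slide_conj:
  assumes "x \<in> carrier G" "a \<in> carrier G"
  shows "slide (x \<star> a) = x \<star> slide_step (infimum (x \<star> a)) (supremum (x \<star> a)) x a"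
  using assms by (simp add: slide_def conj_by_mult[symmetric] mult_preferred_prefix)

lemma meet_comm: "a \<triangle> b = b \<triangle> a"
  by (simp add: meet_def insert_commute)

lemma preferred_prefix_inv:
  "x \<in> carrier G \<Longrightarrow> preferred_prefix (inv x) = preferred_prefix x"
  by (simp add: preferred_prefix_def infimum_inv supremum_inv meet_comm[of "x \<otimes> _"])

lemma slide_inv: "x \<in> carrier G \<Longrightarrow> slide (inv x) = inv (slide x)"
  by (simp add: slide_def preferred_prefix_inv conj_by_inv)

text \<open>With \<open>p = infimum x\<close>, the inequality
  \<open>\<one> \<preceq> shift x (- p) \<one>\<close> is inherited by each of the three terms of
  \<open>slide_step\<close>, since the shifts commute, and then by their meet.\<close>

lemma infimum_slide:
  assumes x: "x \<in> carrier G"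
  shows "infimum x \<le> infimum (slide x)"
proof -
  let ?p = "infimum x" and ?q = "supremum x"
  have 1: "\<one> \<preceq> shift x (- ?p) \<one>"
    using x le_infimum_conj_iff[of x \<one> ?p] by simp
  have "slide_step ?p ?q x \<one> \<preceq> shift x (- ?p) (slide_step ?p ?q x \<one>)"
    unfolding slide_step_def using x 1
    by (intro le_shift_meet le_shift_commute) auto
  then show ?thesis
    using x le_infimum_conj_iff[of x _ ?p] slide_conj[of x \<one>] by simp
qed

lemma supremum_slide: "x \<in> carrier G \<Longrightarrow> supremum (slide x) \<le> supremum x"
  using infimum_slide[of "inv x"] by (simp add: slide_inv infimum_inv)

lemma slide_iter_closed [simp, intro]: "x \<in> carrier G \<Longrightarrow> (slide ^^ k) x \<in> carrier G"
  by (induction k) auto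

lemma infimum_slide_iter: "x \<in> carrier G \<Longrightarrow> infimum x \<le> infimum ((slide ^^ k) x)"
  by (induction k) (auto intro: order_trans[OF _ infimum_slide])

lemma supremum_slide_iter: "x \<in> carrier G \<Longrightarrow> supremum ((slide ^^ k) x) \<le> supremum x"
  by (induction k) (auto intro: order_trans[OF supremum_slide])

lemma slide_periodic:
  assumes "(slide ^^ m) x = x"
  shows "(slide ^^ (m * k + j)) x = (slide ^^ j) x"
proof (induction k)
  case (Suc k)
  have "(slide ^^ (m * Suc k + j)) x = (slide ^^ (m * k + j)) ((slide ^^ m) x)"
    by (simp add: add.commute add.left_commute flip: funpow_add comp_apply[of "slide ^^ _"])
  with Suc assms show ?case by simp
qed simp

text \<open>The infimum never drops under sliding and returns to its initial value, so it is
  constant.\<close>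

lemma periodic_infimum:
  assumes x: "x \<in> carrier G" and m: "(slide ^^ m) x = x" "m \<ge> 1"
  shows "infimum ((slide ^^ k) x) = infimum x"
proof -
  \<comment> \<open>The further slides complete the first \<open>k\<close> to a multiple of the
    period; \<open>m \<ge> 1\<close> keeps the subtraction exact.\<close>
  have "(slide ^^ (m * k - k)) ((slide ^^ k) x) = x"
    using m slide_periodic[OF m(1), of k 0] by (simp flip: funpow_add comp_apply[of "slide ^^ _"])
  then show ?thesis
    using infimum_slide_iter[OF x, of k] infimum_slide_iter[of "(slide ^^ k) x" "m * k - k"] x by simp
qed

lemma slide_iter_inv: "x \<in> carrier G \<Longrightarrow> (slide ^^ k) (inv x) = inv ((slide ^^ k) x)"
  by (induction k) (auto simp: slide_inv)

lemma periodic_supremum: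
  assumes x: "x \<in> carrier G" and m: "(slide ^^ m) x = x" "m \<ge> 1"
  shows "supremum ((slide ^^ k) x) = supremum x"
  using periodic_infimum[of "inv x" m k] assms by (simp add: slide_iter_inv infimum_inv)

end

section \<open>Sliding circuits lie in the super summit set\<close>

context garside_nontrivial
begin

text \<open>
  With \<open>A = shift x (- p)\<close>, \<open>B = shift (inv x) q\<close> and \<open>D = shift \<one> 1\<close>, sliding replaces a conjugator
  \<open>c\<close> by \<open>A c \<triangle> B c \<triangle> D c\<close>, and \<open>inf (x \<star> c) > p\<close> means \<open>D c \<preceq> A c\<close>. Suppose this holds for some
  positive \<open>b\<close>. If \<open>q - p \<le> 1\<close>, iterating the increasing map \<open>A\<^sup>-\<^sup>1 D\<close> at \<open>\<one>\<close> stays below \<open>b\<close>, so that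
  already \<open>D \<one> = A \<one>\<close>. If \<open>q - p \<ge> 2\<close>, the mixed terms are redundant because of \<open>A B = D\<^bsup>q - p\<^esup>\<close>, and
  it suffices to iterate \<open>A c \<triangle> D c\<close>, which comes within bounded distance of \<open>D\<^sup>n b\<close>.
\<close>

lemma periodic_infimum_max:
  assumes x: "x \<in> carrier G" and m: "(slide ^^ m) x = x" "m \<ge> 1" and a: "a \<in> carrier G"
  shows "infimum (x \<star> a) \<le> infimum x"
proof (rule ccontr)
  define p where "p = infimum x"
  define q where "q = supremum x"
  define A where "A = shift x (- p)"
  define D where "D = shift \<one> 1"
  assume "\<not> infimum (x \<star> a) \<le> infimum x"
  then have a_le: "a \<preceq> shift x (- (p + 1)) a"
    using le_infimum_conj_iff[of x a "p + 1"] x a by (simp add: p_def)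
  have not_le: "\<not> \<one> \<preceq> shift x (- (p + 1)) \<one>"
    using le_infimum_conj_iff[of x \<one> "p + 1"] x by (simp add: p_def)
  have A1: "\<one> \<preceq> A \<one>"
    using le_infimum_conj_iff[of x \<one> p] x by (simp add: p_def A_def)
  have B1: "\<one> \<preceq> shift (inv x) q \<one>"
    using supremum_conj_le_iff[of x \<one> q] x by (simp add: q_def)
  have closed [simp]: "A c \<in> carrier G" "D c \<in> carrier G" if "c \<in> carrier G" for c
    using that x by (simp_all add: A_def D_def)
  have le_iff' [simp]: "A c \<preceq> A d \<longleftrightarrow> c \<preceq> d" "D c \<preceq> D d \<longleftrightarrow> c \<preceq> d"
    if "c \<in> carrier G" "d \<in> carrier G" for c d
    using that x by (simp_all add: A_def D_def)
  have AD: "D c \<preceq> A c \<longleftrightarrow> c \<preceq> shift x (- (p + 1)) c" if "c \<in> carrier G" for c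
    using that x shift_le_iff[of \<one> c "shift x (- (p + 1)) c" 1] by (simp add: A_def D_def)

  obtain t where t: "\<Delta> [^] (- t :: int) \<preceq> a"
    using Delta_bounds[OF a] by auto
  \<comment> \<open>Right multiplication by a power of \<open>\<Delta>\<close> makes the conjugator
    positive and keeps the inequality, because the shifts commute.\<close>
  define b where "b = shift \<one> t a"
  have b: "b \<in> carrier G" "\<one> \<preceq> b"
    using a t mult_Delta_pow_le_iff[of "\<Delta> [^] (- t)" a t]
    by (simp_all add: b_def shift_def Delta_pow_add[symmetric] del: mult_Delta_pow_le_iff)
  have b_le: "b \<preceq> shift x (- (p + 1)) b"
    unfolding b_def using x a a_le by (intro le_shift_commute) auto
  show False
  proof (cases "q - p \<le> 1")
    case True
    define C where "C = shift (inv x) (p + 1)"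
    define f where "f n = (C ^^ n) \<one>" for n
    have f_Suc: "f (Suc n) = C (f n)" for n
      by (simp add: f_def)
    have C: "C c \<in> carrier G" if "c \<in> carrier G" for c
      using that x by (simp add: C_def)
    have C_le: "C c \<preceq> C d \<longleftrightarrow> c \<preceq> d" if "c \<in> carrier G" "d \<in> carrier G" for c d
      using that x by (simp add: C_def)
    have f: "f n \<in> carrier G" for n
      by (induction n) (simp_all add: f_def C)
    have C_adj: "C c \<preceq> d \<longleftrightarrow> c \<preceq> shift x (- (p + 1)) d" if "c \<in> carrier G" "d \<in> carrier G" for c d
      using that x shift_adjoint[of x c d "- (p + 1)"] by (simp add: C_def add.commute)
    \<comment> \<open>The case assumption enters as \<open>q \<le> p + 1\<close>: the inequality
      expressing the supremum of \<open>x\<close> passes to \<open>C\<close>.\<close>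
    have "shift (inv x) q \<one> \<preceq> C \<one>"
      using True x le_shift_one[of "shift (inv x) q \<one>" "p + 1 - q"] by (simp add: C_def)
    then have C1: "\<one> \<preceq> C \<one>"
      using B1 x C le_trans[of \<one> "shift (inv x) q \<one>" "C \<one>"] by simp
    have inc: "f n \<preceq> f (Suc n)" for n
    proof (induction n)
      case 0
      show ?case using C1 by (simp add: f_def)
    next
      case (Suc n)
      then show ?case using C_le[OF f f, of n "Suc n"] by (simp add: f_Suc)
    qed
    have "f n \<preceq> b" for n
    proof (induction n)
      case 0
      show ?case using b by (simp add: f_def)
    next
      case (Suc n)
      have "C (f n) \<preceq> C b" using Suc C_le f b by simp
      moreover have "C b \<preceq> b" using C_adj b b_le by simp
      ultimately show ?case
        using C f b le_trans[of "C (f n)" "C b" b] by (simp add: f_Suc)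
    qed
    then obtain n where n: "f (Suc n) = f n"
      using increasing_stabilizes[of f b] f inc b by blast
    \<comment> \<open>\<open>C\<close> is an order embedding, so the equality of two consecutive
      iterates can be cancelled down to the start of the chain.\<close>
    have "C \<one> \<preceq> \<one>"
      using n
    proof (induction n)
      case 0
      then show ?case by (simp add: f_def)
    next
      case (Suc n)
      then have "C (f (Suc n)) \<preceq> C (f n)"
        using C f by (simp add: f_Suc)
      then have "f (Suc n) \<preceq> f n"
        using C_le[OF f f] by blast
      then have "f (Suc n) = f n"
        using inc f le_antisym by blast
      with Suc.IH show ?case by blast
    qed
    then show False
      using C_adj[of \<one> \<one>] not_le by simp
  next
    case False
    define T where "T c = A c \<triangle> D c" for c
    define th where "th n = (T ^^ n) \<one>" for n
    define u where "u n = (slide_step p q x ^^ n) \<one>" for n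
    have u_Suc: "u (Suc n) = slide_step p q x (u n)" and th_Suc: "th (Suc n) = T (th n)" for n
      by (simp_all add: u_def th_def)
    have u: "u n \<in> carrier G" for n
      using x by (induction n) (simp_all add: u_def)
    have th: "th n \<in> carrier G" for n
      by (induction n) (simp_all add: th_def T_def)
    have u_le: "u (Suc n) \<preceq> A (u n)" "u (Suc n) \<preceq> D (u n)" for n
      using slide_step_le x u by (simp_all add: u_Suc A_def D_def)
    have th_le: "th (Suc n) \<preceq> A (th n)" "th (Suc n) \<preceq> D (th n)" for n
      using meet_left meet_right th by (simp_all add: th_Suc T_def)

    obtain t where t: "b \<preceq> \<Delta> [^] (t :: int)"
      using Delta_bounds[OF b(1)] by auto
    \<comment> \<open>\<open>D c \<preceq> A c\<close> holds for all translates of \<open>b\<close>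
      by powers of \<open>\<Delta>\<close>. Starting from one below \<open>\<one>\<close>, its
      images under powers of \<open>D\<close> bound the iterates of \<open>T\<close> from
      below.\<close>
    define l where "l = shift \<one> (- t) b"
    have l: "l \<in> carrier G" "l \<preceq> \<one>"
      using b t mult_Delta_pow_le_iff[of b "\<Delta> [^] t" "- t"]
      by (simp_all add: l_def shift_def Delta_pow_add[symmetric] del: mult_Delta_pow_le_iff)
    have D_le_A: "D (shift \<one> j b) \<preceq> A (shift \<one> j b)" for j
      using AD x b b_le le_shift_commute[of \<one> x b "- (p + 1)" j] by simp
    have l_th: "shift \<one> (int n) l \<preceq> th n" for n
    proof (induction n)
      case 0
      show ?case using l by (simp add: th_def)
    next
      case (Suc n)
      let ?l = "shift \<one> (int n) l"
      have "D ?l \<preceq> A ?l"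
        using D_le_A[of "int n - t"] b by (simp add: l_def)
      moreover have "D ?l \<preceq> D (th n)" "A ?l \<preceq> A (th n)"
        using Suc l th by simp_all
      ultimately have "D ?l \<preceq> th (Suc n)"
        using l th le_trans[of "D ?l" "A ?l" "A (th n)"] by (simp add: th_Suc T_def)
      moreover have "D ?l = shift \<one> (int (Suc n)) l"
        using l by (simp add: D_def add.commute)
      ultimately show ?case by simp
    qed
    \<comment> \<open>Divided by powers of \<open>D\<close>, the iterates form a decreasing chain
      above \<open>l\<close>; where it stabilises, \<open>th (Suc n) = D (th n)\<close>.\<close>
    define g where "g n = shift \<one> (- int n) (th n)" for n
    have "g (Suc n) \<preceq> g n" for n
    proof -
      have "g (Suc n) \<preceq> shift \<one> (- int (Suc n)) (D (th n))"
        using th_le[of n] th by (simp add: g_def)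
      then show ?thesis
        using th by (simp add: g_def D_def)
    qed
    moreover have "l \<preceq> g n" for n
      using shift_adjoint[of \<one> l "g n" "int n"] l_th[of n] l th
        shift_le_iff[of \<one> "shift \<one> (int n) l" "th n" "- int n"] by (simp add: g_def)
    moreover have "g n \<in> carrier G" for n
      using th by (simp add: g_def)
    ultimately obtain n where "g (Suc n) = g n"
      using decreasing_stabilizes[of g l] l by blast
    then have "shift \<one> (int (Suc n)) (g (Suc n)) = shift \<one> (int (Suc n)) (g n)"
      by simp
    then have th_eq: "th (Suc n) = D (th n)"
      using th by (simp add: g_def D_def)

    have u_th: "u k \<preceq> th k" for k
    proof (induction k)
      case 0
      show ?case by (simp add: u_def th_def)
    next
      case (Suc k)
      then have "A (u k) \<preceq> A (th k)" "D (u k) \<preceq> D (th k)"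
        using u th by simp_all
      then show ?case
        using u_le[of k] u th le_trans[of "u (Suc k)" "A (u k)" "A (th k)"]
          le_trans[of "u (Suc k)" "D (u k)" "D (th k)"] by (simp add: th_Suc T_def)
    qed
    \<comment> \<open>\<open>u\<close> lags behind \<open>th\<close> because of the middle term of
      sliding, but not below \<open>D (u k)\<close>: applying \<open>A\<close> to that term gives a
      shift by \<open>q - p \<ge> 2\<close> powers of \<open>\<Delta>\<close>, which lies above two
      applications of \<open>D\<close>.\<close>
    have key: "D (u k) \<triangle> A (th k) \<preceq> A (u k)" for k
    proof (induction k)
      case 0
      show ?case by (simp add: u_def th_def meet_right)
    next
      case (Suc k)
      let ?L = "D (u (Suc k)) \<triangle> A (th (Suc k))"
      note c [simp] = u th
      have L: "?L \<preceq> D (u (Suc k))" "?L \<preceq> A (th (Suc k))" "?L \<in> carrier G"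
        using meet_left meet_right by simp_all
      have LDA: "?L \<preceq> D (A (u k))" and LDD: "?L \<preceq> D (D (u k))"
        using le_trans[OF L(1), of "D (A (u k))"] le_trans[OF L(1), of "D (D (u k))"] u_le[of k] L(3)
        by simp_all
      have comm: "D (A (u k)) = A (D (u k))"
        using x by (simp add: A_def D_def)
      have "?L \<preceq> A (A (th k))"
        using le_trans[OF L(2), of "A (A (th k))"] th_le[of k] L(3) by simp
      then have "?L \<preceq> A (D (u k) \<triangle> A (th k))"
        using LDA x L(3) unfolding comm by (simp add: A_def shift_meet)
      then have LAA: "?L \<preceq> A (A (u k))"
        using le_trans[of ?L "A (D (u k) \<triangle> A (th k))" "A (A (u k))"] Suc L(3)
        by (simp del: le_meet_iff)
      have "D (D (u k)) \<preceq> A (shift (inv x) q (u k))"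
        using False x shift_one_mono[of "u k" 2 "q - p"] by (simp add: A_def D_def)
      then have "?L \<preceq> A (shift (inv x) q (u k))"
        using le_trans[OF LDD] L(3) x by simp
      then show ?case
        using LAA LDA L(3) x unfolding comm
        by (simp add: u_Suc slide_step_def A_def[symmetric] D_def[symmetric])
          (simp add: A_def shift_meet D_def)
    qed
    have "D (th n) \<preceq> A (th n)"
      using th_le(1)[of n] by (simp add: th_eq)
    moreover have "D (u n) \<preceq> D (th n)"
      using u_th u th by simp
    ultimately have "D (u n) \<preceq> D (u n) \<triangle> A (th n)"
      using u th le_trans[of "D (u n)" "D (th n)" "A (th n)"] by simp
    then have "D (u n) \<preceq> A (u n)"
      using key[of n] u th le_trans[of "D (u n)" "D (u n) \<triangle> A (th n)" "A (u n)"]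
      by (simp del: le_meet_iff)
    then have "p + 1 \<le> infimum (x \<star> u n)"
      using AD le_infimum_conj_iff[of x "u n" "p + 1"] u x by simp
    \<comment> \<open>Along a circuit infimum and supremum stay \<open>p\<close> and
      \<open>q\<close>, so the same \<open>slide_step\<close> applies at every stage.\<close>
    moreover have "(slide ^^ k) x = x \<star> u k" for k
    proof (induction k)
      case 0
      show ?case using x by (simp add: u_def)
    next
      case (Suc k)
      then have "infimum (x \<star> u k) = p" "supremum (x \<star> u k) = q"
        using periodic_infimum[OF x m, of k] periodic_supremum[OF x m, of k]
        by (simp_all add: p_def q_def)
      with Suc show ?case
        using slide_conj[OF x u, of k] by (simp add: u_Suc)
    qed
    ultimately show False
      using periodic_infimum[OF x m, of n] by (simp add: p_def)
  qed
qed

lemma periodic_supremum_min: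
  assumes x: "x \<in> carrier G" and m: "(slide ^^ m) x = x" "m \<ge> 1" and a: "a \<in> carrier G"
  shows "supremum x \<le> supremum (x \<star> a)"
  using periodic_infimum_max[of "inv x" m a] assms
  by (simp add: slide_iter_inv infimum_inv conj_by_inv[symmetric])

section \<open>Conjugacy classes and their invariant subsets\<close>

lemma conjugates_closed: "x \<in> carrier G \<Longrightarrow> y \<in> conjugates x \<Longrightarrow> y \<in> carrier G"
  by (auto simp: conjugates_def)

lemma conjugates_subset:
  assumes x: "x \<in> carrier G" and y: "y \<in> conjugates x"
  shows "conjugates y \<subseteq> conjugates x"
  using assms by (auto simp: conjugates_def conj_by_mult[symmetric])

lemma conjugates_sym:
  assumes x: "x \<in> carrier G" and y: "y \<in> conjugates x"
  shows "x \<in> conjugates y"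
proof -
  obtain c where c: "c \<in> carrier G" "y = x \<star> c"
    using y by (auto simp: conjugates_def)
  then have "x = y \<star> inv c"
    using x by simp
  then show ?thesis
    using c by (auto simp: conjugates_def)
qed

lemma conjugates_eq:
  "x \<in> carrier G \<Longrightarrow> y \<in> conjugates x \<Longrightarrow> conjugates y = conjugates x"
  using conjugates_subset conjugates_sym conjugates_closed by blast

lemma conj_by_in_conjugates [simp, intro]: "c \<in> carrier G \<Longrightarrow> x \<star> c \<in> conjugates x"
  by (auto simp: conjugates_def)

lemma conjugates_refl: "x \<in> carrier G \<Longrightarrow> x \<in> conjugates x"
  using conj_by_in_conjugates[of \<one> x] by simp

lemma SC_eq: "x \<in> carrier G \<Longrightarrow> y \<in> conjugates x \<Longrightarrow> SC y = SC x"
  by (simp add: SC_def conjugates_eq)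

lemma SSS_eq: "x \<in> carrier G \<Longrightarrow> y \<in> conjugates x \<Longrightarrow> SSS y = SSS x"
  by (simp add: SSS_def conjugates_eq)

lemma SC_subset_SSS:
  assumes x: "x \<in> carrier G"
  shows "SC x \<subseteq> SSS x"
proof
  fix y assume y: "y \<in> SC x"
  then obtain m where m: "(slide ^^ m) y = y" "m \<ge> 1" and c: "y \<in> conjugates x"
    by (auto simp: SC_def)
  have "y \<in> carrier G"
    using conjugates_closed x c by blast
  then have "infimum z \<le> infimum y \<and> supremum y \<le> supremum z" if "z \<in> conjugates y" for z
    using that periodic_infimum_max[OF _ m] periodic_supremum_min[OF _ m]
    by (auto simp: conjugates_def)
  then show "y \<in> SSS x"
    using x c by (simp add: SSS_def conjugates_eq)
qed

end

section \<open>Transport\<close>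

context garside_nontrivial
begin

lemma SSS_self: "x \<in> carrier G \<Longrightarrow> y \<in> SSS x \<Longrightarrow> y \<in> SSS y"
  using SSS_eq[of x y] by (simp add: SSS_def)

lemma SSS_carrier: "x \<in> carrier G \<Longrightarrow> y \<in> SSS x \<Longrightarrow> y \<in> carrier G"
  using conjugates_closed by (auto simp: SSS_def)

lemma SSS_infimum: "x \<in> carrier G \<Longrightarrow> y \<in> SSS x \<Longrightarrow> z \<in> SSS x \<Longrightarrow> infimum y = infimum z"
  by (auto simp: SSS_def intro: order_antisym)

lemma SSS_supremum: "x \<in> carrier G \<Longrightarrow> y \<in> SSS x \<Longrightarrow> z \<in> SSS x \<Longrightarrow> supremum y = supremum z"
  by (auto simp: SSS_def intro: order_antisym)

lemma SSS_iff:
  assumes v: "v \<in> carrier G" "v \<in> SSS v" and y: "y \<in> conjugates v"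
  shows "y \<in> SSS v \<longleftrightarrow> infimum v \<le> infimum y \<and> supremum y \<le> supremum v"
  using assms conjugates_refl[of v] by (auto simp: SSS_def intro: order_trans)

lemma conj_SSS_iff:
  assumes v: "v \<in> carrier G" "v \<in> SSS v" and a: "a \<in> carrier G"
  shows "v \<star> a \<in> SSS v \<longleftrightarrow>
    a \<preceq> shift v (- infimum v) a \<and> a \<preceq> shift (inv v) (supremum v) a"
  using SSS_iff[OF v, of "v \<star> a"] le_infimum_conj_iff[of v a "infimum v"]
    supremum_conj_le_iff[of v a "supremum v"] v a by simp

lemma conj_meet_SSS:
  assumes v: "v \<in> carrier G" "v \<in> SSS v" and "a \<in> carrier G" "b \<in> carrier G"
    and "v \<star> a \<in> SSS v" "v \<star> b \<in> SSS v"
  shows "v \<star> (a \<triangle> b) \<in> SSS v"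
  using assms by (simp add: conj_SSS_iff le_shift_meet del: le_meet_iff)

lemma slide_in_SSS:
  assumes v: "v \<in> carrier G" "v \<in> SSS v" and y: "y \<in> SSS v"
  shows "slide y \<in> SSS v"
proof -
  have "y \<in> carrier G" "y \<in> conjugates v"
    using SSS_carrier v y by (auto simp: SSS_def)
  then have "slide y \<in> conjugates v"
    using conjugates_subset[of v y] v by (auto simp: slide_def)
  then show ?thesis
    using SSS_iff[OF v] infimum_slide[of y] supremum_slide[of y] y \<open>y \<in> carrier G\<close>
      \<open>y \<in> conjugates v\<close> by (auto intro: order_trans)
qed

lemma slide_iter_in_SSS:
  "v \<in> carrier G \<Longrightarrow> v \<in> SSS v \<Longrightarrow> y \<in> SSS v \<Longrightarrow> (slide ^^ k) y \<in> SSS v"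
  by (induction k) (auto intro: slide_in_SSS)

lemma slide_iter_SSS_self:
  "v \<in> carrier G \<Longrightarrow> v \<in> SSS v \<Longrightarrow> (slide ^^ k) v \<in> SSS ((slide ^^ k) v)"
  using slide_iter_in_SSS SSS_self by blast

lemma Delta_pow_in_SSS:
  fixes j :: int
  assumes v: "v \<in> carrier G" "v \<in> SSS v"
  shows "v \<star> (\<Delta> [^] j) \<in> SSS v"
proof -
  have "v \<star> shift \<one> j \<one> \<in> SSS v"
    using v conj_SSS_iff[OF v, of \<one>] by (simp add: conj_SSS_iff le_shift_commute del: shift_shift)
  then show ?thesis by (simp add: shift_def)
qed

abbreviation step :: "'a \<Rightarrow> 'a \<Rightarrow> 'a" where
  "step v \<equiv> slide_step (infimum v) (supremum v) v"

text \<open>Inside the super summit set infimum and supremum agree with those of \<open>v\<close>,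
  so one map \<open>step v\<close> serves all conjugators.\<close>

lemma step_conj:
  assumes v: "v \<in> carrier G" "v \<in> SSS v" and a: "a \<in> carrier G" "v \<star> a \<in> SSS v"
  shows "a \<otimes> preferred_prefix (v \<star> a) = step v a" "slide (v \<star> a) = v \<star> step v a"
  using mult_preferred_prefix[of v a] slide_conj[of v a] SSS_infimum[of v "v \<star> a" v]
    SSS_supremum[of v "v \<star> a" v] assms by simp_all

lemma transport_closed [simp, intro]:
  "v \<in> carrier G \<Longrightarrow> a \<in> carrier G \<Longrightarrow> transport v a \<in> carrier G"
  by (simp add: transport_def)

lemma transport_conj:
  "v \<in> carrier G \<Longrightarrow> a \<in> carrier G \<Longrightarrow> slide v \<star> transport v a = slide (v \<star> a)"
  by (simp add: slide_def transport_def conj_by_mult[symmetric] m_assoc)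

lemma step_one:
  "v \<in> carrier G \<Longrightarrow> step v \<one> = preferred_prefix v"
  using mult_preferred_prefix[of v \<one>] by simp

text \<open>The left factor does not depend on \<open>a\<close>, so order and meets pass from
  \<open>step v\<close> to transport by left translation.\<close>

lemma transport_eq:
  assumes "v \<in> carrier G" "v \<in> SSS v" "a \<in> carrier G" "v \<star> a \<in> SSS v"
  shows "transport v a = inv (step v \<one>) \<otimes> step v a"
  using step_conj[OF assms] assms by (simp add: transport_def step_one m_assoc)

lemma step_meet:
  assumes "v \<in> carrier G" "a \<in> carrier G" "b \<in> carrier G"
  shows "step v (a \<triangle> b) = step v a \<triangle> step v b"
proof (rule le_antisym)
  show "step v (a \<triangle> b) \<preceq> step v a \<triangle> step v b"
    using assms by (simp add: slide_step_mono meet_left meet_right)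
  show "step v a \<triangle> step v b \<preceq> step v (a \<triangle> b)"
    using assms meet_left[of "step v a" "step v b"] meet_right[of "step v a" "step v b"]
      le_slide_step_iff[of v a "step v a \<triangle> step v b"] le_slide_step_iff[of v b "step v a \<triangle> step v b"]
    by (simp add: le_slide_step_iff shift_meet)
qed (use assms in auto)

lemma transport_mono:
  assumes "v \<in> carrier G" "v \<in> SSS v" "a \<in> carrier G" "v \<star> a \<in> SSS v" "b \<in> carrier G" "v \<star> b \<in> SSS v"
    and "a \<preceq> b"
  shows "transport v a \<preceq> transport v b"
  using assms by (simp add: transport_eq slide_step_mono)

lemma transport_meet:
  assumes "v \<in> carrier G" "v \<in> SSS v" "a \<in> carrier G" "v \<star> a \<in> SSS v" "b \<in> carrier G" "v \<star> b \<in> SSS v"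
  shows "transport v (a \<triangle> b) = transport v a \<triangle> transport v b"
  using assms by (simp add: transport_eq conj_meet_SSS step_meet mult_meet)

lemma transport_one: "v \<in> carrier G \<Longrightarrow> transport v \<one> = \<one>"
  by (simp add: transport_def)

text \<open>Right multiplication by a power of \<open>\<Delta>\<close> commutes with all three
  shifts in \<open>step v\<close>. As fixed points of a monotone map these powers bound the orbits
  of transport; they also supply pullback candidates.\<close>

lemma transport_Delta_pow:
  fixes j :: int
  assumes v: "v \<in> carrier G" "v \<in> SSS v"
  shows "transport v (\<Delta> [^] j) = \<Delta> [^] j"
proof -
  have "step v (shift \<one> j \<one>) = shift \<one> j (step v \<one>)"
    using v by (simp add: slide_step_def shift_meet add.commute)
  then show ?thesis
    using v transport_eq[OF v _ Delta_pow_in_SSS[OF v, of j]] by (simp add: shift_def m_assoc)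
qed

section \<open>Iterated transport\<close>

lemma iter_transport_closed [simp, intro]:
  "v \<in> carrier G \<Longrightarrow> a \<in> carrier G \<Longrightarrow> iter_transport v a k \<in> carrier G"
  by (induction k) auto

lemma iter_transport_conj:
  "v \<in> carrier G \<Longrightarrow> a \<in> carrier G \<Longrightarrow>
    (slide ^^ k) v \<star> iter_transport v a k = (slide ^^ k) (v \<star> a)"
  by (induction k) (auto simp: transport_conj)

lemma iter_transport_add:
  "iter_transport v a (j + k) = iter_transport ((slide ^^ j) v) (iter_transport v a j) k"
  by (induction k) (auto simp: add.commute funpow_add)

lemma iter_transport_one: "v \<in> carrier G \<Longrightarrow> iter_transport v \<one> k = \<one>"
  by (induction k) (auto simp: transport_one)

lemma iter_transport_SSS:
  assumes v: "v \<in> carrier G" "v \<in> SSS v" and a: "a \<in> carrier G" "v \<star> a \<in> SSS v"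
  shows "(slide ^^ k) v \<star> iter_transport v a k \<in> SSS ((slide ^^ k) v)"
proof -
  have "(slide ^^ k) v \<in> conjugates v"
    using slide_iter_in_SSS[OF v v(2), of k] by (simp add: SSS_def)
  then show ?thesis
    using v a slide_iter_in_SSS[OF v a(2), of k] SSS_eq[of v "(slide ^^ k) v"]
    by (simp add: iter_transport_conj)
qed

lemma iter_transport_mono:
  assumes v: "v \<in> carrier G" "v \<in> SSS v" and a: "a \<in> carrier G" "v \<star> a \<in> SSS v"
    and b: "b \<in> carrier G" "v \<star> b \<in> SSS v" and le: "a \<preceq> b"
  shows "iter_transport v a k \<preceq> iter_transport v b k"
proof (induction k)
  case (Suc k)
  then show ?case
    using v a b iter_transport_SSS[OF v a, of k] iter_transport_SSS[OF v b, of k]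
      slide_iter_SSS_self[OF v, of k] by (simp add: transport_mono)
qed (use le in simp)

lemma iter_transport_meet:
  assumes v: "v \<in> carrier G" "v \<in> SSS v" and a: "a \<in> carrier G" "v \<star> a \<in> SSS v"
    and b: "b \<in> carrier G" "v \<star> b \<in> SSS v"
  shows "iter_transport v (a \<triangle> b) k = iter_transport v a k \<triangle> iter_transport v b k"
proof (induction k)
  case (Suc k)
  then show ?case
    using v a b iter_transport_SSS[OF v a, of k] iter_transport_SSS[OF v b, of k]
      slide_iter_SSS_self[OF v, of k] by (simp add: transport_meet)
qed simp

lemma iter_transport_positive:
  assumes v: "v \<in> carrier G" "v \<in> SSS v" and a: "a \<in> P" "v \<star> a \<in> SSS v"
  shows "iter_transport v a k \<in> P"
  using iter_transport_mono[OF v, of \<one> a k] v a by (simp add: iter_transport_one one_le_iff)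

lemma step_iter_closed [simp, intro]:
  "v \<in> carrier G \<Longrightarrow> a \<in> carrier G \<Longrightarrow> (step v ^^ k) a \<in> carrier G"
  by (induction k) auto

lemma slide_iter_conj:
  assumes v: "v \<in> carrier G" "v \<in> SSS v" and a: "a \<in> carrier G" "v \<star> a \<in> SSS v"
  shows "(slide ^^ k) (v \<star> a) = v \<star> (step v ^^ k) a"
proof (induction k)
  case (Suc k)
  then have "v \<star> (step v ^^ k) a \<in> SSS v"
    using slide_iter_in_SSS[OF v a(2), of k] by simp
  then show ?case
    using Suc v a by (simp add: step_conj)
qed simp

lemma slide_iter_eq:
  assumes v: "v \<in> carrier G" "v \<in> SSS v"
  shows "(slide ^^ k) v = v \<star> (step v ^^ k) \<one>"
  using slide_iter_conj[OF v, of \<one> k] v by simp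

lemma iter_transport_Delta_pow:
  fixes j :: int
  assumes "v \<in> carrier G" "v \<in> SSS v"
  shows "iter_transport v (\<Delta> [^] j) k = \<Delta> [^] j"
  using assms by (induction k) (auto simp: transport_Delta_pow slide_iter_SSS_self)

text \<open>Although the base point of the transports moves under sliding, the iterate is expressed
  by one map based at \<open>v\<close>, started at \<open>\<one>\<close> and at
  \<open>a\<close>.\<close>

lemma iter_transport_eq:
  assumes v: "v \<in> carrier G" "v \<in> SSS v" and a: "a \<in> carrier G" "v \<star> a \<in> SSS v"
  shows "(step v ^^ k) \<one> \<otimes> iter_transport v a k = (step v ^^ k) a"
proof (induction k)
  case 0
  show ?case using a by simp
next
  case (Suc k)
  let ?c = "(step v ^^ k) \<one>" and ?d = "iter_transport v a k"
  have c: "(slide ^^ k) v = v \<star> ?c" "?c \<in> carrier G"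
    using v by (simp_all add: slide_iter_eq)
  have sl: "v \<star> ?c \<in> SSS v"
    using slide_iter_in_SSS[OF v v(2), of k] v c by simp
  have "v \<star> (?c \<otimes> ?d) = (slide ^^ k) (v \<star> a)"
    using iter_transport_conj[of v a k] v a c by (simp add: conj_by_mult)
  then have "v \<star> (?c \<otimes> ?d) \<in> SSS v"
    using slide_iter_in_SSS[OF v a(2)] by simp
  then have "?c \<otimes> (?d \<otimes> preferred_prefix (v \<star> ?c \<star> ?d)) = step v (?c \<otimes> ?d)"
    using step_conj[OF v, of "?c \<otimes> ?d"] c v a by (simp add: conj_by_mult m_assoc)
  moreover have "?c \<otimes> preferred_prefix (v \<star> ?c) = step v ?c"
    using step_conj(1)[OF v _ sl] c by simp
  ultimately show ?case
    using Suc v a c by (simp add: transport_def) (simp add: m_assoc flip: \<open>_ = step v ?c\<close>)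
qed

text \<open>Equal end points have equal preferred prefixes after every number of slides, and these
  cancel from the transports one at a time.\<close>

lemma iter_transport_inj:
  assumes "v \<in> carrier G" "a \<in> carrier G" "b \<in> carrier G" "v \<star> a = v \<star> b"
    and "iter_transport v a k = iter_transport v b k"
  shows "a = b"
  using assms(5)
proof (induction k)
  case (Suc k)
  have "(slide ^^ k) v \<star> iter_transport v a k = (slide ^^ k) v \<star> iter_transport v b k"
    using assms by (simp add: iter_transport_conj)
  then show ?case
    using Suc assms(1-4) by (simp add: transport_def)
qed simp

text \<open>With \<open>E = shift y k\<close>, applying the inverse of \<open>E\<close> to
  \<open>s\<close> repeatedly, one time fewer than the exponent in
  \<open>s \<preceq> E^(i+1) \<one>\<close>, gives an element below both \<open>s\<close> and
  \<open>E \<one>\<close>, hence below \<open>\<one>\<close>; this lowers the exponent by one. So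
  what is disjoint from the first increment is not swallowed by later ones.\<close>

lemma increments_absorbed:
  assumes y: "y \<in> carrier G" and s: "s \<in> P" "s \<preceq> shift y k s"
    and 1: "\<one> \<preceq> shift y k \<one>" and disjoint: "s \<triangle> shift y k \<one> = \<one>"
    and le: "s \<preceq> (shift y k ^^ i) \<one>"
  shows "s = \<one>"
proof -
  define E where "E = shift y k"
  define F where "F = shift (inv y) (- k)"
  have E: "(E ^^ i) c \<in> carrier G" and F: "(F ^^ i) c \<in> carrier G" if "c \<in> carrier G" for c i
    using that y by (induction i) (auto simp: E_def F_def)
  have adj: "(F ^^ i) c \<preceq> d \<longleftrightarrow> c \<preceq> (E ^^ i) d" if "c \<in> carrier G" "d \<in> carrier G" for c d i
    using that
  proof (induction i arbitrary: d)
    case (Suc i)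
    have "F ((F ^^ i) c) \<preceq> d \<longleftrightarrow> (F ^^ i) c \<preceq> E d"
      using F[of c i] Suc.prems y shift_adjoint[of y "(F ^^ i) c" d k] by (simp add: E_def F_def)
    also have "\<dots> \<longleftrightarrow> c \<preceq> (E ^^ i) (E d)"
      using Suc y by (simp add: E_def)
    finally show ?case by (simp add: funpow_swap1)
  qed simp
  have s_le: "s \<preceq> (E ^^ i) s" for i
  proof (induction i)
    case (Suc i)
    then have "E s \<preceq> E ((E ^^ i) s)"
      using E[of s i] s y by (simp add: E_def)
    then show ?case
      using s y E[of s i] le_trans[of s "E s"] by (simp add: E_def)
  qed (use s in simp)
  have "s \<preceq> (E ^^ i) \<one> \<Longrightarrow> s = \<one>"
  proof (induction i)
    case 0
    then show ?case using s le_antisym[of s \<one>] by (simp add: one_le_iff)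
  next
    case (Suc i)
    let ?h = "(F ^^ i) s \<nabla> \<one>"
    have "(F ^^ i) s \<preceq> E \<one>"
      using adj[of s "E \<one>" i] Suc.prems s y by (simp add: E_def funpow_swap1)
    moreover have "(F ^^ i) s \<preceq> s"
      using adj[of s s i] s s_le by simp
    ultimately have "?h \<preceq> s \<triangle> E \<one>"
      using 1 s y F[of s i] by (simp add: E_def one_le_iff)
    then have "?h \<preceq> \<one>"
      using disjoint by (simp add: E_def)
    then have "(F ^^ i) s \<preceq> \<one>"
      using s F[of s i] by simp
    then show ?case
      using Suc.IH adj[of s \<one> i] s by simp
  qed
  then show ?thesis
    using le by (simp add: E_def)
qed

end

section \<open>Conjugators between elements of sliding circuits\<close>

text \<open>After \<open>N\<close> slides transport is taken at \<open>v\<close> again, so the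
  iterated \<open>N\<close>-fold transports are the iterates of one self-map, written
  \<open>T\<close> below.\<close>

locale circuit_vertex = garside_nontrivial G P \<Delta>
  for G :: "('a, 'b) monoid_scheme" (structure) and P \<Delta> +
  fixes v :: 'a and N :: nat
  assumes vertex_carrier [simp, intro]: "v \<in> carrier G"
    and period_positive: "N > 0"
    and period: "(slide ^^ N) v = v"
begin

lemma vertex_SC: "v \<in> SC v"
  using period period_positive conjugates_refl[of v] by (auto simp: SC_def intro!: exI[of _ N])

lemma vertex_SSS: "v \<in> SSS v"
  using SC_subset_SSS[of v] vertex_SC by auto

lemma slide_mult_period: "(slide ^^ (k * N)) v = v"
  using slide_periodic[OF period, of k 0] by (simp add: mult.commute)

definition summit_conjugators :: "'a set" where
  "summit_conjugators = {a \<in> P. v \<star> a \<in> SSS v}"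

definition circuit_conjugators :: "'a set" where
  "circuit_conjugators = {a \<in> P. v \<star> a \<in> SC v}"

definition T :: "nat \<Rightarrow> 'a \<Rightarrow> 'a" where
  "T k a = iter_transport v a (k * N)"

lemma T_0 [simp]: "T 0 a = a"
  by (simp add: T_def)

lemma T_add: "T (j + k) a = T k (T j a)"
  by (simp add: T_def add_mult_distrib iter_transport_add slide_mult_period)

lemma T_one [simp]: "T k \<one> = \<one>"
  by (simp add: T_def iter_transport_one)

lemma summit_conjugatorsI: "a \<in> P \<Longrightarrow> v \<star> a \<in> SSS v \<Longrightarrow> a \<in> summit_conjugators"
  by (simp add: summit_conjugators_def)

lemma circuit_subset_summit: "circuit_conjugators \<subseteq> summit_conjugators"
  using SC_subset_SSS[of v] by (auto simp: circuit_conjugators_def summit_conjugators_def)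

lemma summit_conjugatorsD [simp]:
  assumes "a \<in> summit_conjugators"
  shows "a \<in> P" "a \<in> carrier G" "v \<star> a \<in> SSS v"
  using assms unfolding summit_conjugators_def by auto

lemma T_summit [simp]:
  assumes "a \<in> summit_conjugators"
  shows "T k a \<in> summit_conjugators"
proof (rule summit_conjugatorsI)
  show "T k a \<in> P"
    using iter_transport_positive[of v a "k * N"] vertex_SSS assms by (simp add: T_def)
  show "v \<star> T k a \<in> SSS v"
    using iter_transport_SSS[of v a "k * N"] vertex_SSS assms by (simp add: T_def slide_mult_period)
qed

lemma T_conj: "a \<in> carrier G \<Longrightarrow> v \<star> T k a = (slide ^^ (k * N)) (v \<star> a)"
  using iter_transport_conj[of v a "k * N"] by (simp add: T_def slide_mult_period)

lemma T_mono:
  "a \<in> summit_conjugators \<Longrightarrow> b \<in> summit_conjugators \<Longrightarrow> a \<preceq> b \<Longrightarrow> T k a \<preceq> T k b"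
  using vertex_SSS by (simp add: T_def iter_transport_mono)

lemma T_meet:
  "a \<in> summit_conjugators \<Longrightarrow> b \<in> summit_conjugators \<Longrightarrow> T k (a \<triangle> b) = T k a \<triangle> T k b"
  using vertex_SSS by (simp add: T_def iter_transport_meet)

lemma positive_meet: "a \<in> P \<Longrightarrow> b \<in> P \<Longrightarrow> a \<triangle> b \<in> P"
  using one_le_iff[of "a \<triangle> b"] by (simp add: one_le_iff)

lemma summit_meet:
  "a \<in> summit_conjugators \<Longrightarrow> b \<in> summit_conjugators \<Longrightarrow> a \<triangle> b \<in> summit_conjugators"
  using vertex_SSS conj_meet_SSS[of v a b] positive_meet[of a b]
  by (intro summit_conjugatorsI) simp_all

lemma Delta_pow_positive: "0 \<le> j \<Longrightarrow> \<Delta> [^] (j :: int) \<in> P"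
  using Delta_pow_mono[of 0 j] one_le_iff[of "\<Delta> [^] j"] by simp

lemma Delta_pow_summit: "0 \<le> j \<Longrightarrow> \<Delta> [^] (j :: int) \<in> summit_conjugators"
  using Delta_pow_in_SSS[of v j] vertex_SSS by (intro summit_conjugatorsI) (simp_all add: Delta_pow_positive)

lemma T_Delta_pow: "T k (\<Delta> [^] (j :: int)) = \<Delta> [^] j"
  using iter_transport_Delta_pow[of v j "k * N"] vertex_SSS by (simp add: T_def)

text \<open>A power of \<open>\<Delta>\<close> above \<open>a\<close> is fixed by transport and
  bounds the orbit. The index map \<open>f\<close> lets repetitions be sought along multiples of a
  given period.\<close>

lemma finite_range_T:
  assumes "a \<in> summit_conjugators"
  shows "finite (range (\<lambda>k. T (f k) a))"
proof -
  obtain t where t: "0 \<le> t" "a \<preceq> \<Delta> [^] (t :: int)"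
    using Delta_bounds[of a] assms by auto
  have "T k a \<preceq> \<Delta> [^] t" for k
    using T_mono[OF assms Delta_pow_summit t(2), of k] t by (simp add: T_Delta_pow)
  then have "range (\<lambda>k. T (f k) a) \<subseteq> {g \<in> carrier G. \<one> \<preceq> g \<and> g \<preceq> \<Delta> [^] t}"
    using assms by (auto simp: one_le_iff)
  then show ?thesis
    using finite_interval[of \<one> "\<Delta> [^] t"] finite_subset by blast
qed

lemma T_inj:
  assumes "a \<in> carrier G" "b \<in> carrier G" "v \<star> a = v \<star> b" "T k a = T k b"
  shows "a = b"
  using assms iter_transport_inj[of v a b "k * N"] by (simp add: T_def)

lemma circuit_conjugatorsI:
  "a \<in> P \<Longrightarrow> m \<ge> 1 \<Longrightarrow> (slide ^^ m) (v \<star> a) = v \<star> a \<Longrightarrow> a \<in> circuit_conjugators"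
  unfolding circuit_conjugators_def SC_def using positive_carrier by blast

text \<open>The end point follows the transport, which gives one direction. Conversely, along
  multiples of the period of \<open>v \<star> a\<close> the end point is constant, two transports
  coincide by finiteness, and injectivity for a fixed end point removes their common initial
  part.\<close>

lemma circuit_iff:
  assumes a: "a \<in> summit_conjugators"
  shows "a \<in> circuit_conjugators \<longleftrightarrow> (\<exists>M\<ge>1. T M a = a)"
proof
  assume "\<exists>M\<ge>1. T M a = a"
  then obtain M where M: "M \<ge> 1" "T M a = a" by auto
  then have "(slide ^^ (M * N)) (v \<star> a) = v \<star> a"
    using T_conj[of a M] a by simp
  moreover have "M * N \<ge> 1"
    using M period_positive by simp
  ultimately show "a \<in> circuit_conjugators"
    using a circuit_conjugatorsI[of a "M * N"] by simp
next
  assume "a \<in> circuit_conjugators"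
  then obtain m where m: "m \<ge> 1" "(slide ^^ m) (v \<star> a) = v \<star> a"
    by (auto simp: circuit_conjugators_def SC_def)
  have w: "v \<star> T (m * k) a = v \<star> a" for k
    using T_conj[of a "m * k"] slide_periodic[OF m(2), of "k * N" 0] a by (simp add: mult.assoc)
  obtain i j where ij: "i < j" "T (m * i) a = T (m * j) a"
    using finite_range_repetition[OF finite_range_T[OF a, of "\<lambda>k. m * k"]] by blast
  have "m * j = m * (j - i) + m * i"
    using ij(1) by (simp flip: add_mult_distrib2)
  then have "T (m * i) (T (m * (j - i)) a) = T (m * i) a"
    using ij(2) by (simp add: T_add)
  then have "T (m * (j - i)) a = a"
    using T_inj[of "T (m * (j - i)) a" a] w a by simp
  then show "\<exists>M\<ge>1. T M a = a"
    using m ij by (intro exI[of _ "m * (j - i)"]) auto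
qed

lemma T_mult: "T M a = a \<Longrightarrow> T (M * k) a = a"
  by (induction k) (auto simp: T_add)

lemma circuit_period:
  assumes "a \<in> circuit_conjugators"
  obtains M where "M \<ge> 1" "T M a = a"
  using assms circuit_iff circuit_subset_summit by blast

lemma circuit_common_period:
  assumes "a \<in> circuit_conjugators" "b \<in> circuit_conjugators"
  obtains M where "M \<ge> 1" "T M a = a" "T M b = b"
proof -
  obtain m n where "m \<ge> 1" "T m a = a" "n \<ge> 1" "T n b = b"
    using assms circuit_period by metis
  then show ?thesis
    using that[of "m * n"] T_mult[of m a n] T_mult[of n b m] by (simp add: mult.commute)
qed

lemma circuit_meet:
  assumes "a \<in> circuit_conjugators" "b \<in> circuit_conjugators"
  shows "a \<triangle> b \<in> circuit_conjugators"
proof -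
  have s: "a \<in> summit_conjugators" "b \<in> summit_conjugators"
    using assms circuit_subset_summit by auto
  obtain M where "M \<ge> 1" "T M a = a" "T M b = b"
    using assms circuit_common_period by blast
  then show ?thesis
    using s by (auto simp: circuit_iff[OF summit_meet] T_meet)
qed

lemma circuit_T:
  assumes "a \<in> circuit_conjugators"
  shows "T k a \<in> circuit_conjugators"
proof -
  have s: "a \<in> summit_conjugators"
    using assms circuit_subset_summit by auto
  obtain M where "M \<ge> 1" "T M a = a"
    using assms circuit_period by blast
  then show ?thesis
    using s T_add[of k M a] T_add[of M k a] by (auto simp: circuit_iff[OF T_summit] add.commute)
qed

text \<open>On periodic elements \<open>T k\<close> is inverted by another iterate of
  transport.\<close>

lemma T_periodic_back: "T M a = a \<Longrightarrow> M \<ge> 1 \<Longrightarrow> T k (T (M * k - k) a) = a"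
  using T_add[of "M * k - k" k a] T_mult[of M a k] by simp

text \<open>The edges leaving \<open>v\<close> in the sliding circuits graph, which Algorithm 2 has
  to list.\<close>

definition arrow :: "'a \<Rightarrow> bool" where
  "arrow r \<longleftrightarrow> r \<in> circuit_conjugators \<and> r \<noteq> \<one> \<and>
     (\<forall>b \<in> circuit_conjugators. b \<preceq> r \<longrightarrow> b = \<one> \<or> b = r)"

lemma arrowD:
  assumes "arrow r"
  shows "r \<in> circuit_conjugators" "r \<in> summit_conjugators" "r \<in> P" "r \<in> carrier G" "r \<noteq> \<one>"
  using assms circuit_subset_summit by (auto simp: arrow_def)

text \<open>On circuit conjugators transport is monotone and has a monotone inverse, so it permutes
  the minimal ones.\<close>

lemma arrow_T:
  assumes r: "arrow r"
  shows "arrow (T k r)"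
proof -
  have "T k r \<noteq> \<one>"
  proof
    assume *: "T k r = \<one>"
    obtain M where M: "M \<ge> 1" "T M r = r"
      using circuit_period arrowD[OF r] by blast
    have "T (M * k - k) (T k r) = r"
      using T_add[of k "M * k - k" r] T_mult[OF M(2), of k] M(1) by simp
    then show False
      using * arrowD[OF r] by simp
  qed
  moreover have "b = \<one> \<or> b = T k r" if b: "b \<in> circuit_conjugators" "b \<preceq> T k r" for b
  proof -
    obtain M where M: "M \<ge> 1" "T M b = b" "T M r = r"
      using circuit_common_period arrowD[OF r] b by metis
    let ?b = "T (M * k - k) b"
    have "?b \<preceq> T (M * k - k) (T k r)"
      using b arrowD[OF r] circuit_subset_summit by (intro T_mono) auto
    also have "T (M * k - k) (T k r) = r"
      using T_add[of k "M * k - k" r] T_mult[OF M(3), of k] M(1) by simp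
    finally have "?b = \<one> \<or> ?b = r"
      using r circuit_T[OF b(1)] by (auto simp: arrow_def)
    moreover have "T k ?b = b"
      using M T_periodic_back by simp
    ultimately show ?thesis
      by auto
  qed
  ultimately show ?thesis
    using circuit_T arrowD[OF r] by (simp add: arrow_def)
qed

text \<open>\<open>r \<triangle> u\<close> is again a circuit conjugator and is nontrivial because
  of \<open>a\<close>, so minimality gives \<open>r \<triangle> u = r\<close>.\<close>

lemma arrow_le:
  assumes r: "arrow r" and u: "u \<in> circuit_conjugators"
    and a: "a \<in> P" "a \<noteq> \<one>" "a \<preceq> r" "a \<preceq> u"
  shows "r \<preceq> u"
proof -
  have c: "u \<in> carrier G" "r \<in> carrier G"
    using u arrowD[OF r] circuit_subset_summit by auto
  have "r \<triangle> u \<noteq> \<one>"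
  proof
    assume "r \<triangle> u = \<one>"
    then have "a \<preceq> \<one>"
      using le_meet_iff[of r u a] a c by simp
    then show False
      using a le_antisym[of a \<one>] by (simp add: one_le_iff)
  qed
  then have "r \<triangle> u = r"
    using r circuit_meet[of r u] arrowD[OF r] u meet_left c by (auto simp: arrow_def)
  then show ?thesis
    using meet_right[of r u] c by simp
qed

lemma arrow_unique:
  assumes "arrow r" "arrow u" "a \<in> P" "a \<noteq> \<one>" "a \<preceq> r" "a \<preceq> u"
  shows "u = r"
  using assms arrow_le[of r u a] arrow_le[of u r a] arrowD le_antisym by blast

text \<open>The cycle of transports may be entered only after a preperiod; \<open>r\<close> has to
  be met inside the cycle.\<close>

lemma T_reaches_late:
  assumes "T K s = r" "r \<in> circuit_conjugators"
  shows "\<exists>K'\<ge>n. T K' s = r"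
proof -
  obtain M where M: "M \<ge> 1" "T M r = r"
    using circuit_period assms by blast
  then have "T (K + M * n) s = r" "K + M * n \<ge> n"
    using assms by (auto simp: T_add T_mult intro: trans_le_add2)
  then show ?thesis by blast
qed

text \<open>A \<open>y\<close> centralising \<open>v\<close> does not alter the end point, and
  conjugation by \<open>\<Delta> [^] j\<close> leads to a circuit because transport fixes this
  power. With \<open>y\<close> equal to \<open>v\<close>, \<open>inv v\<close> and
  \<open>\<one>\<close> this covers the three terms of the preferred prefix.\<close>

lemma shift_one_circuit:
  assumes y: "y \<in> carrier G" "y \<otimes> v = v \<otimes> y" and j: "\<one> \<preceq> shift y j \<one>"
  shows "shift y j \<one> \<in> circuit_conjugators"
proof -
  have "v \<star> y = v"
    using y conj_by_commutes[of v y] by simp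
  then have "v \<star> shift y j \<one> = v \<star> (\<Delta> [^] j)"
    using y by (simp add: shift_def conj_by_mult)
  moreover have "(slide ^^ N) (v \<star> (\<Delta> [^] j)) = v \<star> (\<Delta> [^] j)"
    using T_conj[of "\<Delta> [^] j" 1] by (simp add: T_Delta_pow)
  ultimately show ?thesis
    using y j period_positive circuit_conjugatorsI[of "shift y j \<one>" N] by (simp add: one_le_iff)
qed

lemma repetition_circuit:
  assumes s: "s \<in> summit_conjugators" and ij: "i < j" "T i s = T j s"
  shows "T i s \<in> circuit_conjugators"
proof -
  have "T (j - i) (T i s) = T i s"
    using ij T_add[of i "j - i" s] by simp
  then show ?thesis
    using s ij(1) by (auto simp: circuit_iff intro!: exI[of _ "j - i"])
qed

lemma disjoint_mono:
  assumes "s \<in> P" "r \<in> carrier G" "c \<in> carrier G" "s \<preceq> r" "\<one> \<preceq> c" "r \<triangle> c = \<one>"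
  shows "s \<triangle> c = \<one>"
proof (rule le_antisym)
  show "s \<triangle> c \<preceq> \<one>"
    using meet_mono[of s r c c] assms by simp
qed (use assms in \<open>auto simp: one_le_iff\<close>)

lemma le_ne_one:
  assumes "a \<in> P" "a \<noteq> \<one>" "a \<preceq> s"
  shows "s \<noteq> \<one>"
  using assms le_antisym[of a \<one>] by (auto simp: one_le_iff)

text \<open>
  The arrow \<open>r\<close> is disjoint from one of \<open>E \<one>\<close>, where \<open>E\<close> is one of the first two shifts in \<open>step v\<close>:
  otherwise it would lie below the preferred prefix. As \<open>(step v ^^ n) \<one> \<preceq> (E ^^ n) \<one>\<close>, this prevents
  the transports of \<open>s\<close> from becoming trivial.
\<close>

lemma transport_reaches:
  assumes r: "arrow r" and a: "a \<in> P" "a \<noteq> \<one>" "\<not> a \<preceq> preferred_prefix v"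
    and s: "s \<in> summit_conjugators" "a \<preceq> s" "s \<preceq> r"
  shows "\<exists>K. T K s = r"
proof -
  note r' = arrowD[OF r]
  have one: "\<one> \<preceq> shift v (- infimum v) \<one>" "\<one> \<preceq> shift (inv v) (supremum v) \<one>"
    using conj_SSS_iff[of v \<one>] vertex_SSS by auto
  have alt: "r \<triangle> c = \<one> \<or> r \<preceq> c" if c: "c \<in> circuit_conjugators" for c
  proof -
    have "c \<in> carrier G" using c circuit_subset_summit by auto
    then show ?thesis
      using r circuit_meet[of r c] c r' meet_left[of r c] meet_right[of r c]
      unfolding arrow_def by metis
  qed
  \<comment> \<open>Some power of \<open>\<Delta>\<close> exceeds \<open>r\<close>, so by
    \<open>increments_absorbed\<close> \<open>r\<close> is not disjoint from
    \<open>\<Delta>\<close>; minimality turns this into \<open>r \<preceq> \<Delta>\<close>.\<close>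
  have "r \<preceq> shift \<one> 1 \<one>"
  proof -
    obtain t where t: "0 \<le> t" "r \<preceq> \<Delta> [^] (t :: int)"
      using Delta_bounds[of r] r' by auto
    have pow: "(shift \<one> 1 ^^ n) \<one> = \<Delta> [^] int n" for n
    proof (induction n)
      case (Suc n)
      then show ?case
        using Delta_pow_add[of "int n" 1] by (simp add: shift_def add.commute)
    qed simp
    have "r \<triangle> shift \<one> 1 \<one> \<noteq> \<one>"
      using increments_absorbed[of \<one> r 1 "nat t"] r' t le_shift_one[of r 1] le_shift_one[of \<one> 1]
      by (auto simp: pow)
    then show ?thesis
      using alt[OF shift_one_circuit[of \<one> 1]] le_shift_one[of \<one> 1] by simp
  qed
  moreover have "\<not> r \<preceq> step v \<one>"
    using a s r' le_trans[of a s r] le_trans[of a r "step v \<one>"] by (auto simp: step_one)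
  ultimately have "\<not> (r \<preceq> shift v (- infimum v) \<one> \<and> r \<preceq> shift (inv v) (supremum v) \<one>)"
    using r' by (simp add: le_slide_step_iff)
  then obtain y k where y: "y \<in> carrier G" and disjoint: "r \<triangle> shift y k \<one> = \<one>"
    and le_E: "\<And>c. c \<in> carrier G \<Longrightarrow> step v c \<preceq> shift y k c"
    and one_E: "\<one> \<preceq> shift y k \<one>" and s_E: "s \<preceq> shift y k s"
    using alt[OF shift_one_circuit[OF _ _ one(1)]] alt[OF shift_one_circuit[OF _ _ one(2)]] one
      conj_SSS_iff[of v s] vertex_SSS s slide_step_le[of v _ "infimum v" "supremum v"]
      that[of v "- infimum v"] that[of "inv v" "supremum v"] by auto
  have pow: "(step v ^^ n) \<one> \<preceq> (shift y k ^^ n) \<one>" "(shift y k ^^ n) \<one> \<in> carrier G" for n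
  proof (induction n)
    case (Suc n)
    {
      case 1
      show ?case
        using Suc le_E[of "(step v ^^ n) \<one>"] y
          le_trans[of "step v ((step v ^^ n) \<one>)" "shift y k ((step v ^^ n) \<one>)"] by simp
    next
      case 2
      show ?case using Suc y by simp
    }
  qed simp_all
  have s_pow: "s \<preceq> (step v ^^ n) s" for n
  proof (induction n)
    case (Suc n)
    have "s \<preceq> step v s"
      using conj_SSS_iff[of v s] vertex_SSS s le_shift_one[of s 1] by (simp add: le_slide_step_iff)
    moreover have "step v s \<preceq> step v ((step v ^^ n) s)"
      using Suc s by (simp add: slide_step_mono)
    ultimately show ?case
      using s le_trans[of s "step v s"] by simp
  qed (use s in simp)
  \<comment> \<open>A trivial transport would make the iterates of \<open>step v\<close> at
    \<open>\<one>\<close> and at \<open>s\<close> agree. The latter stay above \<open>s\<close>, so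
    \<open>s\<close> would lie below an iterate of \<open>shift y k\<close> at
    \<open>\<one>\<close>.\<close>
  have ne: "T n s \<noteq> \<one>" for n
  proof
    assume "T n s = \<one>"
    then have "(step v ^^ (n * N)) \<one> = (step v ^^ (n * N)) s"
      using iter_transport_eq[of v s "n * N"] vertex_SSS s by (simp add: T_def)
    then have "s \<preceq> (shift y k ^^ (n * N)) \<one>"
      using s_pow[of "n * N"] pow[of "n * N"] s
        le_trans[of s "(step v ^^ (n * N)) s" "(shift y k ^^ (n * N)) \<one>"] by simp
    then show False
      using increments_absorbed[of y s k "n * N"] disjoint_mono[of s r "shift y k \<one>"]
        y s s_E one_E disjoint r' le_ne_one[of a s] a by simp
  qed
  obtain M where M: "M \<ge> 1" "T M r = r"
    using circuit_period r' by blast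
  \<comment> \<open>At multiples of the period of \<open>r\<close>, \<open>r\<close> remains an
    upper bound; the periodic transport found there is nontrivial and hence equal to
    \<open>r\<close>.\<close>
  obtain i j where ij: "i < j" "T (M * i) s = T (M * j) s"
    using finite_range_repetition[OF finite_range_T[OF s(1), of "\<lambda>k. M * k"]] by blast
  have "T (M * i) s \<in> circuit_conjugators"
    using repetition_circuit[OF s(1) _ ij(2)] ij(1) M(1) by simp
  moreover have "T (M * i) s \<preceq> r"
    using T_mono[OF s(1) r'(2) s(3), of "M * i"] T_mult[OF M(2)] by simp
  ultimately show ?thesis
    using r ne[of "M * i"] by (auto simp: arrow_def)
qed

end

section \<open>Pullback\<close>

context garside_nontrivial
begin

text \<open>A positive element has finitely many positive prefixes, and a proper prefix has
  fewer.\<close>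

lemma minimal_element:
  assumes X: "X \<subseteq> P" "X \<noteq> {}"
  obtains u where "u \<in> X" "\<And>u'. u' \<in> X \<Longrightarrow> u' \<preceq> u \<Longrightarrow> u' = u"
proof -
  obtain u0 where u0: "u0 \<in> X" using X by auto
  define f where "f u = card {g \<in> carrier G. \<one> \<preceq> g \<and> g \<preceq> u}" for u
  obtain u where u: "u \<in> X" and min: "\<And>u'. u' \<in> X \<Longrightarrow> f u \<le> f u'"
    using exists_least_iff[of "\<lambda>n. \<exists>u \<in> X. f u = n"] u0 by (metis not_le_imp_less)
  have "u' = u" if u': "u' \<in> X" "u' \<preceq> u" for u'
  proof -
    have c: "u \<in> P" "u' \<in> P" using u u' X by auto
    have "{g \<in> carrier G. \<one> \<preceq> g \<and> g \<preceq> u'} = {g \<in> carrier G. \<one> \<preceq> g \<and> g \<preceq> u}"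
    proof (intro card_seteq finite_interval subsetI)
      fix g assume "g \<in> {g \<in> carrier G. \<one> \<preceq> g \<and> g \<preceq> u'}"
      then show "g \<in> {g \<in> carrier G. \<one> \<preceq> g \<and> g \<preceq> u}"
        using u'(2) c le_trans[of g u' u] by simp
    qed (use min[OF u'(1)] c in \<open>auto simp: f_def\<close>)
    moreover have "u \<in> {g \<in> carrier G. \<one> \<preceq> g \<and> g \<preceq> u}"
      using c by (simp add: one_le_iff)
    ultimately have "u \<preceq> u'" by blast
    then show ?thesis using u'(2) c le_antisym by blast
  qed
  with u that show ?thesis by blast
qed

lemma least_element:
  assumes X: "X \<subseteq> P" "X \<noteq> {}" and meet: "\<And>a b. a \<in> X \<Longrightarrow> b \<in> X \<Longrightarrow> a \<triangle> b \<in> X"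
  obtains u where "u \<in> X" "\<And>u'. u' \<in> X \<Longrightarrow> u \<preceq> u'"
proof -
  obtain u where u: "u \<in> X" "\<And>u'. u' \<in> X \<Longrightarrow> u' \<preceq> u \<Longrightarrow> u' = u"
    using minimal_element[OF X] by blast
  have "u \<preceq> u'" if u': "u' \<in> X" for u'
  proof -
    have "u \<in> carrier G" "u' \<in> carrier G" using u u' X by auto
    then show ?thesis
      using u(2)[OF meet[OF u(1) u']] meet_left[of u u'] meet_right[of u u'] by simp
  qed
  with u that show ?thesis by blast
qed

text \<open>Candidates are closed under meets because transport preserves meets, and a power of
  \<open>\<Delta>\<close> is among them. The least candidate is a lower adjoint value since
  transport is monotone.\<close>

lemma pullback_candidates_least:
  assumes z: "z \<in> carrier G" "z \<in> SSS z" and s: "s \<in> P"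
  obtains u where "u \<in> pullback_candidates z s"
    "\<And>u'. u' \<in> P \<Longrightarrow> z \<star> u' \<in> SSS z \<Longrightarrow> u \<preceq> u' \<longleftrightarrow> s \<preceq> transport z u'"
proof -
  let ?X = "pullback_candidates z s"
  have sub: "?X \<subseteq> P"
    by (auto simp: pullback_candidates_def)
  obtain t where t: "0 \<le> t" "s \<preceq> \<Delta> [^] (t :: int)"
    using Delta_bounds[of s] s by auto
  have "\<Delta> [^] t \<in> P"
    using t Delta_pow_mono[of 0 t] one_le_iff[of "\<Delta> [^] t"] by simp
  then have "\<Delta> [^] t \<in> ?X"
    using t z by (simp add: pullback_candidates_def Delta_pow_in_SSS transport_Delta_pow)
  moreover have "a \<triangle> b \<in> ?X" if "a \<in> ?X" "b \<in> ?X" for a b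
  proof -
    have ab: "a \<in> P" "b \<in> P" "z \<star> a \<in> SSS z" "z \<star> b \<in> SSS z"
      "s \<preceq> transport z a" "s \<preceq> transport z b"
      using that by (auto simp: pullback_candidates_def)
    then have "a \<triangle> b \<in> P"
      using one_le_iff[of "a \<triangle> b"] by (simp add: one_le_iff)
    then show ?thesis
      using ab z s by (simp add: pullback_candidates_def conj_meet_SSS transport_meet)
  qed
  ultimately obtain u where u: "u \<in> ?X" "\<And>u'. u' \<in> ?X \<Longrightarrow> u \<preceq> u'"
    using least_element[OF sub] by blast
  have "u \<preceq> u' \<longleftrightarrow> s \<preceq> transport z u'" if u': "u' \<in> P" "z \<star> u' \<in> SSS z" for u'
  proof
    have u_P: "u \<in> P" "z \<star> u \<in> SSS z" "s \<preceq> transport z u"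
      using u(1) by (auto simp: pullback_candidates_def)
    assume "u \<preceq> u'"
    then have "transport z u \<preceq> transport z u'"
      using z u_P u' by (simp add: transport_mono)
    then show "s \<preceq> transport z u'"
      using le_trans[of s "transport z u" "transport z u'"] u_P u' s z by simp
  next
    assume "s \<preceq> transport z u'"
    then show "u \<preceq> u'"
      using u(2) u' by (simp add: pullback_candidates_def)
  qed
  with u(1) that show ?thesis by blast
qed

text \<open>Sliding on to a common multiple of both periods recovers both points. This gives the
  uniqueness behind the preimages selected by \<open>THE\<close> in the definitions of
  pullback.\<close>

lemma slide_periodic_inj:
  assumes "(slide ^^ m) y = y" "m \<ge> 1" "(slide ^^ n) z = z" "n \<ge> 1"
    and "(slide ^^ k) y = (slide ^^ k) z"
  shows "y = z"
proof -
  let ?l = "m * (n * k) - k"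
  have l: "?l + k = m * (n * k) + 0"
    using assms(2,4) by simp
  have "(slide ^^ (?l + k)) y = (slide ^^ (?l + k)) z"
    using assms(5) unfolding funpow_add comp_apply by simp
  then show ?thesis
    using slide_periodic[OF assms(1), of "n * k" 0] slide_periodic[OF assms(3), of "m * k" 0]
    unfolding l by (simp add: mult.left_commute)
qed

text \<open>The definition asks for the unique minimal candidate; a least candidate is minimal and
  excludes all others.\<close>

lemma pullback_slide:
  assumes z: "z \<in> carrier G" and m: "(slide ^^ m) z = z" "m \<ge> 1" and s: "s \<in> P"
  shows "pullback (slide z) s \<in> P"
    and "z \<star> pullback (slide z) s \<in> SSS z"
    and "u \<in> P \<Longrightarrow> z \<star> u \<in> SSS z \<Longrightarrow> pullback (slide z) s \<preceq> u \<longleftrightarrow> s \<preceq> transport z u"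
proof -
  have z_SC: "z \<in> SC z"
    using z m conjugates_refl by (auto simp: SC_def)
  have z_SSS: "z \<in> SSS z"
    using SC_subset_SSS[OF z] z_SC by auto
  have "slide z \<in> conjugates z"
    using z by (auto simp: slide_def)
  then have "z \<in> SC (slide z)"
    using SC_eq[of z "slide z"] z z_SC by simp
  moreover have "z' = z" if "z' \<in> SC (slide z)" "slide z' = slide z" for z'
    using that slide_periodic_inj[of _ z' m z 1] m by (auto simp: SC_def)
  ultimately have the_z: "(THE z'. z' \<in> SC (slide z) \<and> slide z' = slide z) = z"
    by blast
  obtain u0 where u0: "u0 \<in> pullback_candidates z s"
    "\<And>u'. u' \<in> P \<Longrightarrow> z \<star> u' \<in> SSS z \<Longrightarrow> u0 \<preceq> u' \<longleftrightarrow> s \<preceq> transport z u'"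
    using pullback_candidates_least[OF z z_SSS s] by blast
  have le: "u0 \<preceq> u'" if "u' \<in> pullback_candidates z s" for u'
    using that u0(2) by (auto simp: pullback_candidates_def)
  have P: "u' \<in> P" if "u' \<in> pullback_candidates z s" for u'
    using that by (auto simp: pullback_candidates_def)
  have "pullback (slide z) s = u0"
    unfolding pullback_def the_z Let_def
  proof (rule the_equality)
    show "u0 \<in> pullback_candidates z s \<and> (\<forall>u'\<in>pullback_candidates z s. u' \<preceq> u0 \<longrightarrow> u' = u0)"
      using u0(1) le P le_antisym by blast
  next
    fix u assume "u \<in> pullback_candidates z s \<and> (\<forall>u'\<in>pullback_candidates z s. u' \<preceq> u \<longrightarrow> u' = u)"
    then show "u = u0"
      using u0(1) le by blast
  qed
  then show "pullback (slide z) s \<in> P" "z \<star> pullback (slide z) s \<in> SSS z"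
    "u \<in> P \<Longrightarrow> z \<star> u \<in> SSS z \<Longrightarrow> pullback (slide z) s \<preceq> u \<longleftrightarrow> s \<preceq> transport z u"
    using u0 by (auto simp: pullback_candidates_def)
qed

end

section \<open>Iterated pullback as lower adjoint of iterated transport\<close>

context circuit_vertex
begin

text \<open>The point of the circuit from which \<open>k\<close> slides lead to \<open>v\<close>,
  reached by going forward around the circuit.\<close>

definition preimage :: "nat \<Rightarrow> 'a" where
  "preimage k = (slide ^^ (k * N - k)) v"

lemma slide_iter_period: "(slide ^^ N) ((slide ^^ k) v) = (slide ^^ k) v"
  using period by (metis add.commute comp_apply funpow_add)

lemma preimage_carrier [simp, intro]: "preimage k \<in> carrier G"
  by (simp add: preimage_def)

lemma preimage_SSS: "preimage k \<in> SSS (preimage k)"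
  using slide_iter_SSS_self vertex_SSS by (simp add: preimage_def)

lemma slide_preimage: "slide (preimage (Suc k)) = preimage k"
proof -
  have "Suc (Suc k * N - Suc k) = k * N - k + N"
    using period_positive by (cases N) auto
  then have "slide (preimage (Suc k)) = (slide ^^ (k * N - k + N)) v"
    by (metis comp_apply funpow.simps(2) preimage_def)
  also have "\<dots> = preimage k"
    by (simp add: preimage_def funpow_add period)
  finally show ?thesis .
qed

lemma preimage_mult: "preimage (k * N) = v"
  using slide_mult_period[of "k * N - k"] by (simp add: preimage_def diff_mult_distrib)

lemma the_preimage: "(THE w. w \<in> sliding_circuit v \<and> (slide ^^ k) w = v) = preimage k"
proof (rule the_equality)
  have "(slide ^^ k) (preimage k) = (slide ^^ (k + (k * N - k))) v"
    by (simp add: preimage_def funpow_add)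
  also have "k + (k * N - k) = k * N"
    using period_positive by simp
  finally show *: "preimage k \<in> sliding_circuit v \<and> (slide ^^ k) (preimage k) = v"
    by (auto simp: sliding_circuit_def preimage_def slide_mult_period)
  fix w assume w: "w \<in> sliding_circuit v \<and> (slide ^^ k) w = v"
  have "(slide ^^ N) u = u" if "u \<in> sliding_circuit v" for u
    using that slide_iter_period by (auto simp: sliding_circuit_def)
  then show "w = preimage k"
    using * w slide_periodic_inj[of N w N "preimage k" k] period_positive by simp
qed

lemma iter_pullback_adjoint:
  assumes s: "s \<in> summit_conjugators"
  shows "iter_pullback v s k \<in> P"
    and "preimage k \<star> iter_pullback v s k \<in> SSS (preimage k)"
    and "u \<in> P \<Longrightarrow> preimage k \<star> u \<in> SSS (preimage k) \<Longrightarrow>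
      iter_pullback v s k \<preceq> u \<longleftrightarrow> s \<preceq> iter_transport (preimage k) u k"
proof (induction k arbitrary: u)
  case 0
  {
    case 1
    show ?case using s by simp
  next
    case 2
    show ?case using s by (simp add: preimage_def)
  next
    case 3
    show ?case by simp
  }
next
  case (Suc k)
  let ?z = "preimage (Suc k)"
  have periodic: "(slide ^^ N) ?z = ?z" "N \<ge> 1"
    using slide_iter_period period_positive by (simp_all add: preimage_def)
  have eq: "iter_pullback v s (Suc k) = pullback (slide ?z) (iter_pullback v s k)"
    by (simp add: the_preimage slide_preimage)
  note pb = pullback_slide[OF preimage_carrier periodic Suc(1)]
  {
    case 1
    show ?case unfolding eq by (rule pb)
  next
    case 2
    show ?case unfolding eq by (rule pb)
  next
    case (3 u)
    have "transport ?z u \<in> P" "slide ?z \<star> transport ?z u \<in> SSS (slide ?z)"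
      using iter_transport_positive[of ?z u 1] iter_transport_SSS[of ?z u 1] 3 preimage_SSS by auto
    then have "iter_pullback v s k \<preceq> transport ?z u \<longleftrightarrow>
        s \<preceq> iter_transport (slide ?z) (transport ?z u) k"
      using Suc(3) by (simp add: slide_preimage)
    \<comment> \<open>Adjoints compose in reverse order, so the first transport is split off here,
      whereas the recursion splits off the last.\<close>
    moreover have "iter_transport ?z u (Suc k) = iter_transport (slide ?z) (transport ?z u) k"
      using iter_transport_add[of ?z u 1 k] by simp
    ultimately show ?case
      unfolding eq using pb(3)[OF 3] by simp
  }
qed

lemma iter_pullback_summit: "s \<in> summit_conjugators \<Longrightarrow> iter_pullback v s (k * N) \<in> summit_conjugators"
  using iter_pullback_adjoint(1,2)[of s "k * N"] by (intro summit_conjugatorsI) (simp_all add: preimage_mult)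

lemma iter_pullback_le_iff:
  "s \<in> summit_conjugators \<Longrightarrow> u \<in> summit_conjugators \<Longrightarrow>
    iter_pullback v s (k * N) \<preceq> u \<longleftrightarrow> s \<preceq> T k u"
  using iter_pullback_adjoint(3)[where s = s and u = u and k = "k * N"] by (simp add: preimage_mult T_def)

text \<open>The adjunction turns a fixed power of \<open>\<Delta>\<close> above \<open>s\<close>
  into an upper bound for all pullbacks.\<close>

lemma finite_range_pullback:
  assumes "s \<in> summit_conjugators"
  shows "finite (range (\<lambda>k. iter_pullback v s (k * N)))"
proof -
  obtain t where t: "0 \<le> t" "s \<preceq> \<Delta> [^] (t :: int)"
    using Delta_bounds[of s] assms by auto
  have "iter_pullback v s (k * N) \<preceq> \<Delta> [^] t" for k
    using iter_pullback_le_iff[OF assms Delta_pow_summit] t by (simp add: T_Delta_pow)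
  then have "range (\<lambda>k. iter_pullback v s (k * N)) \<subseteq> {g \<in> carrier G. \<one> \<preceq> g \<and> g \<preceq> \<Delta> [^] t}"
    using iter_pullback_summit[OF assms] by (auto simp: one_le_iff)
  then show ?thesis
    using finite_interval[of \<one> "\<Delta> [^] t"] finite_subset by blast
qed

text \<open>The repeated pullback increases under transport by \<open>j - i\<close> and, by
  adjunction, lies below the periodic preimage of \<open>r\<close> under \<open>T j\<close>. Its
  transports thus stabilise at a circuit conjugator whose image under \<open>T j\<close> lies
  between \<open>s\<close> and \<open>r\<close>; minimality makes this image
  \<open>r\<close>.\<close>

lemma pullback_reaches:
  assumes r: "arrow r" and a: "a \<in> P" "a \<noteq> \<one>"
    and s: "s \<in> summit_conjugators" "a \<preceq> s" "s \<preceq> r"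
    and ij: "i < j" "iter_pullback v s (i * N) = iter_pullback v s (j * N)"
  shows "\<exists>K. T K (iter_pullback v s (j * N)) = r"
proof -
  note r' = arrowD[OF r]
  let ?s = "iter_pullback v s (j * N)"
  have s': "?s \<in> summit_conjugators"
    using iter_pullback_summit s by blast
  have "s \<preceq> T i ?s"
    using iter_pullback_le_iff[OF s(1) s', of i] s' ij by simp
  have s_le: "s \<preceq> T j ?s"
    using iter_pullback_le_iff[OF s(1) s', of j] s' by simp
  have "T j ?s = T i (T (j - i) ?s)"
    using ij T_add[of "j - i" i] by simp
  \<comment> \<open>\<open>?s\<close> is also the \<open>i\<close>-th pullback, so the adjunction
    may be applied with \<open>T i\<close>.\<close>
  then have "?s \<preceq> T (j - i) ?s"
    using iter_pullback_le_iff[OF s(1) T_summit[OF s'], of i "j - i"] s_le ij by simp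
  then have inc1: "T k ?s \<preceq> T (j - i + k) ?s" for k
    using T_mono[OF s' T_summit[OF s'], of "j - i" k] by (simp add: T_add)
  have inc: "T k ?s \<preceq> T ((j - i) * l + k) ?s" for k l
  proof (induction l)
    case (Suc l)
    then show ?case
      using inc1[of "(j - i) * l + k"] s'
        le_trans[of "T k ?s" "T ((j - i) * l + k) ?s" "T ((j - i) * Suc l + k) ?s"]
      by (simp add: add.assoc)
  qed (use s' in simp)

  obtain r0 M where r0: "r0 \<in> circuit_conjugators" "T j r0 = r" and M: "M \<ge> 1" "T M r0 = r0"
  proof -
    obtain M where M: "M \<ge> 1" "T M r = r"
      using circuit_period r' by blast
    let ?r0 = "T (M * j - j) r"
    have "T M ?r0 = T (M * j - j) (T M r)"
      by (simp add: add.commute flip: T_add)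
    then show ?thesis
      using that[of ?r0 M] M T_periodic_back circuit_T r' by simp
  qed
  have r0': "r0 \<in> summit_conjugators"
    using r0 circuit_subset_summit by auto
  have "?s \<preceq> r0"
    using iter_pullback_le_iff[OF s(1) r0', of j] s r0 by simp
  \<comment> \<open>A multiple of \<open>M\<close> keeps \<open>r0\<close> an upper bound, a
    multiple of \<open>j - i\<close> keeps the chain increasing.\<close>
  define L where "L = (j - i) * M"
  define f where "f k = T (L * k) ?s" for k
  have "f k \<preceq> r0" for k
    using T_mono[OF s' r0' \<open>?s \<preceq> r0\<close>, of "L * k"] T_mult[OF M(2), of "(j - i) * k"]
    by (simp add: f_def L_def mult.commute mult.left_commute)
  moreover have "f k \<preceq> f (Suc k)" for k
    using inc[of "L * k" M] by (simp add: f_def L_def)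
  ultimately obtain k where k: "f (Suc k) = f k"
    using increasing_stabilizes[of f r0] s' r0' by (auto simp: f_def)
  then have circ: "f k \<in> circuit_conjugators"
    using repetition_circuit[OF s', of "L * k" "L * Suc k"] ij(1) M(1) by (simp add: f_def L_def)
  have "?s \<preceq> f k"
    using inc[of 0 "M * k"] by (simp add: f_def L_def mult.assoc)
  let ?x = "T j (f k)"
  have fk: "f k \<in> summit_conjugators" "?x \<in> summit_conjugators"
    using circ circuit_subset_summit by auto
  have "T j ?s \<preceq> ?x" "?x \<preceq> r"
    using T_mono[OF s' fk(1) \<open>?s \<preceq> f k\<close>, of j] T_mono[OF fk(1) r0' \<open>f k \<preceq> r0\<close>, of j] r0 by auto
  then have "s \<preceq> ?x"
    using s_le s s' fk le_trans[of s "T j ?s" ?x] by simp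
  then have "a \<preceq> ?x"
    using a s fk le_trans[of a s ?x] by simp
  then have "?x = r"
    using r \<open>?x \<preceq> r\<close> circuit_T[OF circ, of j] le_ne_one a unfolding arrow_def by blast
  then have "T (L * k + j) ?s = r"
    by (simp add: f_def T_add)
  then show ?thesis by blast
qed

end

section \<open>The arrows of the sliding circuits graph\<close>

text \<open>The earlier partner of the first repeated index is unique, since two partners would form
  an earlier repetition.\<close>

lemma first_repetition_Some:
  fixes f :: "nat \<Rightarrow> 'c"
  assumes "finite (range f)"
  obtains i j where "first_repetition f = Some j" "i < j" "f i = f j"
    "(THE i. i < j \<and> f i = f j) = i"
proof -
  let ?Q = "\<lambda>j. \<exists>i<j. f i = f j"
  obtain i0 j0 where "i0 < j0" "f i0 = f j0"
    using finite_range_repetition[OF assms] by blast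
  then have ex: "\<exists>j. ?Q j" by blast
  define j where "j = (LEAST j. ?Q j)"
  have "?Q j"
    unfolding j_def by (rule LeastI_ex[OF ex])
  then obtain i where i: "i < j" "f i = f j" by blast
  have "(THE i. i < j \<and> f i = f j) = i"
  proof (rule the_equality)
    fix i' assume i': "i' < j \<and> f i' = f j"
    have "\<not> ?Q i''" if "i'' < j" for i''
      using not_less_Least that unfolding j_def by blast
    then show "i' = i"
      using i i' by (metis nat_neq_iff)
  qed (use i in simp)
  moreover have "first_repetition f = Some j"
    unfolding first_repetition_def search_def j_def using ex by simp
  ultimately show ?thesis using that i by blast
qed

context garside_nontrivial
begin

lemma atom_below:
  assumes b: "b \<in> P" "b \<noteq> \<one>"
  obtains a where "a \<in> atoms" "a \<preceq> b"
proof -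
  let ?X = "{g \<in> P. g \<noteq> \<one> \<and> g \<preceq> b}"
  have X: "?X \<subseteq> P" "?X \<noteq> {}"
    using b by auto
  then obtain u where u: "u \<in> ?X" "\<And>u'. u' \<in> ?X \<Longrightarrow> u' \<preceq> u \<Longrightarrow> u' = u"
    using minimal_element[OF X] by blast
  have "c = \<one> \<or> d = \<one>" if cd: "c \<in> P" "d \<in> P" "u = c \<otimes> d" for c d
  proof -
    have "c \<preceq> u"
      using cd le_mult_positive by simp
    moreover have "c \<preceq> b"
      using \<open>c \<preceq> u\<close> u(1) cd(1) b le_trans[of c u b] by simp
    ultimately have "c = \<one> \<or> c = u"
      using u(2)[of c] cd(1) by auto
    then show ?thesis
      using cd by auto
  qed
  then have "u \<in> atoms"
    using u(1) by (auto simp: atoms_def)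
  with u(1) that show ?thesis by blast
qed

end

context circuit_vertex
begin

lemma arrow_below:
  assumes "b \<in> circuit_conjugators" "b \<noteq> \<one>"
  obtains r where "arrow r" "r \<preceq> b"
proof -
  let ?X = "{g \<in> circuit_conjugators. g \<noteq> \<one> \<and> g \<preceq> b}"
  have b: "b \<in> carrier G"
    using assms circuit_subset_summit by auto
  have X: "?X \<subseteq> P" "?X \<noteq> {}"
    using assms b circuit_subset_summit by auto
  then obtain u where u: "u \<in> ?X" "\<And>u'. u' \<in> ?X \<Longrightarrow> u' \<preceq> u \<Longrightarrow> u' = u"
    using minimal_element[OF X] by blast
  have "g = \<one> \<or> g = u" if g: "g \<in> circuit_conjugators" "g \<preceq> u" for g
  proof -
    have "g \<in> carrier G" "u \<in> carrier G"
      using g u(1) circuit_subset_summit by auto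
    then have "g \<preceq> b"
      using g u(1) b le_trans[of g u b] by simp
    then show ?thesis
      using g u(2)[of g] by auto
  qed
  then have "arrow u"
    using u(1) by (auto simp: arrow_def)
  with u(1) that show ?thesis by blast
qed

lemma summit_iff_length:
  assumes s: "s \<in> P"
  shows "s \<in> summit_conjugators \<longleftrightarrow> \<not> canonical_length (v \<star> s) > canonical_length v"
proof -
  have c: "v \<star> s \<in> conjugates v" using s by simp
  have "infimum (v \<star> s) \<le> infimum v" "supremum v \<le> supremum (v \<star> s)"
    using vertex_SSS c by (auto simp: SSS_def)
  then have "v \<star> s \<in> SSS v \<longleftrightarrow> \<not> canonical_length (v \<star> s) > canonical_length v"
    using SSS_iff[OF vertex_carrier vertex_SSS c] by (auto simp: canonical_length_def)
  then show ?thesis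
    using s summit_conjugatorsI summit_conjugatorsD(3) by blast
qed

text \<open>The loop body replaces \<open>s\<close> by its join with
  \<open>shift (inv v) (infimum v) s\<close> and \<open>shift v (- supremum v) s\<close>, the
  inverse images of \<open>s\<close> under the two shifts characterising the super summit set. Every
  super summit conjugator above \<open>s\<close> lies above this join, so the loop ends in the least
  one above \<open>a\<close>.\<close>

lemma summit_closure:
  assumes a: "a \<in> P"
  obtains s where
    "while_option (\<lambda>s. canonical_length (v \<star> s) > canonical_length v)
       (\<lambda>s. s \<otimes> (\<one> \<nabla> inv (v \<star> s) \<otimes> \<Delta> [^] infimum v \<nabla> (v \<star> s) \<otimes> \<Delta> [^] (- supremum v))) a
     = Some s"
    "s \<in> summit_conjugators" "a \<preceq> s"
    "\<And>u. u \<in> summit_conjugators \<Longrightarrow> a \<preceq> u \<Longrightarrow> s \<preceq> u"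
proof -
  define b where "b = (\<lambda>s. canonical_length (v \<star> s) > canonical_length v)"
  define c where "c = (\<lambda>s. s \<otimes>
    (\<one> \<nabla> inv (v \<star> s) \<otimes> \<Delta> [^] infimum v \<nabla> (v \<star> s) \<otimes> \<Delta> [^] (- supremum v)))"
  define I where "I s \<longleftrightarrow> s \<in> P \<and> a \<preceq> s \<and> (\<forall>u \<in> summit_conjugators. a \<preceq> u \<longrightarrow> s \<preceq> u)" for s
  obtain t where t: "0 \<le> t" "a \<preceq> \<Delta> [^] (t :: int)"
    using Delta_bounds[of a] a by auto
  \<comment> \<open>\<open>\<Delta> [^] t\<close> is itself a super summit conjugator above
    \<open>a\<close>, so all iterates stay below it and this count drops.\<close>
  define f where "f s = card {g \<in> carrier G. s \<preceq> g \<and> g \<preceq> \<Delta> [^] t}" for s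

  have c_le: "c s \<preceq> u \<longleftrightarrow> s \<preceq> u \<and> shift (inv v) (infimum v) s \<preceq> u \<and> shift v (- supremum v) s \<preceq> u"
    if "s \<in> carrier G" "u \<in> carrier G" for s u
  proof -
    have *: "g \<preceq> inv s \<otimes> u \<longleftrightarrow> s \<otimes> g \<preceq> u" if "g \<in> carrier G" for g
      using mult_le_iff[of s g "inv s \<otimes> u"] that \<open>s \<in> carrier G\<close> \<open>u \<in> carrier G\<close>
      by (simp del: mult_le_iff)
    have "c s \<preceq> u \<longleftrightarrow> \<one> \<nabla> inv (v \<star> s) \<otimes> \<Delta> [^] infimum v \<nabla> (v \<star> s) \<otimes> \<Delta> [^] (- supremum v)
        \<preceq> inv s \<otimes> u"
      unfolding c_def using that by (intro *[symmetric]) simp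
    moreover have "s \<otimes> (inv (v \<star> s) \<otimes> \<Delta> [^] infimum v) = shift (inv v) (infimum v) s"
      "s \<otimes> (v \<star> s \<otimes> \<Delta> [^] (- supremum v)) = shift v (- supremum v) s"
      using that by (simp_all add: conj_by_def shift_def m_assoc inv_mult_group)
    ultimately show ?thesis
      using that *[of \<one>] *[of "inv (v \<star> s) \<otimes> \<Delta> [^] infimum v"]
        *[of "(v \<star> s) \<otimes> \<Delta> [^] (- supremum v)"] by simp
  qed
  have c_closed: "c s \<in> carrier G" if "s \<in> carrier G" for s
    using that by (simp add: c_def)
  have le_c: "s \<preceq> c s" "c s \<in> P" if "s \<in> P" for s
  proof -
    show "s \<preceq> c s"
      using c_le[of s "c s"] c_closed[of s] that by simp
    then show "c s \<in> P"
      using that le_trans[of \<one> s "c s"] c_closed[of s] by (simp add: one_le_iff)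
  qed
  have summit_c: "c s \<preceq> u" if "s \<in> P" "u \<in> summit_conjugators" "s \<preceq> u" for s u
  proof -
    have "u \<preceq> shift v (- infimum v) u" "u \<preceq> shift (inv v) (supremum v) u"
      using conj_SSS_iff[of v u] that vertex_SSS by auto
    then have "s \<preceq> shift v (- infimum v) u" "s \<preceq> shift (inv v) (supremum v) u"
      using that le_trans[of s u "shift v (- infimum v) u"]
        le_trans[of s u "shift (inv v) (supremum v) u"] by auto
    then show ?thesis
      using that shift_adjoint[of v s u "- infimum v"] shift_adjoint[of "inv v" s u "supremum v"]
      by (simp add: c_le)
  qed
  have fixed: "s \<in> summit_conjugators" if "s \<in> P" "c s = s" for s
  proof (rule summit_conjugatorsI)
    have "shift (inv v) (infimum v) s \<preceq> s" "shift v (- supremum v) s \<preceq> s"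
      using c_le[of s s] that by auto
    then show "v \<star> s \<in> SSS v"
      using that conj_SSS_iff[of v s] vertex_SSS shift_adjoint[of v s s "- infimum v"]
        shift_adjoint[of "inv v" s s "supremum v"] by simp
  qed (rule that)
  have step: "I (c s) \<and> f (c s) < f s" if s: "I s" "b s" for s
  proof
    have P: "s \<in> P" "a \<preceq> s" using s by (auto simp: I_def)
    then show "I (c s)"
      using s le_c[of s] summit_c[of s] a le_trans[of a s "c s"] by (auto simp: I_def)
    have "s \<notin> summit_conjugators"
      using s(2) P summit_iff_length by (simp add: b_def)
    then have ne: "c s \<noteq> s"
      using fixed P by blast
    have "{g \<in> carrier G. c s \<preceq> g \<and> g \<preceq> \<Delta> [^] t} \<subset> {g \<in> carrier G. s \<preceq> g \<and> g \<preceq> \<Delta> [^] t}"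
    proof (rule psubsetI)
      show "{g \<in> carrier G. c s \<preceq> g \<and> g \<preceq> \<Delta> [^] t} \<subseteq> {g \<in> carrier G. s \<preceq> g \<and> g \<preceq> \<Delta> [^] t}"
      proof
        fix g assume "g \<in> {g \<in> carrier G. c s \<preceq> g \<and> g \<preceq> \<Delta> [^] t}"
        then show "g \<in> {g \<in> carrier G. s \<preceq> g \<and> g \<preceq> \<Delta> [^] t}"
          using P le_c[of s] le_trans[of s "c s" g] by simp
      qed
      have "s \<preceq> \<Delta> [^] t"
        using s(1) Delta_pow_summit t by (auto simp: I_def)
      moreover have "\<not> c s \<preceq> s"
        using ne le_c[of s] P le_antisym[of "c s" s] by auto
      ultimately have "s \<in> {g \<in> carrier G. s \<preceq> g \<and> g \<preceq> \<Delta> [^] t}"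
        "s \<notin> {g \<in> carrier G. c s \<preceq> g \<and> g \<preceq> \<Delta> [^] t}"
        using P by simp_all
      then show "{g \<in> carrier G. c s \<preceq> g \<and> g \<preceq> \<Delta> [^] t} \<noteq> {g \<in> carrier G. s \<preceq> g \<and> g \<preceq> \<Delta> [^] t}"
        by blast
    qed
    then show "f (c s) < f s"
      unfolding f_def using P by (intro psubset_card_mono finite_interval) auto
  qed
  have I_a: "I a"
    using a by (simp add: I_def)
  obtain s where s: "while_option b c a = Some s"
    using measure_while_option_Some[of I b c f a] step I_a by blast
  have "I s"
    using while_option_rule[of I b c a s] step s I_a by blast
  moreover have "\<not> b s"
    using while_option_stop[OF s] .
  ultimately show ?thesis
    using that[OF s[unfolded b_def c_def]] summit_iff_length[of s] by (simp add: I_def b_def)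
qed

section \<open>The loop over the atoms in Algorithm 2\<close>

lemma T_cycle:
  assumes ij: "i < j" "T i s = T j s" and K: "K \<ge> i"
  obtains m where "i \<le> m" "m < j" "T m s = T K s"
proof -
  define d where "d = j - i"
  define m where "m = i + (K - i) mod d"
  have d: "d > 0" "T d (T i s) = T i s"
    using ij T_add[of i "j - i" s] by (simp_all add: d_def)
  have "K = i + d * ((K - i) div d) + (K - i) mod d"
    using K by simp
  then have "T K s = T ((K - i) mod d) (T (d * ((K - i) div d)) (T i s))"
    by (metis T_add)
  also have "\<dots> = T m s"
    using T_mult[OF d(2)] by (simp add: m_def T_add)
  finally have "T m s = T K s" by simp
  moreover have "(K - i) mod d < d"
    using d(1) by simp
  then have "i \<le> m" "m < j"
    by (simp_all add: m_def d_def)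
  ultimately show ?thesis
    using that by blast
qed

text \<open>The last conclusion holds for any choice of index: if an arrow \<open>r\<close> lies
  above the atom, every element of the cycle is a transport of \<open>r\<close>, hence an arrow, and
  the one chosen shares the atom with \<open>r\<close>.\<close>

lemma arrows_step_result:
  assumes pick_index: "\<And>v a M. M \<noteq> {} \<Longrightarrow> pick_index v a M \<in> M"
    and a: "as ! t \<in> P" "as ! t \<noteq> \<one>"
  obtains u found where
    "arrows_step pick_index as v N t (A, Atoms) = Some
      (if found \<and> (\<forall>k < length as. as ! k \<in> Atoms \<or> k > t \<longrightarrow> \<not> as ! k \<preceq> u)
       then (A \<union> {u}, Atoms \<union> {as ! t}) else (A, Atoms))"
    "found \<Longrightarrow> u \<in> circuit_conjugators \<and> as ! t \<preceq> u"
    "\<And>r. arrow r \<Longrightarrow> as ! t \<preceq> r \<Longrightarrow> found \<and> u = r"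
proof -
  let ?a = "as ! t"
  obtain s0 where s0:
    "while_option (\<lambda>s. canonical_length (v \<star> s) > canonical_length v)
       (\<lambda>s. s \<otimes> (\<one> \<nabla> inv (v \<star> s) \<otimes> \<Delta> [^] infimum v \<nabla> (v \<star> s) \<otimes> \<Delta> [^] (- supremum v))) ?a
     = Some s0"
    "s0 \<in> summit_conjugators" "?a \<preceq> s0"
    "\<And>u. u \<in> summit_conjugators \<Longrightarrow> ?a \<preceq> u \<Longrightarrow> s0 \<preceq> u"
    using summit_closure[OF a(1)] by blast
  have s0_le: "s0 \<preceq> r" if "arrow r" "?a \<preceq> r" for r
    using s0(4) arrowD that by blast
  define pb where "pb = (if ?a \<preceq> preferred_prefix v
      then do {
        r \<leftarrow> first_repetition (\<lambda>i. iter_pullback v s0 (i * N));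
        Some (iter_pullback v s0 (r * N))
      }
      else Some s0)"
  obtain s where s: "pb = Some s" "s \<in> summit_conjugators"
    and reach: "\<And>r. arrow r \<Longrightarrow> ?a \<preceq> r \<Longrightarrow> \<exists>K. T K s = r"
  proof (cases "?a \<preceq> preferred_prefix v")
    case True
    obtain i j where ij: "first_repetition (\<lambda>i. iter_pullback v s0 (i * N)) = Some j" "i < j"
      "iter_pullback v s0 (i * N) = iter_pullback v s0 (j * N)"
      using first_repetition_Some[OF finite_range_pullback[OF s0(2)]] by blast
    then have "pb = Some (iter_pullback v s0 (j * N))"
      using True by (simp add: pb_def)
    then show ?thesis
      using that iter_pullback_summit[OF s0(2)] pullback_reaches[OF _ a s0(2,3) _ ij(2,3)] s0_le
      by blast
  next
    case False
    then have "pb = Some s0"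
      by (simp add: pb_def)
    then show ?thesis
      using that s0(2) transport_reaches[OF _ a False s0(2,3)] s0_le by blast
  qed
  obtain i j where ij: "first_repetition (\<lambda>i. iter_transport v s (i * N)) = Some j" "i < j"
    "T i s = T j s" "(THE i. i < j \<and> iter_transport v s (i * N) = iter_transport v s (j * N)) = i"
    using first_repetition_Some[OF finite_range_T[OF s(2), of "\<lambda>k. k"]] unfolding T_def by blast
  define M where "M = {m. i \<le> m \<and> m < j \<and> ?a \<preceq> T m s}"
  define u where "u = T (pick_index v ?a M) s"
  have eq: "arrows_step pick_index as v N t (A, Atoms) = Some
      (if M \<noteq> {} \<and> (\<forall>k < length as. as ! k \<in> Atoms \<or> k > t \<longrightarrow> \<not> as ! k \<preceq> u)
       then (A \<union> {u}, Atoms \<union> {as ! t}) else (A, Atoms))"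
    unfolding arrows_step_def prod.case s0(1) Option.bind.bind_lunit pb_def[symmetric] s(1) ij(1)
      Let_def ij(4) M_def u_def T_def
    by (rule refl)
  have cycle: "T m s \<in> circuit_conjugators" if "i \<le> m" for m
    using circuit_T[OF repetition_circuit[OF s(2) ij(2,3)], of "m - i"] T_add[of i "m - i" s] that
    by simp
  have "u \<in> circuit_conjugators \<and> ?a \<preceq> u" if "M \<noteq> {}"
    using pick_index[OF that, of v ?a] cycle by (auto simp: M_def u_def)
  moreover have "M \<noteq> {} \<and> u = r" if r: "arrow r" "?a \<preceq> r" for r
  proof -
    obtain K where "K \<ge> i" "T K s = r"
      using reach[OF r] T_reaches_late arrowD[OF r(1)] by blast
    then obtain m where m: "i \<le> m" "m < j" "T m s = r"
      using T_cycle[OF ij(2,3)] by metis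
    then have M: "M \<noteq> {}"
      using r by (auto simp: M_def)
    define m' where "m' = pick_index v ?a M"
    have m': "i \<le> m'" "m' < j" "?a \<preceq> u"
      using pick_index[OF M, of v ?a] by (auto simp: M_def u_def m'_def)
    \<comment> \<open>\<open>m'\<close> may precede \<open>m\<close>; one additional turn of the
      cycle gives an index beyond \<open>m\<close>, which exhibits \<open>u\<close> as a transport
      of \<open>r\<close>.\<close>
    have "T (j - i) (T m' s) = T (m' - i) (T (j - i) (T i s))"
      using m'(1) T_add[of i "m' - i" s] by (simp add: add.commute flip: T_add)
    also have "\<dots> = T m' s"
      using m'(1) ij T_add[of i "j - i" s] T_add[of i "m' - i" s] by simp
    finally have "u = T (j - i) (T m' s)"
      by (simp add: u_def m'_def)
    also have "\<dots> = T (m' + (j - i) - m) r"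
      using m m' T_add[of m "m' + (j - i) - m" s] by (simp flip: T_add)
    finally have "arrow u"
      using arrow_T r by simp
    then show ?thesis
      using arrow_unique[OF r(1) \<open>arrow u\<close> a r(2) m'(3)] M by simp
  qed
  ultimately show ?thesis
    using that[OF eq] by blast
qed

text \<open>
  An arrow is recorded at the last atom below it. If an atom below \<open>r\<close> already belongs to \<open>Atoms\<close>,
  because of an arrow \<open>u\<close>, then \<open>r \<preceq> u\<close>, contradicting that no later atom lies below \<open>u\<close>.
\<close>

definition last_atom :: "'a list \<Rightarrow> nat \<Rightarrow> 'a \<Rightarrow> bool" where
  "last_atom as k u \<longleftrightarrow>
     k < length as \<and> as ! k \<preceq> u \<and> (\<forall>k' < length as. k' > k \<longrightarrow> \<not> as ! k' \<preceq> u)"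

text \<open>The witness \<open>u\<close> kept for each member of \<open>Atoms\<close> serves to show
  that a recorded atom never blocks an arrow treated later.\<close>

definition loop_invariant :: "'a list \<Rightarrow> nat \<Rightarrow> 'a set \<times> 'a set \<Rightarrow> bool" where
  "loop_invariant as t = (\<lambda>(A, Atoms).
     finite A \<and> A \<subseteq> circuit_conjugators \<and>
     (\<forall>b \<in> Atoms. \<exists>k < t. b = as ! k \<and> (\<exists>u \<in> circuit_conjugators. last_atom as k u)) \<and>
     (\<forall>r k. arrow r \<longrightarrow> k < t \<longrightarrow> last_atom as k r \<longrightarrow> r \<in> A))"

lemma arrows_step_invariant:
  assumes pick_index: "\<And>v a M. M \<noteq> {} \<Longrightarrow> pick_index v a M \<in> M"
    and as: "\<And>k. k < length as \<Longrightarrow> as ! k \<in> P \<and> as ! k \<noteq> \<one>"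
    and t: "t < length as" and inv: "loop_invariant as t (A, Atoms)"
  obtains st where "arrows_step pick_index as v N t (A, Atoms) = Some st"
    "loop_invariant as (Suc t) st"
proof -
  obtain u found where step: "arrows_step pick_index as v N t (A, Atoms) = Some
      (if found \<and> (\<forall>k < length as. as ! k \<in> Atoms \<or> k > t \<longrightarrow> \<not> as ! k \<preceq> u)
       then (A \<union> {u}, Atoms \<union> {as ! t}) else (A, Atoms))" (is "_ = Some (if ?c then _ else _)")
    and found: "found \<Longrightarrow> u \<in> circuit_conjugators \<and> as ! t \<preceq> u"
    and arrow: "\<And>r. arrow r \<Longrightarrow> as ! t \<preceq> r \<Longrightarrow> found \<and> u = r"
    by (rule arrows_step_result[of pick_index as t A Atoms])
      (use pick_index as[OF t] in \<open>blast+\<close>)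
  have A: "finite A" "A \<subseteq> circuit_conjugators"
    and Atoms: "\<And>b. b \<in> Atoms \<Longrightarrow> \<exists>k < t. b = as ! k \<and> (\<exists>u \<in> circuit_conjugators. last_atom as k u)"
    and arrows_A: "\<And>r k. arrow r \<Longrightarrow> k < t \<Longrightarrow> last_atom as k r \<Longrightarrow> r \<in> A"
    using inv unfolding loop_invariant_def by blast+
  have key: "?c \<and> u = r" if r: "arrow r" "last_atom as t r" for r
  proof -
    have u: "found" "u = r"
      using arrow r by (auto simp: last_atom_def)
    have "\<not> as ! k \<preceq> r" if k: "k < length as" "as ! k \<in> Atoms" for k
    proof
      assume le: "as ! k \<preceq> r"
      obtain l w where l: "l < t" "as ! k = as ! l" and w: "w \<in> circuit_conjugators" "last_atom as l w"
        using Atoms[OF k(2)] by blast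
      have "r \<preceq> w"
        using arrow_le[OF r(1) w(1) _ _ le] as[OF k(1)] w(2) l(2) by (simp add: last_atom_def)
      moreover have "w \<in> carrier G"
        using w(1) circuit_subset_summit by auto
      ultimately have "as ! t \<preceq> w"
        using r(2) as[OF t] arrowD(4)[OF r(1)] le_trans[of "as ! t" r w] by (simp add: last_atom_def)
      then show False
        using w(2) t l(1) by (simp add: last_atom_def)
    qed
    then show ?thesis
      using u r(2) by (auto simp: last_atom_def)
  qed
  have "loop_invariant as (Suc t) (if ?c then (A \<union> {u}, Atoms \<union> {as ! t}) else (A, Atoms))"
  proof (cases ?c)
    case True
    have u: "u \<in> circuit_conjugators" "last_atom as t u"
      using True found t by (auto simp: last_atom_def)
    have "\<exists>k < Suc t. b = as ! k \<and> (\<exists>u \<in> circuit_conjugators. last_atom as k u)"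
      if "b \<in> Atoms \<union> {as ! t}" for b
      using that Atoms[of b] u less_SucI by blast
    moreover have "r \<in> A \<union> {u}" if "arrow r" "k < Suc t" "last_atom as k r" for r k
      using that arrows_A[of r k] key[of r] by (cases "k = t") auto
    ultimately have "loop_invariant as (Suc t) (A \<union> {u}, Atoms \<union> {as ! t})"
      using A u unfolding loop_invariant_def by simp
    with True show ?thesis by simp
  next
    case False
    have "\<exists>k < Suc t. b = as ! k \<and> (\<exists>u \<in> circuit_conjugators. last_atom as k u)"
      if "b \<in> Atoms" for b
      using that Atoms[of b] less_SucI by blast
    moreover have "r \<in> A" if "arrow r" "k < Suc t" "last_atom as k r" for r k
    proof (cases "k = t")
      case True
      then show ?thesis using key[of r] that False by blast
    qed (use that arrows_A[of r k] in simp)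
    ultimately have "loop_invariant as (Suc t) (A, Atoms)"
      using A unfolding loop_invariant_def by blast
    with False show ?thesis by (simp only: if_False)
  qed
  with step that show ?thesis by blast
qed

lemma arrows_loop_invariant:
  assumes pick_index: "\<And>v a M. M \<noteq> {} \<Longrightarrow> pick_index v a M \<in> M"
    and as: "\<And>k. k < length as \<Longrightarrow> as ! k \<in> P \<and> as ! k \<noteq> \<one>"
    and t: "t \<le> length as" and inv: "loop_invariant as t st"
  shows "\<exists>st'. arrows_loop pick_index as v N [t..<length as] st = Some st' \<and>
    loop_invariant as (length as) st'"
  using t inv
proof (induction t arbitrary: st rule: inc_induct)
  case base
  then show ?case by simp
next
  case (step t)
  obtain A Atoms where st: "st = (A, Atoms)"
    by (cases st)
  obtain st' where "arrows_step pick_index as v N t st = Some st'" "loop_invariant as (Suc t) st'"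
    using arrows_step_invariant[of pick_index as t A Atoms] pick_index as step.hyps step.prems st
    by blast
  then show ?case
    using step.IH[of st'] step.hyps by (simp add: upt_conv_Cons)
qed

end

context garside_nontrivial
begin

theorem arrows_correct:
  assumes pick_index: "\<And>v a M. M \<noteq> {} \<Longrightarrow> pick_index v a M \<in> M"
    and as: "set as = atoms" and v: "v \<in> carrier G" "v \<in> SC v"
  obtains A where "arrows pick_index as v = Some A" "finite A"
    "\<And>s. s \<in> A \<Longrightarrow> s \<in> P \<and> v \<star> s \<in> SC v"
    "\<And>b. b \<in> P \<Longrightarrow> v \<star> b \<in> SC v \<Longrightarrow> b \<noteq> \<one> \<Longrightarrow> \<exists>s \<in> A. s \<noteq> \<one> \<and> s \<preceq> b"
proof -
  let ?Q = "\<lambda>n. n > 0 \<and> (slide ^^ n) v = v"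
  have ex: "\<exists>n. ?Q n"
    using v(2) by (auto simp: SC_def Suc_le_eq)
  define N where "N = (LEAST n. ?Q n)"
  have N: "?Q N"
    unfolding N_def by (rule LeastI_ex[OF ex])
  interpret circuit_vertex G P \<Delta> v N
    using N v by unfold_locales auto
  have as': "as ! k \<in> P \<and> as ! k \<noteq> \<one>" if "k < length as" for k
    using that as nth_mem[of k as] by (auto simp: atoms_def)
  have "loop_invariant as 0 ({}, {})"
    by (simp add: loop_invariant_def)
  then obtain A Atoms where loop: "arrows_loop pick_index as v N [0..<length as] ({}, {}) = Some (A, Atoms)"
    and inv: "loop_invariant as (length as) (A, Atoms)"
    using arrows_loop_invariant[of pick_index as 0 "({}, {})"] pick_index as' by auto
  have arrow_in: "r \<in> A" if r: "arrow r" for r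
  proof -
    obtain a where "a \<in> atoms" "a \<preceq> r"
      using atom_below arrowD[OF r] by metis
    then obtain k0 where "k0 < length as" "as ! k0 \<preceq> r"
      using as by (metis in_set_conv_nth)
    then obtain k where "k < length as \<and> as ! k \<preceq> r"
      "\<And>k'. k' < length as \<and> as ! k' \<preceq> r \<Longrightarrow> k' \<le> k"
      using Nat.ex_has_greatest_nat[of "\<lambda>k. k < length as \<and> as ! k \<preceq> r" k0 "length as"]
      by auto
    then have "last_atom as k r" "k < length as"
      by (auto simp: last_atom_def not_less[symmetric])
    then show ?thesis
      using inv r unfolding loop_invariant_def by blast
  qed
  have "search ?Q = Some N"
    unfolding search_def N_def using ex by simp
  then have "arrows pick_index as v = Some A"
    by (simp add: arrows_def loop)
  moreover have A: "finite A" "A \<subseteq> circuit_conjugators"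
    using inv unfolding loop_invariant_def by blast+
  moreover have "s \<in> P \<and> v \<star> s \<in> SC v" if "s \<in> A" for s
    using A that unfolding circuit_conjugators_def by blast
  moreover have "\<exists>s \<in> A. s \<noteq> \<one> \<and> s \<preceq> b" if b: "b \<in> P" "v \<star> b \<in> SC v" "b \<noteq> \<one>" for b
  proof -
    have "b \<in> circuit_conjugators"
      using b by (simp add: circuit_conjugators_def)
    then obtain r where "arrow r" "r \<preceq> b"
      using arrow_below b(3) by blast
    then show ?thesis
      using arrow_in arrowD(5) by blast
  qed
  ultimately show ?thesis
    using that by blast
qed

end

section \<open>Correctness of the algorithm\<close>

context garside_nontrivial
begin

lemma finite_bounded: "finite {g \<in> carrier G. p \<le> infimum g \<and> supremum g \<le> q}"
proof -
  have "{g \<in> carrier G. p \<le> infimum g \<and> supremum g \<le> q}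
      \<subseteq> {g \<in> carrier G. \<Delta> [^] p \<preceq> g \<and> g \<preceq> \<Delta> [^] q}"
    by (auto simp: le_infimum_iff supremum_le_iff)
  then show ?thesis
    using finite_interval[of "\<Delta> [^] p" "\<Delta> [^] q"] finite_subset by blast
qed

lemma finite_SSS:
  assumes "x \<in> carrier G"
  shows "finite (SSS x)"
proof (cases "SSS x = {}")
  case False
  then obtain v where v: "v \<in> SSS x" by blast
  have "SSS x \<subseteq> {g \<in> carrier G. infimum v \<le> infimum g \<and> supremum g \<le> supremum v}"
    using SSS_infimum[OF assms v] SSS_supremum[OF assms v] SSS_carrier[OF assms] by auto
  then show ?thesis
    using finite_bounded finite_subset by blast
qed simp

text \<open>Sliding neither lowers the infimum nor raises the supremum, so the orbit of
  \<open>x\<close> is finite and the first loop ends. The second loop collects an element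
  centralising the point found, so multiplying by its inverse keeps the end point.\<close>

lemma find_circuit_correct:
  assumes x: "x \<in> carrier G"
  obtains c where "find_circuit x = Some (x \<star> c, c)" "c \<in> carrier G" "x \<star> c \<in> SC x"
proof -
  define b where "b = (\<lambda>(xt :: 'a, c :: 'a, T). xt \<notin> T)"
  define f where "f = (\<lambda>(xt, c, T). (slide xt, c \<otimes> preferred_prefix xt, T \<union> {xt}))"
  define R where "R = range (\<lambda>i. (slide ^^ i) x)"
  define I where "I = (\<lambda>(xt, c, T). c \<in> carrier G \<and> xt = x \<star> c \<and>
    (\<exists>n. xt = (slide ^^ n) x \<and> T = (\<lambda>i. (slide ^^ i) x) ` {..<n}))"
  have "R \<subseteq> {g \<in> carrier G. infimum x \<le> infimum g \<and> supremum g \<le> supremum x}"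
    using x infimum_slide_iter supremum_slide_iter by (auto simp: R_def)
  then have R: "finite R"
    using finite_bounded finite_subset by blast
  have step: "I (f s) \<and> card (R - snd (snd (f s))) < card (R - snd (snd s))"
    if s: "I s" "b s" for s
  proof -
    obtain xt c T where st: "s = (xt, c, T)" by (cases s) auto
    obtain n where c: "c \<in> carrier G" "xt = x \<star> c" and n: "xt = (slide ^^ n) x"
      "T = (\<lambda>i. (slide ^^ i) x) ` {..<n}"
      using s(1) unfolding st I_def by auto
    have "slide xt = x \<star> (c \<otimes> preferred_prefix xt)"
      using c x by (simp add: slide_def conj_by_mult)
    moreover have "slide xt = (slide ^^ Suc n) x"
      using n by simp
    moreover have "T \<union> {xt} = (\<lambda>i. (slide ^^ i) x) ` {..<Suc n}"
      using n by (auto simp: lessThan_Suc)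
    ultimately have "I (f s)"
      using c x unfolding st I_def f_def prod.case by blast
    moreover have "xt \<in> R" "xt \<notin> T"
      using n s(2) by (auto simp: st b_def R_def)
    then have "R - (T \<union> {xt}) \<subset> R - T" by blast
    then have "card (R - (T \<union> {xt})) < card (R - T)"
      using R by (intro psubset_card_mono) auto
    ultimately show ?thesis
      by (simp add: st f_def)
  qed
  have init: "I (x, \<one>, {})"
    using x by (auto simp: I_def intro!: exI[of _ 0])
  obtain s where s: "while_option b f (x, \<one>, {}) = Some s"
    using measure_while_option_Some[of I b f "\<lambda>s. card (R - snd (snd s))"] step init by blast
  have "I s" "\<not> b s"
    using while_option_rule[of I b f _ s] step s init while_option_stop[OF s] by blast+
  obtain xt c T where st: "s = (xt, c, T)" by (cases s) auto
  obtain n where c: "c \<in> carrier G" "xt = x \<star> c" and n: "xt = (slide ^^ n) x"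
    "T = (\<lambda>i. (slide ^^ i) x) ` {..<n}"
    using \<open>I s\<close> unfolding st I_def by auto
  obtain i where i: "i < n" "xt = (slide ^^ i) x"
    using \<open>\<not> b s\<close> n by (auto simp: st b_def)
  have "(slide ^^ (n - i)) xt = (slide ^^ (n - i + i)) x"
    using i(2) by (simp only: funpow_add comp_apply)
  then have period: "(slide ^^ (n - i)) xt = xt"
    using i(1) n by simp

  have xt: "xt \<in> carrier G" using c x by simp
  define b2 where "b2 = (\<lambda>(y, d :: 'a). y \<noteq> xt)"
  define f2 where "f2 = (\<lambda>(y, d). (slide y, d \<otimes> preferred_prefix y))"
  define s2 where "s2 = (slide xt, preferred_prefix xt)"
  define J where "J = (\<lambda>(y, d). d \<in> carrier G \<and> y = xt \<star> d)"
  have "fst ((f2 ^^ k) s2) = (slide ^^ Suc k) xt" for k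
    by (induction k) (simp_all add: f2_def s2_def case_prod_unfold)
  \<comment> \<open>The second loop starts one slide ahead, hence one iteration fewer than the
    period \<open>n - i\<close>.\<close>
  from this[of "n - i - 1"] have "\<not> b2 ((f2 ^^ (n - i - 1)) s2)"
    using period i(1) by (simp add: b2_def case_prod_unfold Suc_diff_Suc del: funpow.simps)
  then obtain t where t: "while_option b2 f2 s2 = Some t"
    unfolding while_option_def by (metis option.distinct(1) option.exhaust)
  have "J s2"
    using xt by (simp add: J_def s2_def slide_def)
  moreover have "J (f2 s)" if "J s" "b2 s" for s
    using that xt by (cases s) (simp add: J_def f2_def slide_def conj_by_mult)
  ultimately have "J t"
    using while_option_rule[of J b2 f2 s2 t] t by blast
  moreover have "\<not> b2 t"
    by (rule while_option_stop[OF t])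
  ultimately obtain d where d: "t = (xt, d)" "d \<in> carrier G" "xt = xt \<star> d"
    by (cases t) (auto simp: J_def b2_def)
  have "find_circuit x = Some (xt, c \<otimes> inv d)"
    unfolding find_circuit_def s[unfolded b_def f_def st] Option.bind.bind_lunit prod.case
      t[unfolded b2_def f2_def s2_def d(1)]
    by (rule refl)
  moreover have "x \<star> (c \<otimes> inv d) = xt \<star> inv d"
    using c d x by (simp add: conj_by_mult)
  moreover have "xt \<star> inv d = xt"
    using conj_by_cancel[OF xt d(2)] d(3) by simp
  moreover have "xt \<in> SC x"
    using period i(1) c by (auto simp: SC_def intro!: exI[of _ "n - i"])
  ultimately show ?thesis
    using that[of "c \<otimes> inv d"] c d by simp
qed

text \<open>The conjugates of \<open>v\<close> by powers of \<open>\<Delta>\<close> lie in the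
  finite super summit set, so two coincide and the quotient of the powers centralises
  \<open>v\<close>.\<close>

lemma SSS_Delta_pow_period:
  assumes v: "v \<in> carrier G" "v \<in> SSS v"
  obtains e :: nat where "e \<ge> 1" "\<And>k :: nat. v \<star> (\<Delta> [^] int (e * k)) = v"
proof -
  have "range (\<lambda>k :: nat. v \<star> (\<Delta> [^] int k)) \<subseteq> SSS v"
    using Delta_pow_in_SSS[OF v] by blast
  then have "finite (range (\<lambda>k :: nat. v \<star> (\<Delta> [^] int k)))"
    using finite_SSS v(1) finite_subset by blast
  then obtain i j :: nat where ij: "i < j" "v \<star> (\<Delta> [^] int i) = v \<star> (\<Delta> [^] int j)"
    using finite_range_repetition by blast
  have "\<Delta> [^] int j = \<Delta> [^] int (j - i) \<otimes> \<Delta> [^] int i"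
    using ij(1) Delta_pow_add[of "int (j - i)" "int i"] by simp
  then have "v \<star> (\<Delta> [^] int (j - i)) \<star> (\<Delta> [^] int i) = v \<star> (\<Delta> [^] int i)"
    using ij(2) v by (simp add: conj_by_mult)
  then have "v \<star> (\<Delta> [^] int (j - i)) \<star> (\<Delta> [^] int i) \<star> inv (\<Delta> [^] int i)
      = v \<star> (\<Delta> [^] int i) \<star> inv (\<Delta> [^] int i)"
    by simp
  then have e: "v \<star> (\<Delta> [^] int (j - i)) = v"
    using v by simp
  have "v \<star> (\<Delta> [^] int ((j - i) * k)) = v" for k
  proof (induction k)
    case (Suc k)
    have "\<Delta> [^] int ((j - i) * Suc k) = \<Delta> [^] int ((j - i) * k) \<otimes> \<Delta> [^] int (j - i)"
      using Delta_pow_add[of "int ((j - i) * k)" "int (j - i)"] by (simp add: add.commute)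
    then show ?case
      using Suc e v by (simp add: conj_by_mult)
  qed (use v in simp)
  then show ?thesis
    using that[of "j - i"] ij(1) by simp
qed

text \<open>
  The conjugator is required to be nontrivial, since the algorithm tests the vertices only when
  they are reached along an arrow, even if \<open>w = v\<close>.
\<close>

lemma positive_conjugator:
  assumes v: "v \<in> carrier G" "v \<in> SSS v" and w: "w \<in> conjugates v"
  obtains b where "b \<in> P" "b \<noteq> \<one>" "v \<star> b = w"
proof -
  obtain a where a: "a \<in> carrier G" "w = v \<star> a"
    using w by (auto simp: conjugates_def)
  obtain k where k: "0 \<le> k" "\<Delta> [^] (- k :: int) \<preceq> a"
    using Delta_bounds[OF a(1)] by blast
  obtain e where e: "e \<ge> 1" "\<And>k :: nat. v \<star> (\<Delta> [^] int (e * k)) = v"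
    using SSS_Delta_pow_period[OF v] by blast
  \<comment> \<open>A multiple of \<open>e\<close>, so that \<open>\<Delta> [^] j\<close>
    centralises \<open>v\<close>; exceeding \<open>k\<close> makes \<open>b\<close> nontrivial as
    well as positive.\<close>
  define j where "j = int (e * nat (k + 1))"
  define b where "b = \<Delta> [^] j \<otimes> a"
  have "1 * nat (k + 1) \<le> e * nat (k + 1)"
    using e(1) by (rule mult_le_mono1)
  then have j: "k + 1 \<le> j"
    unfolding j_def by linarith
  have "\<Delta> [^] j \<otimes> \<Delta> [^] (- k) \<preceq> b"
    using k a by (simp add: b_def)
  then have le: "\<Delta> [^] (j - k) \<preceq> b"
    using Delta_pow_add[of j "- k"] by simp
  then have "\<Delta> [^] (0 :: int) \<preceq> b"
    using Delta_pow_mono[of 0 "j - k"] j a le_trans[of "\<Delta> [^] (0 :: int)" "\<Delta> [^] (j - k)" b]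
    by (simp add: b_def)
  then have "b \<in> P"
    using a by (simp add: one_le_iff b_def)
  moreover have "b \<noteq> \<one>"
    using le j Delta_pow_le_iff[of "j - k" 0] by auto
  moreover have "v \<star> b = w"
    using v a e(2)[of "nat (k + 1)"] by (simp add: b_def conj_by_mult j_def)
  ultimately show ?thesis
    using that by blast
qed

text \<open>Left multiplication by \<open>s\<close> embeds the prefixes of \<open>b\<close> into
  those of \<open>s \<otimes> b\<close> and misses \<open>\<one>\<close>.\<close>

lemma card_prefixes_less:
  assumes s: "s \<in> P" "s \<noteq> \<one>" and b: "b \<in> P"
  shows "card {g \<in> carrier G. \<one> \<preceq> g \<and> g \<preceq> b} < card {g \<in> carrier G. \<one> \<preceq> g \<and> g \<preceq> s \<otimes> b}"
proof -
  let ?B = "{g \<in> carrier G. \<one> \<preceq> g \<and> g \<preceq> b}" and ?C = "{g \<in> carrier G. \<one> \<preceq> g \<and> g \<preceq> s \<otimes> b}"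
  have "inj_on ((\<otimes>) s) ?B"
    using s by (auto simp: inj_on_def)
  then have "card ?B = card ((\<otimes>) s ` ?B)"
    by (simp add: card_image)
  also have "\<dots> < card ?C"
  proof (rule psubset_card_mono)
    have "(\<otimes>) s ` ?B \<subseteq> ?C"
    proof
      fix h assume "h \<in> (\<otimes>) s ` ?B"
      then obtain g where "g \<in> P" "g \<preceq> b" "h = s \<otimes> g"
        by (auto simp: one_le_iff)
      then show "h \<in> ?C"
        using s b by (simp add: one_le_iff)
    qed
    moreover have "\<one> \<in> ?C"
      using s b by (simp add: one_le_iff)
    moreover have "\<one> \<notin> (\<otimes>) s ` ?B"
    proof
      assume "\<one> \<in> (\<otimes>) s ` ?B"
      then obtain g where g: "g \<in> ?B" "\<one> = s \<otimes> g"
        by blast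
      have "g \<in> P"
        using g(1) by (auto simp: one_le_iff)
      then have "s \<preceq> \<one>"
        unfolding g(2) using le_mult_positive s(1) by blast
      then show False
        using s le_antisym[of s \<one>] by (simp add: one_le_iff)
    qed
    ultimately show "(\<otimes>) s ` ?B \<subset> ?C" by blast
    show "finite ?C"
      using finite_interval[of \<one> "s \<otimes> b"] s b by simp
  qed
  finally show ?thesis .
qed

text \<open>Descent on the number of prefixes of \<open>b\<close>: splitting off \<open>s\<close>
  leaves a shorter positive conjugator from another vertex of \<open>V\<close>, nontrivial because
  that vertex is not \<open>w\<close>.\<close>

lemma closed_reaches:
  assumes closed: "\<And>v b. v \<in> V \<Longrightarrow> b \<in> P \<Longrightarrow> b \<noteq> \<one> \<Longrightarrow> v \<star> b = w \<Longrightarrow>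
      \<exists>s \<in> P. s \<noteq> \<one> \<and> s \<preceq> b \<and> v \<star> s \<in> V \<and> v \<star> s \<noteq> w"
    and V: "V \<subseteq> carrier G" and v: "v \<in> V" and b: "b \<in> P" "b \<noteq> \<one>"
  shows "v \<star> b \<noteq> w"
  using v b
proof (induction "card {g \<in> carrier G. \<one> \<preceq> g \<and> g \<preceq> b}" arbitrary: v b rule: less_induct)
  case less
  show ?case
  proof
    assume eq: "v \<star> b = w"
    then obtain s where s: "s \<in> P" "s \<noteq> \<one>" "s \<preceq> b" "v \<star> s \<in> V" "v \<star> s \<noteq> w"
      using closed less.prems by blast
    define b' where "b' = inv s \<otimes> b"
    have b': "b' \<in> P" "b = s \<otimes> b'"
      using s less.prems by (auto simp: b'_def le_iff[symmetric])
    have "v \<in> carrier G" using less.prems V by auto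
    then have eq': "v \<star> s \<star> b' = w"
      using eq s b' by (simp add: conj_by_mult)
    moreover have "b' \<noteq> \<one>"
      using eq' s \<open>v \<in> carrier G\<close> by auto
    ultimately show False
      using less.hyps[of b' "v \<star> s"] card_prefixes_less[of s b'] s b' by blast
  qed
qed

text \<open>A new vertex enters both sets, so the set \<open>V - V'\<close> of processed vertices
  does not change during a visit.\<close>

lemma visit_result:
  assumes x: "x \<in> carrier G" and v: "v \<in> V"
    and ss: "\<And>s. s \<in> set ss \<Longrightarrow> s \<in> P \<and> v \<star> s \<in> SC x"
    and V: "V \<subseteq> SC x" "V' \<subseteq> V" and c: "\<And>w. w \<in> V \<Longrightarrow> c w \<in> carrier G \<and> x \<star> c w = w"
  shows "case visit yt v ss (V, V', c) of
      Inl g \<Rightarrow> g \<in> carrier G \<and> x \<star> g = yt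
    | Inr (V1, V1', c1) \<Rightarrow> V \<subseteq> V1 \<and> V1 \<subseteq> SC x \<and> V1' \<subseteq> V1 \<and> V1 - V1' = V - V' \<and>
        (\<forall>w \<in> V1. c1 w \<in> carrier G \<and> x \<star> c1 w = w) \<and>
        (\<forall>s \<in> set ss. v \<star> s \<in> V1 \<and> v \<star> s \<noteq> yt)"
  using v ss V c
proof (induction ss arbitrary: V V' c)
  case Nil
  then show ?case by simp
next
  case (Cons s ss)
  have s: "s \<in> P" "v \<star> s \<in> SC x"
    using Cons.prems(2) by auto
  have conj: "c v \<otimes> s \<in> carrier G" "x \<star> (c v \<otimes> s) = v \<star> s"
    using Cons.prems(5)[OF Cons.prems(1)] s x by (auto simp: conj_by_mult)
  consider "v \<star> s = yt" | "v \<star> s \<noteq> yt" "v \<star> s \<notin> V" | "v \<star> s \<noteq> yt" "v \<star> s \<in> V"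
    by blast
  then show ?case
  proof cases
    case 1
    then show ?thesis using conj by simp
  next
    case 2
    let ?V = "V \<union> {v \<star> s}" and ?V' = "V' \<union> {v \<star> s}" and ?c = "c(v \<star> s := c v \<otimes> s)"
    have "?V - ?V' = V - V'" using 2 by blast
    moreover have "case visit yt v ss (?V, ?V', ?c) of
      Inl g \<Rightarrow> g \<in> carrier G \<and> x \<star> g = yt
    | Inr (V1, V1', c1) \<Rightarrow> ?V \<subseteq> V1 \<and> V1 \<subseteq> SC x \<and> V1' \<subseteq> V1 \<and> V1 - V1' = ?V - ?V' \<and>
        (\<forall>w \<in> V1. c1 w \<in> carrier G \<and> x \<star> c1 w = w) \<and>
        (\<forall>s \<in> set ss. v \<star> s \<in> V1 \<and> v \<star> s \<noteq> yt)"
      using Cons.prems s conj by (intro Cons.IH) auto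
    ultimately show ?thesis
      using 2 by (auto split: sum.splits)
  next
    case 3
    have "case visit yt v ss (V, V', c) of
      Inl g \<Rightarrow> g \<in> carrier G \<and> x \<star> g = yt
    | Inr (V1, V1', c1) \<Rightarrow> V \<subseteq> V1 \<and> V1 \<subseteq> SC x \<and> V1' \<subseteq> V1 \<and> V1 - V1' = V - V' \<and>
        (\<forall>w \<in> V1. c1 w \<in> carrier G \<and> x \<star> c1 w = w) \<and>
        (\<forall>s \<in> set ss. v \<star> s \<in> V1 \<and> v \<star> s \<noteq> yt)"
      using Cons.prems by (intro Cons.IH) auto
    then show ?thesis
      using 3 by (auto split: sum.splits)
  qed
qed

text \<open>Each round processes a new vertex of the finite set \<open>SC x\<close>. By
  \<open>closed\<close>, edges from processed vertices stay in \<open>V\<close> and avoid the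
  target; when \<open>V'\<close> is empty this holds on all of \<open>V\<close>, and
  \<open>closed_reaches\<close> excludes a conjugator.\<close>

theorem explore_correct:
  assumes as: "set as = atoms"
    and pick: "\<And>W. W \<noteq> {} \<Longrightarrow> pick W \<in> W"
    and pick_index: "\<And>v a M. M \<noteq> {} \<Longrightarrow> pick_index v a M \<in> M"
    and enum: "\<And>v A. finite A \<Longrightarrow> set (enum v A) = A"
    and x: "x \<in> carrier G" "x \<in> SC x" and yt: "yt \<in> carrier G" "yt \<in> SC yt"
    and V: "x \<in> V" "V \<subseteq> SC x" "V' \<subseteq> V"
    and c: "\<And>w. w \<in> V \<Longrightarrow> c w \<in> carrier G \<and> x \<star> c w = w"
    and closed: "\<And>v A s. v \<in> V - V' \<Longrightarrow> arrows pick_index as v = Some A \<Longrightarrow> s \<in> A \<Longrightarrow>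
      v \<star> s \<in> V \<and> v \<star> s \<noteq> yt"
  shows "\<exists>answer. explore pick pick_index enum as yt V V' c = Some answer \<and>
    (case answer of Conjugate_by g \<Rightarrow> g \<in> carrier G \<and> x \<star> g = yt
     | Not_conjugate \<Rightarrow> yt \<notin> conjugates x)"
  using V c closed
proof (induction "card (SC x - (V - V'))" arbitrary: V V' c rule: less_induct)
  case less
  have SC: "v \<in> carrier G" "v \<in> SC v" "SC v = SC x" if "v \<in> SC x" for v
    using that x(1) SC_eq[of x v] conjugates_closed[of x v] by (auto simp: SC_def)
  have arrows: "\<exists>A. arrows pick_index as v = Some A \<and> finite A \<and> (\<forall>s \<in> A. s \<in> P \<and> v \<star> s \<in> SC x) \<and>
      (\<forall>b. b \<in> P \<longrightarrow> v \<star> b \<in> SC x \<longrightarrow> b \<noteq> \<one> \<longrightarrow> (\<exists>s \<in> A. s \<noteq> \<one> \<and> s \<preceq> b))"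
    if "v \<in> SC x" for v
    by (rule arrows_correct[of pick_index as v])
      (use pick_index as SC[OF that] in \<open>auto\<close>)
  show ?case
  proof (cases "V' = {}")
    case True
    have "yt \<notin> conjugates x"
    proof
      assume conj: "yt \<in> conjugates x"
      then have yt_SC: "yt \<in> SC x"
        using SC_eq x yt by auto
      have "\<exists>s \<in> P. s \<noteq> \<one> \<and> s \<preceq> b \<and> v \<star> s \<in> V \<and> v \<star> s \<noteq> yt"
        if b: "v \<in> V" "b \<in> P" "b \<noteq> \<one>" "v \<star> b = yt" for v b
      proof -
        obtain A where A: "arrows pick_index as v = Some A" "\<forall>s \<in> A. s \<in> P \<and> v \<star> s \<in> SC x"
          "\<forall>b. b \<in> P \<longrightarrow> v \<star> b \<in> SC x \<longrightarrow> b \<noteq> \<one> \<longrightarrow> (\<exists>s \<in> A. s \<noteq> \<one> \<and> s \<preceq> b)"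
          using arrows[of v] b(1) less.prems(2) by blast
        then obtain s where "s \<in> A" "s \<noteq> \<one>" "s \<preceq> b"
          using b yt_SC by blast
        then show ?thesis
          using A(2) less.prems(5)[of v A s] A(1) b(1) True by blast
      qed
      moreover have "V \<subseteq> carrier G"
        using less.prems(2) SC(1) by blast
      moreover obtain b where "b \<in> P" "b \<noteq> \<one>" "x \<star> b = yt"
        using positive_conjugator[OF x(1) _ conj] SC_subset_SSS[OF x(1)] x(2) by blast
      ultimately show False
        using closed_reaches[of V yt x b] less.prems(1) by blast
    qed
    then show ?thesis
      using True by (simp add: explore.simps)
  next
    case False
    define v where "v = pick V'"
    have v: "v \<in> V'" "v \<in> V" "v \<in> SC x"
      using pick[OF False] less.prems(2,3) by (auto simp: v_def)
    obtain A where A: "arrows pick_index as v = Some A" "finite A" "\<forall>s \<in> A. s \<in> P \<and> v \<star> s \<in> SC x"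
      using arrows[OF v(3)] by blast
    have visit: "case visit yt v (enum v A) (V, V', c) of
        Inl g \<Rightarrow> g \<in> carrier G \<and> x \<star> g = yt
      | Inr (V1, V1', c1) \<Rightarrow> V \<subseteq> V1 \<and> V1 \<subseteq> SC x \<and> V1' \<subseteq> V1 \<and> V1 - V1' = V - V' \<and>
          (\<forall>w \<in> V1. c1 w \<in> carrier G \<and> x \<star> c1 w = w) \<and>
          (\<forall>s \<in> set (enum v A). v \<star> s \<in> V1 \<and> v \<star> s \<noteq> yt)"
      using A(3) enum[OF A(2)] by (intro visit_result[OF x(1) v(2) _ less.prems(2,3,4)]) auto
    show ?thesis
    proof (cases "visit yt v (enum v A) (V, V', c)")
      case (Inl g)
      then show ?thesis
        using visit False A(1) by (simp add: explore.simps v_def[symmetric] Let_def)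
    next
      case (Inr r)
      obtain V1 V1' c1 where r: "r = (V1, V1', c1)" by (cases r)
      have V1: "V \<subseteq> V1" "V1 \<subseteq> SC x" "V1' \<subseteq> V1" "V1 - V1' = V - V'"
        and c1: "\<And>w. w \<in> V1 \<Longrightarrow> c1 w \<in> carrier G \<and> x \<star> c1 w = w"
        and reached: "\<And>s. s \<in> A \<Longrightarrow> v \<star> s \<in> V1 \<and> v \<star> s \<noteq> yt"
        using visit enum[OF A(2), of v] by (auto simp: Inr r)
      have processed: "V1 - (V1' - {v}) = insert v (V - V')"
        using V1 v by blast
      have "finite (SC x)"
        using finite_SSS[OF x(1)] SC_subset_SSS[OF x(1)] finite_subset by blast
      then have "card (SC x - (V1 - (V1' - {v}))) < card (SC x - (V - V'))"
        unfolding processed using v by (intro psubset_card_mono) auto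
      moreover have "u \<star> s \<in> V1 \<and> u \<star> s \<noteq> yt"
        if "u \<in> V1 - (V1' - {v})" "arrows pick_index as u = Some B" "s \<in> B" for u B s
      proof (cases "u = v")
        case True
        then show ?thesis using that(2,3) A(1) reached[of s] by simp
      next
        case False
        then have "u \<in> V - V'"
          using that(1) unfolding processed by blast
        then show ?thesis using that(2,3) less.prems(5)[of u B s] V1(1) by blast
      qed
      ultimately have "\<exists>answer. explore pick pick_index enum as yt V1 (V1' - {v}) c1 = Some answer \<and>
          (case answer of Conjugate_by g \<Rightarrow> g \<in> carrier G \<and> x \<star> g = yt
           | Not_conjugate \<Rightarrow> yt \<notin> conjugates x)"
        using less.prems(1) V1 c1 by (intro less.hyps) auto
      then show ?thesis
        using False A(1) by (subst explore.simps) (simp add: v_def[symmetric] Let_def Inr r)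
    qed
  qed
qed

end

text \<open>The list \<open>as\<close> and the functions \<open>pick\<close>,
  \<open>pick_index\<close> and \<open>enum\<close> are arbitrary, which covers every resolution of
  the choices left open by the algorithms; the result \<open>Some\<close> expresses
  termination.\<close>

theorem mainTheorem1:
  fixes G :: "('a, 'b) monoid_scheme" (structure)
    and P :: "'a set" and \<Delta> x y :: 'a
    and as :: "'a list"
    and pick :: "'a set \<Rightarrow> 'a"
    and pick_index :: "'a \<Rightarrow> 'a \<Rightarrow> nat set \<Rightarrow> nat"
    and enum :: "'a \<Rightarrow> 'a set \<Rightarrow> 'a list"
  assumes garside: "garside_finite_type G P \<Delta>"
    and nontrivial: "carrier G \<noteq> {\<one>}"
    and atom_list: "distinct as" "set as = garside_data.atoms G P"
    and pick: "\<And>W. W \<noteq> {} \<Longrightarrow> pick W \<in> W"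
    and pick_index: "\<And>v a M. M \<noteq> {} \<Longrightarrow> pick_index v a M \<in> M"
    and enum: "\<And>v A. finite A \<Longrightarrow> distinct (enum v A) \<and> set (enum v A) = A"
    and x: "x \<in> carrier G" and y: "y \<in> carrier G"
  shows "\<exists>answer. garside_data.solve_conjugacy G P \<Delta> pick pick_index enum as x y = Some answer \<and>
    (y \<in> garside_data.conjugates G x \<longrightarrow>
      (\<exists>c \<in> carrier G. answer = Conjugate_by c \<and> inv c \<otimes> x \<otimes> c = y)) \<and>
    (y \<notin> garside_data.conjugates G x \<longrightarrow> answer = Not_conjugate)"
proof -
  interpret garside_nontrivial G P \<Delta>
    using garside nontrivial by (simp add: garside_nontrivial_def garside_nontrivial_axioms_def)
  obtain c1 where c1: "find_circuit x = Some (x \<star> c1, c1)" "c1 \<in> carrier G" "x \<star> c1 \<in> SC x"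
    using find_circuit_correct[OF x] by blast
  obtain c2 where c2: "find_circuit y = Some (y \<star> c2, c2)" "c2 \<in> carrier G" "y \<star> c2 \<in> SC y"
    using find_circuit_correct[OF y] by blast
  let ?xt = "x \<star> c1" and ?yt = "y \<star> c2"
  have xt: "?xt \<in> carrier G" "?xt \<in> SC ?xt" and yt: "?yt \<in> carrier G" "?yt \<in> SC ?yt"
    using c1 c2 x y SC_eq by auto
  obtain answer where answer:
    "explore pick pick_index enum as ?yt {?xt} {?xt} ((\<lambda>_. undefined)(?xt := \<one>)) = Some answer"
    "case answer of Conjugate_by g \<Rightarrow> g \<in> carrier G \<and> ?xt \<star> g = ?yt
     | Not_conjugate \<Rightarrow> ?yt \<notin> conjugates ?xt"
    using explore_correct[of as pick pick_index enum ?xt ?yt "{?xt}" "{?xt}"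
        "(\<lambda>_. undefined)(?xt := \<one>)"] atom_list(2) pick pick_index enum xt yt by auto
  have solve: "solve_conjugacy pick pick_index enum as x y = Some (case answer of
      Conjugate_by g \<Rightarrow> Conjugate_by (c1 \<otimes> g \<otimes> inv c2) | Not_conjugate \<Rightarrow> Not_conjugate)"
    by (simp add: solve_conjugacy_def c1(1) c2(1) answer(1))
  have conjugates: "conjugates ?xt = conjugates x" "conjugates ?yt = conjugates y"
    by (rule conjugates_eq[OF x conj_by_in_conjugates[OF c1(2)]],
        rule conjugates_eq[OF y conj_by_in_conjugates[OF c2(2)]])
  show ?thesis
  proof (cases answer)
    case (Conjugate_by g)
    then have g: "g \<in> carrier G" "?xt \<star> g = ?yt"
      using answer(2) by auto
    have eq: "x \<star> (c1 \<otimes> g \<otimes> inv c2) = y"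
      using g c1 c2 x y by (simp add: conj_by_mult)
    then have "y \<in> conjugates x"
      using g c1 c2 conj_by_in_conjugates[of "c1 \<otimes> g \<otimes> inv c2" x] by simp
    then show ?thesis
      using solve Conjugate_by eq g c1 c2 by (auto simp: conj_by_def)
  next
    case Not_conjugate
    then have "?yt \<notin> conjugates x"
      using answer(2) conjugates by simp
    then have "y \<notin> conjugates x"
      using conjugates_eq[of x y] x c2(2) conj_by_in_conjugates[of c2 y] by auto
    then show ?thesis
      using solve Not_conjugate by auto
  qed
qed

end
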